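(* Suppose that $\langle f,g\rangle$ is a Kleinian group generated by two elements $f$ and $g$ with principal character $(\gamma,\beta,-4)$. Then $$|\gamma|+|\beta+2|\geq \frac{\sqrt5-1}{2}.$$ This inequality is sharp for the $(2,4,5)$ hyperbolic triangle group with the parameters $\left(\frac{\sqrt5-1}{2},-2,-4\right)$.
   Context: The group $\mathrm{Isom}^+(\mathbb{H}^3)$ of orientation-preserving isometries of hyperbolic 3-space is identified with $\mathrm{PSL}(2,\mathbb{C})$. A subgroup is elementary if the accumulation set in $\overline{\mathbb{H}^3}=\mathbb{H}^3\cup\overline{\mathbb{C}}$ of the orbit of an arbitrary point of $\mathbb{H}^3$ is finite. A Kleinian group is a discrete non-elementary subgroup. For $f,g\in\mathrm{PSL}(2,\mathbb{C})$ set $\beta(f)=\mathrm{tr}^2(f)-4$ and $\gamma(f,g)=\mathrm{tr}([f,g])-2$, where $[f,g]=fgf^{-1}g^{-1}$. The principal character (or parameters) of $\langle f,g\rangle$ is the triple $(\gamma(f,g),\beta(f),\beta(g))\in\mathbb{C}^3$; here $\gamma=\gamma(f,g)$, $\beta=\beta(f)$, and $\beta(g)=-4$ (so $g$ has order two). The $(2,4,5)$ hyperbolic triangle group is the orientation-preserving (Fuchsian) triangle group, viewed in $\mathrm{PSL}(2,\mathbb{R})\subset\mathrm{PSL}(2,\mathbb{C})$; sharpness means that this group has generators $f,g$ with the stated parameters, for which equality holds. *)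

theory Defs
  imports "HOL-Analysis.Analysis" "HOL-Algebra.Generated_Groups" "HOL-Algebra.Bij"
begin

section \<open>The group PSL(2,C)\<close>

definition SL2C :: "(complex^2^2) monoid" where
  "SL2C = \<lparr>carrier = {A. det A = 1}, mult = (**), one = mat 1\<rparr>"

text \<open>Elements of \<open>PSL2C\<close> are cosets, i.e. sets \<open>{A, -A}\<close> with \<open>det A = 1\<close>
  (see \<open>carrier_PSL2C\<close> below).\<close>

definition PSL2C :: "(complex^2^2) set monoid" where
  "PSL2C = SL2C Mod {mat 1, - mat 1}"

lemma carrier_SL2C [simp]: "carrier SL2C = {A. det A = 1}"
  and mult_SL2C [simp]: "A \<otimes>\<^bsub>SL2C\<^esub> B = A ** B"
  and one_SL2C [simp]: "\<one>\<^bsub>SL2C\<^esub> = mat 1"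
  by (simp_all add: SL2C_def)

lemma matrix_mult_minus_left: "(- A) ** B = - (A ** B)" for A B :: "complex^2^2"
  by (simp add: vec_eq_iff matrix_matrix_mult_def sum_negf)

lemma matrix_mult_minus_right: "A ** (- B) = - (A ** B)" for A B :: "complex^2^2"
  by (simp add: vec_eq_iff matrix_matrix_mult_def sum_negf)

lemma det_minus_2: "det (- A) = det A" for A :: "complex^2^2"
  by (simp add: det_2)

lemma det_one_inverse:
  fixes A :: "complex^2^2"
  assumes "det A = 1"
  shows "A ** matrix_inv A = mat 1" "matrix_inv A ** A = mat 1" "det (matrix_inv A) = 1"
proof -
  have inv: "invertible A"
    using assms by (simp add: invertible_det_nz)
  then show 1: "A ** matrix_inv A = mat 1" and "matrix_inv A ** A = mat 1"
    unfolding invertible_def matrix_inv_def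
    by (metis (mono_tags, lifting) someI_ex)+
  have "det A * det (matrix_inv A) = 1"
    using arg_cong [OF 1, of det] by (simp add: det_mul)
  then show "det (matrix_inv A) = 1"
    using assms by simp
qed

lemma group_SL2C: "group SL2C"
proof (rule groupI)
  fix A assume "A \<in> carrier SL2C"
  then show "\<exists>B\<in>carrier SL2C. B \<otimes>\<^bsub>SL2C\<^esub> A = \<one>\<^bsub>SL2C\<^esub>"
    using det_one_inverse [of A] by auto
qed (auto simp: det_mul matrix_mul_assoc)

lemma normal_pm_one: "{mat 1, - mat 1} \<lhd> SL2C"
proof -
  interpret group SL2C by (rule group_SL2C)
  have m: "inv\<^bsub>SL2C\<^esub> (- mat 1) = - mat 1"
    by (rule inv_equality) (auto simp: det_minus_2 matrix_mult_minus_left)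
  have "inv\<^bsub>SL2C\<^esub> (mat 1) = mat 1"
    using inv_one by simp
  with m have "subgroup {mat 1, - mat 1} SL2C"
    by (intro subgroupI)
      (auto simp: det_minus_2 matrix_mult_minus_left matrix_mult_minus_right)
  then show ?thesis
    by (auto simp: normal_def normal_axioms_def group_SL2C r_coset_def l_coset_def
        matrix_mult_minus_left matrix_mult_minus_right)
qed

lemma group_PSL2C: "group PSL2C"
  unfolding PSL2C_def by (rule normal.factorgroup_is_group [OF normal_pm_one])

lemma carrier_PSL2C: "X \<in> carrier PSL2C \<longleftrightarrow> (\<exists>A. det A = 1 \<and> X = {A, - A})"
  by (auto simp: PSL2C_def FactGroup_def RCOSETS_def r_coset_def
      matrix_mult_minus_left matrix_mult_minus_right)

definition PSL2C_topology :: "(complex^2^2) set topology" where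
  "PSL2C_topology =
     topology (\<lambda>U. U \<subseteq> carrier PSL2C \<and> openin (top_of_set (carrier SL2C)) (\<Union>U))"

lemma Union_Int_PSL2C:
  assumes "U \<subseteq> carrier PSL2C" "V \<subseteq> carrier PSL2C"
  shows "\<Union>(U \<inter> V) = \<Union>U \<inter> \<Union>V"
proof -
  have "X = Y" if "X \<in> carrier PSL2C" "Y \<in> carrier PSL2C" "A \<in> X" "A \<in> Y" for X Y A
    using that by (auto simp: carrier_PSL2C)
  then show ?thesis
    using assms by blast
qed

text \<open>This is the quotient topology: \<open>\<Union>U\<close> is the preimage of \<open>U\<close> in \<open>SL2C\<close>.\<close>

lemma openin_PSL2C_topology:
  "openin PSL2C_topology U \<longleftrightarrow>
     U \<subseteq> carrier PSL2C \<and> openin (top_of_set (carrier SL2C)) (\<Union>U)"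
proof -
  let ?P = "\<lambda>U. U \<subseteq> carrier PSL2C \<and> openin (top_of_set (carrier SL2C)) (\<Union>U)"
  have "?P (\<Union>K)" if K: "\<forall>U\<in>K. ?P U" for K
  proof -
    have "\<Union>(\<Union>K) = \<Union>(Union ` K)"
      by blast
    moreover have "openin (top_of_set (carrier SL2C)) (\<Union>(Union ` K))"
      using K by (intro openin_Union) blast
    ultimately show ?thesis
      using K by (metis Sup_least)
  qed
  moreover have "?P (U \<inter> V)" if "?P U" "?P V" for U V
    using that by (metis Union_Int_PSL2C openin_Int le_infI1)
  ultimately have "istopology ?P"
    unfolding istopology_def by blast
  then show ?thesis
    by (simp add: PSL2C_topology_def)
qed


section \<open>Parameters of two-generator groups\<close>

definition lift :: "(complex^2^2) set \<Rightarrow> complex^2^2" where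
  "lift X = (SOME A. A \<in> X)"

definition beta :: "(complex^2^2) set \<Rightarrow> complex" where
  "beta f = (trace (lift f))\<^sup>2 - 4"

definition gamma :: "(complex^2^2) set \<Rightarrow> (complex^2^2) set \<Rightarrow> complex" where
  "gamma f g =
     trace (lift f ** lift g ** matrix_inv (lift f) ** matrix_inv (lift g)) - 2"

definition principal_character ::
    "(complex^2^2) set \<Rightarrow> (complex^2^2) set \<Rightarrow> complex \<times> complex \<times> complex" where
  "principal_character f g = (gamma f g, beta f, beta g)"

text \<open>The parameters do not depend on the chosen lifts.\<close>

lemma lift_cases:
  assumes "X \<in> carrier PSL2C" "A \<in> X"
  shows "lift X = A \<or> lift X = - A"
proof -
  have "lift X \<in> X"
    unfolding lift_def using assms(2) by (rule someI)
  with assms show ?thesis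
    by (auto simp: carrier_PSL2C)
qed

lemma beta_eq:
  assumes "X \<in> carrier PSL2C" "A \<in> X"
  shows "beta X = (trace A)\<^sup>2 - 4"
  using lift_cases [OF assms] by (auto simp: beta_def trace_def sum_negf)

lemma matrix_inv_minus:
  fixes A :: "complex^2^2"
  assumes "det A = 1"
  shows "matrix_inv (- A) = - matrix_inv A"
proof -
  have "matrix_inv (- A) ** (- A) = mat 1"
    using det_one_inverse(2) [of "- A"] assms by (simp add: det_minus_2)
  then have "(- matrix_inv (- A)) ** A = mat 1"
    by (simp add: matrix_mult_minus_left matrix_mult_minus_right)
  then have "- matrix_inv (- A) = matrix_inv A"
    by (metis assms det_one_inverse(1) matrix_mul_assoc matrix_mul_lid matrix_mul_rid)
  then show ?thesis
    by (metis minus_minus)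
qed

lemma gamma_eq:
  assumes "X \<in> carrier PSL2C" "A \<in> X" "Y \<in> carrier PSL2C" "B \<in> Y"
  shows "gamma X Y = trace (A ** B ** matrix_inv A ** matrix_inv B) - 2"
proof -
  have "det A = 1" "det B = 1"
    using assms by (auto simp: carrier_PSL2C det_minus_2)
  then show ?thesis
    using lift_cases [OF assms(1,2)] lift_cases [OF assms(3,4)]
    by (auto simp: gamma_def matrix_inv_minus matrix_mult_minus_left matrix_mult_minus_right)
qed


section \<open>Kleinian groups\<close>

text \<open>Upper half-space model: \<open>(z, t)\<close> stands for \<open>z + t j\<close>.\<close>

definition hyp_space :: "(complex \<times> real) set" where
  "hyp_space = {(z, t). t > 0}"

text \<open>The closed ball \<open>H^3 \<union> C \<union> {\<infinity>}\<close>; the point \<open>None\<close> is \<open>\<infinity>\<close>, and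
  \<open>Some (z, 0)\<close> is the boundary point \<open>z\<close>.\<close>

definition closed_hyp_space :: "(complex \<times> real) option topology" where
  "closed_hyp_space = Alexandroff_compactification (top_of_set {(z, t). t \<ge> 0})"

text \<open>The Poincare extension of \<open>z \<mapsto> (az + b) / (cz + d)\<close>; it is the same for \<open>A\<close> and \<open>- A\<close>.\<close>

definition poincare_extension :: "complex^2^2 \<Rightarrow> complex \<times> real \<Rightarrow> complex \<times> real" where
  "poincare_extension A = (\<lambda>(z, t).
     let a = A$1$1; b = A$1$2; c = A$2$1; d = A$2$2;
         N = (cmod (c * z + d))\<^sup>2 + (cmod c)\<^sup>2 * t\<^sup>2
     in (((a * z + b) * cnj (c * z + d) + a * cnj c * of_real (t\<^sup>2)) / of_real N, t / N))"

definition psl_orbit :: "(complex^2^2) set set \<Rightarrow> complex \<times> real \<Rightarrow> (complex \<times> real) set" where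
  "psl_orbit G p = {poincare_extension A p |A. A \<in> \<Union>G}"

definition elementary :: "(complex^2^2) set set \<Rightarrow> bool" where
  "elementary G \<longleftrightarrow>
     (\<forall>p\<in>hyp_space. finite (closed_hyp_space derived_set_of (Some ` psl_orbit G p)))"

definition kleinian :: "(complex^2^2) set set \<Rightarrow> bool" where
  "kleinian G \<longleftrightarrow> subgroup G PSL2C
     \<and> subtopology PSL2C_topology G = discrete_topology G
     \<and> \<not> elementary G"


section \<open>Hyperbolic triangle groups\<close>

definition hyp_plane :: "complex set" where
  "hyp_plane = {z. Im z > 0}"

text \<open>The isometry from \<open>hyp_plane\<close> onto the Poincare disc that sends \<open>u\<close> to \<open>0\<close>, and its inverse.
  Geodesics through \<open>u\<close> become diameters, and angles at \<open>u\<close> become Euclidean angles at \<open>0\<close>.\<close>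

definition to_disc :: "complex \<Rightarrow> complex \<Rightarrow> complex" where
  "to_disc u z = (z - u) / (z - cnj u)"

definition from_disc :: "complex \<Rightarrow> complex \<Rightarrow> complex" where
  "from_disc u w = (u - cnj u * w) / (1 - w)"

definition hyp_angle :: "complex \<Rightarrow> complex \<Rightarrow> complex \<Rightarrow> real" where
  "hyp_angle u v w = \<bar>Arg (to_disc u v / to_disc u w)\<bar>"
  \<comment> \<open>the angle at \<open>u\<close> of the triangle \<open>u v w\<close>\<close>

text \<open>The reflection in the geodesic through two points \<open>u \<noteq> v\<close>, which is the conjugate of the
  Euclidean reflection in the diameter through \<open>to_disc u v\<close>.\<close>

definition hyp_reflection :: "complex \<Rightarrow> complex \<Rightarrow> complex \<Rightarrow> complex" where
  "hyp_reflection u v = (\<lambda>z\<in>hyp_plane.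
     from_disc u (to_disc u v / cnj (to_disc u v) * cnj (to_disc u z)))"

definition reflection_group :: "complex \<Rightarrow> complex \<Rightarrow> complex \<Rightarrow> (complex \<Rightarrow> complex) set" where
  "reflection_group u v w =
     generate (BijGroup hyp_plane) {hyp_reflection u v, hyp_reflection v w, hyp_reflection w u}"

definition moebius :: "complex^2^2 \<Rightarrow> complex \<Rightarrow> complex" where
  "moebius A = (\<lambda>z\<in>hyp_plane. (A$1$1 * z + A$1$2) / (A$2$1 * z + A$2$2))"

definition PSL2R :: "(complex^2^2) set set" where
  "PSL2R = {X \<in> carrier PSL2C. \<forall>A\<in>X. \<forall>i j. A$i$j \<in> \<real>}"

text \<open>\<open>PSL2R\<close> acts on \<open>hyp_plane\<close> as the group of orientation-preserving isometries, so this is the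
  orientation-preserving subgroup of the reflection group.\<close>

definition orientation_preserving_group ::
    "complex \<Rightarrow> complex \<Rightarrow> complex \<Rightarrow> (complex^2^2) set set" where
  "orientation_preserving_group u v w =
     {X \<in> PSL2R. \<forall>A\<in>X. moebius A \<in> reflection_group u v w}"

text \<open>Triangle groups are determined by the angles only up to conjugacy, hence a predicate.
  For \<open>p, q, r \<ge> 2\<close> the angle conditions force \<open>u v w\<close> to be a nondegenerate triangle, since
  \<open>hyp_angle\<close> is \<open>0\<close> or \<open>pi\<close> in the degenerate cases.\<close>

definition is_triangle_group :: "nat \<Rightarrow> nat \<Rightarrow> nat \<Rightarrow> (complex^2^2) set set \<Rightarrow> bool" where
  "is_triangle_group p q r G \<longleftrightarrow>
     (\<exists>u\<in>hyp_plane. \<exists>v\<in>hyp_plane. \<exists>w\<in>hyp_plane.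
        hyp_angle u v w = pi / real p \<and> hyp_angle v w u = pi / real q \<and>
        hyp_angle w u v = pi / real r \<and> G = orientation_preserving_group u v w)"

end

theory Submission
  imports Defs
begin

text \<open>Lower bound. Conjugate \<open>f\<close> to \<open>F = diag(l, 1/l)\<close> and put \<open>\<delta> = \<beta> + 2\<close>, \<open>\<beta> = \<beta>(f)\<close>. Starting from
  \<open>k = g F g^-1\<close>, iterate \<open>k \<mapsto> h F h^-1\<close> with \<open>h = k F k\<close>. The parameter \<open>\<sigma> = \<gamma>(F, -)\<close> changes by
  \<open>\<sigma> \<mapsto> \<sigma> (\<sigma> + 2 - \<delta>) (\<sigma> - \<delta>)^2\<close>; since \<open>r^2 (2 + r) = 1\<close> for \<open>r = (sqrt 5 - 1) / 2\<close>, it contracts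
  to \<open>0\<close> as soon as \<open>|\<sigma>| + |\<delta>| < r\<close>. After conjugation by powers of \<open>F\<close> the matrices \<open>k\<close> then converge
  to \<open>F\<close>, so by discreteness some \<open>k\<close> is diagonal. Going back, either \<open>g\<close> was diagonal or some
  \<open>F k\<close> has order two; in the latter case Jorgensen's inequality for \<open>F^4\<close> and \<open>F k\<close> fails. If
  \<open>\<gamma> = 0\<close>, then \<open>f\<close> and \<open>g\<close> have a common fixed point and the group is elementary.

  Sharpness. Products of reflections in the sides of the triangle give generators of orders 4 and 2
  whose product has order 5. The group lies in an order of a quaternion algebra over \<open>Q(sqrt 5)\<close>
  whose norm form is definite at the conjugate place, hence it is discrete. It is non-elementary as
  the fixed points of conjugates of the hyperbolic commutator accumulate orbits.\<close>

section \<open>Two by two matrices\<close>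

text \<open>The word \<open>k F k\<close> suits Cayley-Hamilton: with
  \<open>\<tau> = tr (F k)\<close> one has \<open>k F k = \<tau> k - F^-1\<close>, so the
  off-diagonal entries are multiplied by \<open>\<tau> = \<delta> - \<sigma>\<close>. This is small
  when F is almost of order four, as \<open>\<delta>\<close> is the trace of \<open>F^2\<close>. The
  obstacle is that traces see only the product \<open>b c\<close> of the off-diagonal entries of
  \<open>k\<close>; one may grow while the other shrinks. Their growth rates tend to reciprocal
  powers of \<open>l\<close> times a factor of modulus below 1, and conjugation by powers of F
  removes these powers. The second obstacle is \<open>\<tau> = 0\<close>: then the next
  \<open>k\<close> is F itself and nothing follows about the earlier ones. There
  \<open>\<delta>\<close> is very small, so \<open>F^4\<close> is close to \<open>- mat 1\<close>.
  For sharpness every triangle with the given angles is treated at once: the angles enter only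
  through the traces of A, B and A B, which fix the multiplication table of 1, A, B, A B. The trace
  \<open>sqrt 2\<close> of A is not in \<open>Q(sqrt 5)\<close>, which forces the bookkeeping of
  word parity.\<close>

definition mk2 :: "complex \<Rightarrow> complex \<Rightarrow> complex \<Rightarrow> complex \<Rightarrow> complex^2^2" where
  "mk2 a b c d = vector [vector [a, b], vector [c, d]]"

lemma mk2_nth [simp]:
  "mk2 a b c d $ 1 $ 1 = a" "mk2 a b c d $ 1 $ 2 = b"
  "mk2 a b c d $ 2 $ 1 = c" "mk2 a b c d $ 2 $ 2 = d"
  by (simp_all add: mk2_def)

lemma mk2_eq_iff [simp]: "mk2 a b c d = mk2 a' b' c' d' \<longleftrightarrow> a = a' \<and> b = b' \<and> c = c' \<and> d = d'"
  by (auto simp: vec_eq_iff forall_2)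

lemma mk2_eta: "A = mk2 (A$1$1) (A$1$2) (A$2$1) (A$2$2)"
  by (simp add: vec_eq_iff forall_2)

lemma mk2_cases: obtains a b c d where "A = mk2 a b c d"
  using mk2_eta by blast

lemma mk2_mult [simp]:
  "mk2 a b c d ** mk2 a' b' c' d' =
     mk2 (a * a' + b * c') (a * b' + b * d') (c * a' + d * c') (c * b' + d * d')"
  by (simp add: vec_eq_iff forall_2 matrix_matrix_mult_def sum_2)

lemma mk2_det [simp]: "det (mk2 a b c d) = a * d - b * c"
  by (simp add: det_2)

lemma mk2_trace [simp]: "trace (mk2 a b c d) = a + d"
  by (simp add: trace_def sum_2)

lemma mk2_uminus [simp]: "- mk2 a b c d = mk2 (- a) (- b) (- c) (- d)"
  by (simp add: vec_eq_iff forall_2)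

lemma mat_1_mk2: "(mat 1 :: complex^2^2) = mk2 1 0 0 1"
  by (simp add: vec_eq_iff forall_2 mat_def)

lemma matrix_inv_unique:
  fixes A :: "complex^2^2"
  assumes "det A = 1" "A ** B = mat 1"
  shows "matrix_inv A = B"
proof -
  have "matrix_inv A = matrix_inv A ** (A ** B)"
    by (simp add: assms)
  also have "\<dots> = (matrix_inv A ** A) ** B"
    by (simp only: matrix_mul_assoc)
  finally show ?thesis
    by (simp add: assms det_one_inverse)
qed

lemma matrix_inv_mk2:
  assumes "a * d - b * c = 1"
  shows "matrix_inv (mk2 a b c d) = mk2 d (- b) (- c) a"
  by (rule matrix_inv_unique) (use assms in \<open>auto simp: mat_1_mk2 algebra_simps\<close>)

lemma LIMSEQ_dist_less:
  fixes X :: "nat \<Rightarrow> 'a::metric_space"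
  assumes "\<And>n. dist (X n) l < 1 / real (Suc n)"
  shows "X \<longlonglongrightarrow> l"
proof (rule metric_LIMSEQ_I)
  fix r :: real assume "r > 0"
  then obtain N where N: "inverse (real (Suc N)) < r" using reals_Archimedean by blast
  have "dist (X n) l < r" if "n \<ge> N" for n
  proof -
    have "1 / real (Suc n) \<le> 1 / real (Suc N)" using that by (simp add: field_simps)
    then show ?thesis using assms [of n] N unfolding inverse_eq_divide by linarith
  qed
  then show "\<exists>no. \<forall>n\<ge>no. dist (X n) l < r" by blast
qed

lemma tendsto_matrix_iff:
  fixes X :: "nat \<Rightarrow> complex^2^2"
  shows "X \<longlonglongrightarrow> A \<longleftrightarrow> (\<forall>i j. (\<lambda>n. X n $ i $ j) \<longlonglongrightarrow> A $ i $ j)"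
  by (metis tendsto_vec_nth vec_tendstoI)

lemma tendsto_mk2:
  assumes "a \<longlonglongrightarrow> a'" "b \<longlonglongrightarrow> b'" "c \<longlonglongrightarrow> c'" "d \<longlonglongrightarrow> d'"
  shows "(\<lambda>n. mk2 (a n) (b n) (c n) (d n)) \<longlonglongrightarrow> mk2 a' b' c' d'"
  using assms by (simp add: tendsto_matrix_iff forall_2)

lemma tendsto_matrix_mult:
  fixes X Y :: "nat \<Rightarrow> complex^2^2"
  assumes "X \<longlonglongrightarrow> A" "Y \<longlonglongrightarrow> B"
  shows "(\<lambda>n. X n ** Y n) \<longlonglongrightarrow> A ** B"
  unfolding tendsto_matrix_iff
  by (auto simp: matrix_matrix_mult_def intro!: tendsto_sum tendsto_mult tendsto_vec_nth assms)

section \<open>Discrete subgroups of \<open>SL2C\<close>\<close>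

text \<open>The set \<open>\<Union>G\<close> of all lifts of a subgroup of \<open>PSL2C\<close> is
  of this kind; arguing with it avoids any choice of lifts.\<close>

locale sl2_group =
  fixes S :: "(complex^2^2) set"
  assumes det_1: "A \<in> S \<Longrightarrow> det A = 1"
    and one_closed: "mat 1 \<in> S"
    and mult_closed: "A \<in> S \<Longrightarrow> B \<in> S \<Longrightarrow> A ** B \<in> S"
    and inv_closed: "A \<in> S \<Longrightarrow> matrix_inv A \<in> S"
begin

lemma mk2_det_1: "mk2 a b c d \<in> S \<Longrightarrow> a * d - b * c = 1"
  using det_1 by fastforce

lemma inv_closed_mk2: "mk2 a b c d \<in> S \<Longrightarrow> mk2 d (- b) (- c) a \<in> S"
  by (metis inv_closed matrix_inv_mk2 mk2_det_1)

lemma diag_power_closed: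
  assumes "mk2 l 0 0 (1 / l) \<in> S"
  shows "mk2 (l ^ n) 0 0 (1 / l ^ n) \<in> S" "mk2 (1 / l ^ n) 0 0 (l ^ n) \<in> S"
proof -
  show *: "mk2 (l ^ n) 0 0 (1 / l ^ n) \<in> S"
  proof (induction n)
    case 0
    show ?case using one_closed by (simp add: mat_1_mk2)
  next
    case (Suc n)
    show ?case using mult_closed [OF assms Suc] by simp
  qed
  show "mk2 (1 / l ^ n) 0 0 (l ^ n) \<in> S"
    using inv_closed_mk2 [OF *] by simp
qed

end

text \<open>Discreteness is asked for only at the identity and in sequential form; translation by
  group elements carries it to every limit of determinant one, as \<open>eventually_eq\<close>
  shows.\<close>

locale discrete_sl2_group = sl2_group +
  assumes isolated: "(\<And>n::nat. X n \<in> S) \<Longrightarrow> X \<longlonglongrightarrow> mat 1 \<Longrightarrow> \<exists>n. X n = mat 1"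
begin

text \<open>Otherwise there are later terms \<open>X (\<phi> N)\<close> different from
  \<open>X N\<close>, and the quotients of the two tend to the identity without ever reaching
  it.\<close>

lemma eventually_eq:
  assumes X: "\<And>n::nat. X n \<in> S" and A: "det A = 1" and lim: "X \<longlonglongrightarrow> A"
  shows "\<exists>N. \<forall>n\<ge>N. X n = X N"
proof (rule ccontr)
  assume "\<not> ?thesis"
  then have "\<exists>\<phi>. \<forall>N. \<phi> N \<ge> N \<and> X (\<phi> N) \<noteq> X N" by (intro choice) auto
  then obtain \<phi> where \<phi>: "\<And>N. \<phi> N \<ge> N" "\<And>N. X (\<phi> N) \<noteq> X N" by auto
  have "filterlim \<phi> at_top sequentially"
    using filterlim_at_top_mono [OF filterlim_ident always_eventually] \<phi>(1) by blast
  then have l2: "(\<lambda>N. X (\<phi> N)) \<longlonglongrightarrow> A"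
    using lim by (rule filterlim_compose [rotated])
  have inv: "(\<lambda>N. matrix_inv (X N)) \<longlonglongrightarrow> matrix_inv A"
  proof -
    have e: "matrix_inv B = mk2 (B$2$2) (- (B$1$2)) (- (B$2$1)) (B$1$1)" if "det B = 1" for B
      using that by (cases B rule: mk2_cases) (simp add: matrix_inv_mk2)
    have "(\<lambda>N. mk2 (X N$2$2) (- (X N$1$2)) (- (X N$2$1)) (X N$1$1)) \<longlonglongrightarrow>
        mk2 (A$2$2) (- (A$1$2)) (- (A$2$1)) (A$1$1)"
      using lim by (intro tendsto_mk2 tendsto_minus tendsto_vec_nth)
    then show ?thesis
      using e [OF A] e [OF det_1 [OF X]] by simp
  qed
  have "(\<lambda>N. matrix_inv (X N) ** X (\<phi> N)) \<longlonglongrightarrow> mat 1"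
    using tendsto_matrix_mult [OF inv l2] det_one_inverse(2) [OF A] by simp
  then obtain n where "matrix_inv (X n) ** X (\<phi> n) = mat 1"
    using isolated [where X = "\<lambda>N. matrix_inv (X N) ** X (\<phi> N)", OF mult_closed [OF inv_closed [OF X] X]]
    by auto
  then have "X (\<phi> n) = X n"
  proof -
    have "X (\<phi> n) = (X n ** matrix_inv (X n)) ** X (\<phi> n)"
      using det_one_inverse(1) [OF det_1 [OF X [of n]]] by simp
    also have "\<dots> = X n ** (matrix_inv (X n) ** X (\<phi> n))"
      by (simp only: matrix_mul_assoc)
    finally show ?thesis
      using \<open>matrix_inv (X n) ** X (\<phi> n) = mat 1\<close> by simp
  qed
  with \<phi>(2) show False by blast
qed

text \<open>Bolzano-Weierstrass: an injective bounded sequence has a convergent subsequence, whose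
  limit again has determinant 1, so that it would be eventually constant.\<close>

lemma finite_bounded: "finite {A \<in> S. norm A \<le> R}"
proof (rule ccontr)
  assume "infinite {A \<in> S. norm A \<le> R}"
  then obtain X :: "nat \<Rightarrow> complex^2^2" where X: "inj X" "range X \<subseteq> {A \<in> S. norm A \<le> R}"
    using infinite_countable_subset by blast
  have "compact (cball (0::complex^2^2) R)" by simp
  moreover have "\<forall>n. X n \<in> cball 0 R" using X by auto
  ultimately obtain A \<phi> where \<phi>: "strict_mono (\<phi> :: nat \<Rightarrow> nat)" "(X \<circ> \<phi>) \<longlonglongrightarrow> A"
    unfolding compact_def by metis
  have d: "det (X (\<phi> n)) = 1" for n using X det_1 by auto
  have "(\<lambda>n. det (X (\<phi> n))) \<longlonglongrightarrow> det A"
    using \<phi>(2) unfolding det_2 o_def by (intro tendsto_diff tendsto_mult tendsto_vec_nth)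
  then have "det A = 1" using d by (simp add: LIMSEQ_const_iff)
  then have "\<exists>N. \<forall>n\<ge>N. X (\<phi> n) = X (\<phi> N)"
    using eventually_eq [of "X \<circ> \<phi>" A] X(2) \<phi>(2) by (auto simp: image_subset_iff)
  then obtain N where "X (\<phi> (Suc N)) = X (\<phi> N)" by (metis le_SucI order_refl)
  then have "\<phi> (Suc N) = \<phi> N" using X(1) by (simp add: inj_eq)
  then show False using \<phi>(1) by (metis lessI less_irrefl strict_monoD)
qed

end

lemma matrix_inv_conj:
  fixes A P Q :: "complex^2^2"
  assumes "det A = 1" "P ** Q = mat 1" "Q ** P = mat 1"
  shows "matrix_inv (Q ** A ** P) = Q ** matrix_inv A ** P" "det (Q ** A ** P) = 1"
proof -
  have "det P * det Q = 1" using assms(2) by (metis det_I det_mul)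
  then show 1: "det (Q ** A ** P) = 1" using assms(1) by (simp add: det_mul mult.commute)
  have "(Q ** A ** P) ** (Q ** matrix_inv A ** P) = Q ** (A ** (P ** Q) ** matrix_inv A) ** P"
    by (simp add: matrix_mul_assoc)
  also have "\<dots> = mat 1" using assms by (simp add: det_one_inverse)
  finally show "matrix_inv (Q ** A ** P) = Q ** matrix_inv A ** P"
    by (rule matrix_inv_unique [OF 1])
qed

text \<open>Lets a group be studied in an eigenbasis of one of its elements.\<close>

lemma discrete_conj:
  fixes P Q :: "complex^2^2"
  assumes "discrete_sl2_group S" and PQ: "P ** Q = mat 1" "Q ** P = mat 1"
  shows "discrete_sl2_group ((\<lambda>A. Q ** A ** P) ` S)"
proof -
  interpret discrete_sl2_group S by fact
  show ?thesis
  proof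
    fix A assume "A \<in> (\<lambda>A. Q ** A ** P) ` S"
    then show "det A = 1" using matrix_inv_conj PQ det_1 by blast
  next
    show "mat 1 \<in> (\<lambda>A. Q ** A ** P) ` S"
      using one_closed PQ by (intro image_eqI [of _ _ "mat 1"]) auto
  next
    fix A B assume "A \<in> (\<lambda>A. Q ** A ** P) ` S" "B \<in> (\<lambda>A. Q ** A ** P) ` S"
    then obtain A' B' where "A' \<in> S" "B' \<in> S" "A = Q ** A' ** P" "B = Q ** B' ** P" by blast
    moreover have "(Q ** A' ** P) ** (Q ** B' ** P) = Q ** (A' ** B') ** P"
    proof -
      have "(Q ** A' ** P) ** (Q ** B' ** P) = Q ** A' ** (P ** Q) ** B' ** P"
        by (simp only: matrix_mul_assoc)
      then show ?thesis by (simp add: PQ matrix_mul_assoc)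
    qed
    ultimately show "A ** B \<in> (\<lambda>A. Q ** A ** P) ` S"
      using mult_closed by auto
  next
    fix A assume "A \<in> (\<lambda>A. Q ** A ** P) ` S"
    then show "matrix_inv A \<in> (\<lambda>A. Q ** A ** P) ` S"
      using matrix_inv_conj(1) [OF _ PQ] inv_closed det_1 by auto
  next
    fix X :: "nat \<Rightarrow> complex^2^2"
    assume X: "\<And>n. X n \<in> (\<lambda>A. Q ** A ** P) ` S" and lim: "X \<longlonglongrightarrow> mat 1"
    have "P ** X n ** Q \<in> S" for n
    proof -
      obtain A where "A \<in> S" "X n = Q ** A ** P" using X by blast
      moreover have "P ** (Q ** A ** P) ** Q = A"
      proof -
        have "P ** (Q ** A ** P) ** Q = (P ** Q) ** A ** (P ** Q)"
          by (simp only: matrix_mul_assoc)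
        then show ?thesis by (simp add: PQ)
      qed
      ultimately show ?thesis by simp
    qed
    moreover have "(\<lambda>n. P ** X n ** Q) \<longlonglongrightarrow> P ** mat 1 ** Q"
      by (intro tendsto_matrix_mult lim tendsto_const)
    ultimately obtain n where "P ** X n ** Q = mat 1"
      using isolated [of "\<lambda>n. P ** X n ** Q"] PQ by auto
    moreover have "Q ** (P ** X n ** Q) ** P = (Q ** P) ** X n ** (Q ** P)"
      by (simp only: matrix_mul_assoc)
    ultimately have "X n = mat 1"
      by (simp add: PQ)
    then show "\<exists>n. X n = mat 1" by blast
  qed
qed

section \<open>Lifting subgroups and the quotient topology from PSL(2,C) to SL(2,C)\<close>

lemma mult_PSL2C:
  assumes "X \<in> carrier PSL2C" "Y \<in> carrier PSL2C" "A \<in> X" "B \<in> Y"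
  shows "A ** B \<in> X \<otimes>\<^bsub>PSL2C\<^esub> Y"
  using assms by (auto simp: PSL2C_def FactGroup_def set_mult_def)

lemma one_PSL2C: "\<one>\<^bsub>PSL2C\<^esub> = {mat 1, - mat 1}"
  by (simp add: PSL2C_def FactGroup_def)

lemma PSL2C_eqI:
  assumes "X \<in> carrier PSL2C" "Y \<in> carrier PSL2C" "A \<in> X" "A \<in> Y"
  shows "X = Y"
  using assms by (auto simp: carrier_PSL2C)

lemma mem_PSL2C_eq:
  assumes "X \<in> carrier PSL2C" "A \<in> X"
  shows "X = {A, - A}" "det A = 1"
  using assms by (auto simp: carrier_PSL2C det_minus_2)

lemma carrier_PSL2C_I: "det A = 1 \<Longrightarrow> {A, - A} \<in> carrier PSL2C"
  by (auto simp: carrier_PSL2C)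

lemma inv_PSL2C:
  assumes "X \<in> carrier PSL2C" "A \<in> X"
  shows "matrix_inv A \<in> inv\<^bsub>PSL2C\<^esub> X"
proof -
  interpret group PSL2C by (rule group_PSL2C)
  have d: "det A = 1" using assms mem_PSL2C_eq by blast
  let ?Y = "{matrix_inv A, - matrix_inv A}"
  have Y: "?Y \<in> carrier PSL2C" using d det_one_inverse(3) carrier_PSL2C_I by blast
  have "mat 1 \<in> ?Y \<otimes>\<^bsub>PSL2C\<^esub> X"
    using mult_PSL2C [OF Y assms(1), of "matrix_inv A" A] assms d by (simp add: det_one_inverse)
  then have "?Y \<otimes>\<^bsub>PSL2C\<^esub> X = \<one>\<^bsub>PSL2C\<^esub>"
    using assms Y one_closed by (intro PSL2C_eqI) (auto simp: one_PSL2C)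
  then have "inv\<^bsub>PSL2C\<^esub> X = ?Y" using assms Y by (metis inv_equality)
  then show ?thesis by blast
qed

lemma sl2_group_Union:
  assumes "subgroup G PSL2C"
  shows "sl2_group (\<Union>G)"
proof -
  interpret subgroup G PSL2C by fact
  show ?thesis
  proof
    show "det A = 1" if A: "A \<in> \<Union>G" for A
    proof -
      obtain X where X: "X \<in> G" "A \<in> X" using A by blast
      show ?thesis by (rule mem_PSL2C_eq(2) [OF mem_carrier [OF X(1)] X(2)])
    qed
    show "mat 1 \<in> \<Union>G"
      by (rule UnionI [OF one_closed]) (simp add: one_PSL2C)
    show "A ** B \<in> \<Union>G" if A: "A \<in> \<Union>G" and B: "B \<in> \<Union>G" for A B
    proof -
      obtain X Y where XY: "X \<in> G" "A \<in> X" "Y \<in> G" "B \<in> Y" using A B by blast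
      show ?thesis
        by (rule UnionI [OF m_closed [OF XY(1,3)]])
          (rule mult_PSL2C [OF mem_carrier [OF XY(1)] mem_carrier [OF XY(3)] XY(2,4)])
    qed
    show "matrix_inv A \<in> \<Union>G" if A: "A \<in> \<Union>G" for A
    proof -
      obtain X where X: "X \<in> G" "A \<in> X" using A by blast
      show ?thesis
        by (rule UnionI [OF m_inv_closed [OF X(1)]]) (rule inv_PSL2C [OF mem_carrier [OF X(1)] X(2)])
    qed
  qed
qed

text \<open>The cosets contained in S form a subgroup of \<open>PSL2C\<close>, so only the
  generators have to be checked. This serves as the induction principle for generated groups: S is
  chosen as the matrix group cut out by the property to be proved.\<close>

lemma Union_generate_subset:
  assumes S: "sl2_group S" and m: "- mat 1 \<in> S" and A: "A \<in> S" and B: "B \<in> S"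
  shows "\<Union>(generate PSL2C {{A, - A}, {B, - B}}) \<subseteq> S"
proof -
  interpret sl2_group S by fact
  have um: "- C \<in> S" if "C \<in> S" for C
    using mult_closed [OF m that] by (simp add: matrix_mult_minus_left)
  let ?H = "{X \<in> carrier PSL2C. X \<subseteq> S}"
  interpret P: group PSL2C by (rule group_PSL2C)
  have "subgroup ?H PSL2C"
  proof
    show "X \<otimes>\<^bsub>PSL2C\<^esub> Y \<in> ?H" if "X \<in> ?H" "Y \<in> ?H" for X Y
    proof -
      have X: "X \<in> carrier PSL2C" "X \<subseteq> S" and Y: "Y \<in> carrier PSL2C" "Y \<subseteq> S"
        using that by auto
      obtain C where C: "X = {C, - C}" "C \<in> S"
        using X carrier_PSL2C [THEN iffD1, OF X(1)] by auto
      obtain D where D: "Y = {D, - D}" "D \<in> S"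
        using Y carrier_PSL2C [THEN iffD1, OF Y(1)] by auto
      have c: "X \<otimes>\<^bsub>PSL2C\<^esub> Y \<in> carrier PSL2C" using X Y by simp
      have "C ** D \<in> X \<otimes>\<^bsub>PSL2C\<^esub> Y"
        using C D by (intro mult_PSL2C X Y) auto
      then have "X \<otimes>\<^bsub>PSL2C\<^esub> Y = {C ** D, - (C ** D)}"
        by (rule mem_PSL2C_eq(1) [OF c])
      then show ?thesis
        using c mult_closed [OF C(2) D(2)] um by simp
    qed
    show "inv\<^bsub>PSL2C\<^esub> X \<in> ?H" if "X \<in> ?H" for X
    proof -
      have X: "X \<in> carrier PSL2C" "X \<subseteq> S"
        using that by auto
      obtain C where C: "X = {C, - C}" "C \<in> S"
        using X carrier_PSL2C [THEN iffD1, OF X(1)] by auto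
      have c: "inv\<^bsub>PSL2C\<^esub> X \<in> carrier PSL2C" using X by simp
      have "matrix_inv C \<in> inv\<^bsub>PSL2C\<^esub> X"
        using C by (intro inv_PSL2C X) auto
      then have "inv\<^bsub>PSL2C\<^esub> X = {matrix_inv C, - matrix_inv C}"
        by (rule mem_PSL2C_eq(1) [OF c])
      then show ?thesis
        using c inv_closed [OF C(2)] um by simp
    qed
    show "\<one>\<^bsub>PSL2C\<^esub> \<in> ?H"
      using one_closed m P.one_closed by (auto simp: one_PSL2C)
  qed auto
  moreover have "{{A, - A}, {B, - B}} \<subseteq> ?H"
    using A B um det_1 carrier_PSL2C_I by auto
  ultimately have "generate PSL2C {{A, - A}, {B, - B}} \<subseteq> ?H"
    by (rule P.generate_subgroup_incl [rotated])
  then show ?thesis by auto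
qed

lemma Union_carrier_PSL2C: "\<Union>(carrier PSL2C) = carrier SL2C"
proof
  show "\<Union>(carrier PSL2C) \<subseteq> carrier SL2C"
  proof
    fix A assume "A \<in> \<Union>(carrier PSL2C)"
    then obtain X where "X \<in> carrier PSL2C" "A \<in> X" by (rule UnionE)
    then show "A \<in> carrier SL2C" using mem_PSL2C_eq(2) by simp
  qed
  show "carrier SL2C \<subseteq> \<Union>(carrier PSL2C)"
  proof
    fix A assume "A \<in> carrier SL2C"
    then have "{A, - A} \<in> carrier PSL2C" by (intro carrier_PSL2C_I) simp
    then show "A \<in> \<Union>(carrier PSL2C)" by (rule UnionI) simp
  qed
qed

lemma topspace_PSL2C [simp]: "topspace PSL2C_topology = carrier PSL2C"
proof
  show "topspace PSL2C_topology \<subseteq> carrier PSL2C"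
    using openin_PSL2C_topology by (metis openin_topspace)
  have "openin PSL2C_topology (carrier PSL2C)"
    unfolding openin_PSL2C_topology Union_carrier_PSL2C by auto
  then show "carrier PSL2C \<subseteq> topspace PSL2C_topology"
    by (rule openin_subset)
qed

text \<open>An open set isolating the identity coset pulls back to a neighbourhood of
  \<open>mat 1\<close> that meets the group only in \<open>mat 1\<close> and \<open>- mat 1\<close>,
  and a sequence tending to \<open>mat 1\<close> finally avoids the latter.\<close>

lemma discrete_sl2_group_Union:
  assumes "subgroup G PSL2C" and disc: "subtopology PSL2C_topology G = discrete_topology G"
  shows "discrete_sl2_group (\<Union>G)"
proof -
  interpret sl2_group "\<Union>G" using assms(1) by (rule sl2_group_Union)
  interpret H: subgroup G PSL2C by fact
  show ?thesis
  proof
    fix X :: "nat \<Rightarrow> complex^2^2"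
    assume X: "\<And>n. X n \<in> \<Union>G" and lim: "X \<longlonglongrightarrow> mat 1"
    let ?I = "\<one>\<^bsub>PSL2C\<^esub>"
    have "openin (subtopology PSL2C_topology G) {?I}"
      unfolding disc by simp
    then obtain U where U: "openin PSL2C_topology U" "{?I} = U \<inter> G"
      unfolding openin_subtopology by blast
    then obtain T where T: "open T" "\<Union>U = carrier SL2C \<inter> T"
      unfolding openin_PSL2C_topology openin_open by blast
    have "mat 1 \<in> T" using T U one_PSL2C by blast
    then have "\<forall>\<^sub>F n in sequentially. X n \<in> T"
      using lim T(1) topological_tendstoD by blast
    moreover have "- mat 1 \<noteq> (mat 1 :: complex^2^2)" by (simp add: mat_1_mk2)
    then have "\<forall>\<^sub>F n in sequentially. X n \<noteq> - mat 1"
      using lim by (metis tendsto_imp_eventually_ne)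
    ultimately have "\<forall>\<^sub>F n in sequentially. X n = mat 1"
    proof eventually_elim
      case (elim n)
      have "X n \<in> carrier SL2C" using X det_1 by simp
      then obtain Y where Y: "Y \<in> U" "X n \<in> Y" using elim T by blast
      obtain Z where Z: "Z \<in> G" "X n \<in> Z" using X by blast
      have "Y = Z"
        using Y Z U(1) H.subset by (intro PSL2C_eqI) (auto simp: openin_PSL2C_topology)
      then have "X n \<in> ?I" using Y Z U by blast
      then show ?case using elim by (auto simp: one_PSL2C)
    qed
    then show "\<exists>n. X n = mat 1"
      by (meson eventually_happens sequentially_bot)
  qed
qed

text \<open>An accumulation point X of G in G would give lifts that tend to a lift of X but never
  equal it, against \<open>eventually_eq\<close>.\<close>

lemma discrete_topology_PSL2C:
  assumes G: "G \<subseteq> carrier PSL2C" and "discrete_sl2_group (\<Union>G)"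
  shows "subtopology PSL2C_topology G = discrete_topology G"
proof -
  interpret discrete_sl2_group "\<Union>G" by fact
  have "X \<notin> PSL2C_topology derived_set_of G" if XG: "X \<in> G" for X
  proof
    assume X: "X \<in> PSL2C_topology derived_set_of G"
    obtain A where A: "A \<in> X" "X = {A, - A}" "det A = 1"
      using carrier_PSL2C [THEN iffD1, OF subsetD [OF G XG]] by auto
    have "\<exists>B\<in>\<Union>G. dist B A < 1 / real (Suc n) \<and> B \<noteq> A" for n
    proof -
      let ?e = "1 / real (Suc n)"
      let ?U = "{Y \<in> carrier PSL2C. \<exists>B\<in>Y. dist B A < ?e}"
      \<comment> \<open>Preimages of sets in the quotient are saturated under the sign, hence the
        union of a ball with its negative.\<close>
      have e: "\<Union>?U = carrier SL2C \<inter> (ball A ?e \<union> uminus -` ball A ?e)"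
      proof
        show "\<Union>?U \<subseteq> carrier SL2C \<inter> (ball A ?e \<union> uminus -` ball A ?e)"
        proof
          fix C assume "C \<in> \<Union>?U"
          then obtain Y B where Y: "Y \<in> carrier PSL2C" "C \<in> Y" "B \<in> Y" "dist B A < ?e" by blast
          have "B = C \<or> B = - C" "det C = 1"
            using Y(3) mem_PSL2C_eq [OF Y(1,2)] by auto
          then show "C \<in> carrier SL2C \<inter> (ball A ?e \<union> uminus -` ball A ?e)"
            using Y(4) by (auto simp: dist_commute)
        qed
        show "carrier SL2C \<inter> (ball A ?e \<union> uminus -` ball A ?e) \<subseteq> \<Union>?U"
        proof
          fix B assume "B \<in> carrier SL2C \<inter> (ball A ?e \<union> uminus -` ball A ?e)"
          then have "{B, - B} \<in> carrier PSL2C" "dist B A < ?e \<or> dist (- B) A < ?e"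
            using carrier_PSL2C_I by (auto simp: dist_commute)
          then have "{B, - B} \<in> ?U" by auto
          then show "B \<in> \<Union>?U" by (rule UnionI) simp
        qed
      qed
      have "open (ball A ?e \<union> uminus -` ball A ?e)"
        by (intro open_Un open_ball continuous_open_vimage) (auto intro!: continuous_intros)
      then have "openin PSL2C_topology ?U"
        unfolding openin_PSL2C_topology e by auto
      moreover have "X \<in> ?U" using subsetD [OF G XG] A(1) by (auto intro!: bexI [of _ A])
      ultimately have "\<exists>Y. Y \<noteq> X \<and> Y \<in> G \<and> Y \<in> ?U"
        using X unfolding in_derived_set_of by (elim conjE allE [of _ ?U]) simp
      then obtain Y where Y: "Y \<noteq> X" "Y \<in> G" "Y \<in> ?U" by auto
      from Y(3) obtain B where B: "B \<in> Y" "dist B A < ?e" by auto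
      have "B \<noteq> A"
        using PSL2C_eqI [OF subsetD [OF G Y(2)] subsetD [OF G XG] B(1)] A(1) Y(1) by auto
      with B Y show ?thesis by auto
    qed
    then have "\<forall>n. \<exists>B. B \<in> \<Union>G \<and> dist B A < 1 / real (Suc n) \<and> B \<noteq> A"
      unfolding Bex_def by (rule allI)
    from choice [OF this]
    obtain B where B': "\<forall>n. B n \<in> \<Union>G \<and> dist (B n) A < 1 / real (Suc n) \<and> B n \<noteq> A"
      by (rule exE)
    have B: "B n \<in> \<Union>G" "dist (B n) A < 1 / real (Suc n)" "B n \<noteq> A" for n
      using B' [THEN spec, of n] by simp_all
    have "B \<longlonglongrightarrow> A" using B(2) by (rule LIMSEQ_dist_less)
    obtain N where "\<forall>n\<ge>N. B n = B N"
      using eventually_eq [OF B(1) A(3) \<open>B \<longlonglongrightarrow> A\<close>] by (rule exE)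
    then have "\<exists>M. \<forall>n\<ge>M. B n = B N"
      by (rule exI)
    then have "B \<longlonglongrightarrow> B N"
      unfolding eventually_sequentially [symmetric] by (rule tendsto_eventually)
    with \<open>B \<longlonglongrightarrow> A\<close> have "B N = A"
      by (rule LIMSEQ_unique [rotated])
    with B(3) [of N] show False by simp
  qed
  then have "G \<inter> PSL2C_topology derived_set_of G = {}"
    by (intro equals0I) (simp only: Int_iff, elim conjE, simp)
  then show ?thesis
    using G by (simp add: subtopology_eq_discrete_topology_eq)
qed

section \<open>Iteration of commutators\<close>

text \<open>Made for the off-diagonal entries, whose successive ratios are known only in the
  limit.\<close>

lemma ratio_tendsto_zero:
  fixes u :: "nat \<Rightarrow> complex"
  assumes rec: "\<And>n. u (Suc n) = q n * u n" and q: "q \<longlonglongrightarrow> L" and L: "norm L < 1"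
  shows "u \<longlonglongrightarrow> 0"
proof -
  obtain r where r: "norm L < r" "r < 1" using L dense by blast
  have "(\<lambda>n. norm (q n)) \<longlonglongrightarrow> norm L" using q by (rule tendsto_norm)
  then have "\<forall>\<^sub>F n in sequentially. norm (q n) < r" using r(1) by (rule order_tendstoD(2))
  then obtain N where N: "\<And>n. n \<ge> N \<Longrightarrow> norm (q n) < r"
    unfolding eventually_sequentially by auto
  have "norm (u (Suc n)) \<le> r * norm (u n)" if "n \<ge> N" for n
    unfolding rec norm_mult using N [OF that] by (intro mult_right_mono) auto
  then have "summable u" using summable_ratio_test [OF r(2)] by auto
  then show ?thesis by (rule summable_LIMSEQ_zero)
qed

lemma geometric_tendsto_zero:
  fixes s :: "nat \<Rightarrow> complex"
  assumes s: "\<And>n. cmod (s n) \<le> c * q ^ n" and q: "0 \<le> q" "q < 1"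
  shows "s \<longlonglongrightarrow> 0"
proof (rule Lim_null_comparison [OF always_eventually])
  show "\<forall>n. norm (s n) \<le> c * q ^ n" using s by blast
  show "(\<lambda>n. c * q ^ n) \<longlonglongrightarrow> 0"
    using tendsto_mult [OF tendsto_const LIMSEQ_power_zero [of q]] q by simp
qed

lemma diag_conj:
  assumes "a * d - b * c = 1" "l \<noteq> 0"
  shows "mk2 a b c d ** mk2 l 0 0 (1 / l) ** matrix_inv (mk2 a b c d) =
    mk2 (l + b * c * (l - 1 / l)) (- (a * b * (l - 1 / l))) (c * d * (l - 1 / l))
      (1 / l - b * c * (l - 1 / l))"
proof -
  have "a * d = 1 + b * c" using assms(1) by (simp add: algebra_simps)
  then have "a * l * d = (1 + b * c) * l" "d * a / l = (1 + b * c) / l"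
    by (simp_all add: mult.commute mult.left_commute)
  then show ?thesis
    unfolding matrix_inv_mk2 [OF assms(1)] using assms(2)
    by (simp add: field_simps)
qed

text \<open>The backward step of the iterations: by \<open>diag_conj\<close>, if a conjugate of a
  diagonal matrix with distinct eigenvalues is diagonal again, the conjugating matrix fixes or
  exchanges the two eigenlines.\<close>

lemma diag_or_antidiag:
  fixes a b c d :: complex
  assumes "a * d - b * c = 1" "a * b = 0" "c * d = 0"
  shows "b = 0 \<and> c = 0 \<or> a = 0 \<and> d = 0"
  using assms by auto

context discrete_sl2_group
begin

text \<open>Conjugating by powers of the diagonal element rescales \<open>b n\<close> and \<open>c n\<close> reciprocally, so that
  the sequence can be made to converge to the diagonal element.\<close>

lemma diag_limit:
  assumes F: "mk2 l 0 0 (1 / l) \<in> S" and l: "l \<noteq> 0"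
    and k: "\<And>n. mk2 (a n) (b n) (c n) (d n) \<in> S"
    and a: "a \<longlonglongrightarrow> l" and d: "d \<longlonglongrightarrow> 1 / l"
    and b: "(\<lambda>n. b n / l ^ (s * n)) \<longlonglongrightarrow> 0" and c: "(\<lambda>n. c n * l ^ (s * n)) \<longlonglongrightarrow> 0"
  shows "\<exists>n. b n = 0 \<and> c n = 0"
proof -
  \<comment> \<open>Conjugation by the m-th power divides \<open>b\<close> by
    \<open>l^(2 m)\<close>, so only even exponents can be removed exactly. Half of
    \<open>s * n\<close> is taken, and the remainder \<open>e n\<close> costs a bounded
    factor.\<close>
  define m where "m n = s * n div 2" for n
  define e where "e n = s * n mod 2" for n
  have me: "l ^ (s * n) = l ^ m n * l ^ m n * l ^ e n" for n
  proof -
    have "s * n = m n + m n + e n" unfolding m_def e_def by presburger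
    then show ?thesis by (metis power_add)
  qed
  have e01: "e n = 0 \<or> e n = 1" for n unfolding e_def by auto
  \<comment> \<open>The last factor is the inverse of the diagonal element; it turns convergence to
    that element into convergence to the identity.\<close>
  define X where "X n = mk2 (1 / l ^ m n) 0 0 (l ^ m n) ** mk2 (a n) (b n) (c n) (d n) **
    mk2 (l ^ m n) 0 0 (1 / l ^ m n) ** mk2 (1 / l ^ 1) 0 0 (l ^ 1)" for n
  have XS: "X n \<in> S" for n
    unfolding X_def by (intro mult_closed diag_power_closed k F)
  have X: "X n = mk2 (a n / l) (b n / l ^ (s * n) * (l * l ^ e n))
      (c n * l ^ (s * n) * (1 / (l * l ^ e n))) (d n * l)" for n
    using l unfolding X_def me [of n] by (simp add: field_simps)
  have nb: "norm (l * l ^ e n) \<le> norm l + norm l * norm l" for n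
    using e01 [of n] by (auto simp: norm_mult)
  have nc: "norm (1 / (l * l ^ e n)) \<le> norm (1 / l) + norm (1 / l) * norm (1 / l)" for n
    using e01 [of n] by (auto simp: norm_mult norm_divide)
  have "X \<longlonglongrightarrow> mk2 1 0 0 1"
    unfolding X
  proof (rule tendsto_mk2)
    show "(\<lambda>n. a n / l) \<longlonglongrightarrow> 1" using tendsto_divide [OF a tendsto_const, of l] l by simp
    show "(\<lambda>n. d n * l) \<longlonglongrightarrow> 1" using tendsto_mult [OF d tendsto_const, of l] l by simp
    show "(\<lambda>n. b n / l ^ (s * n) * (l * l ^ e n)) \<longlonglongrightarrow> 0"
    proof (rule Lim_null_comparison)
      show "\<forall>\<^sub>F n in sequentially. norm (b n / l ^ (s * n) * (l * l ^ e n)) \<le>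
          norm (b n / l ^ (s * n)) * (norm l + norm l * norm l)"
        by (rule always_eventually, rule allI) (simp only: norm_mult [of "b _ / _"] mult_left_mono [OF nb] norm_ge_zero)
      show "(\<lambda>n. norm (b n / l ^ (s * n)) * (norm l + norm l * norm l)) \<longlonglongrightarrow> 0"
        using tendsto_mult [OF tendsto_norm [OF b] tendsto_const] by simp
    qed
    show "(\<lambda>n. c n * l ^ (s * n) * (1 / (l * l ^ e n))) \<longlonglongrightarrow> 0"
    proof (rule Lim_null_comparison)
      show "\<forall>\<^sub>F n in sequentially. norm (c n * l ^ (s * n) * (1 / (l * l ^ e n))) \<le>
          norm (c n * l ^ (s * n)) * (norm (1 / l) + norm (1 / l) * norm (1 / l))"
        by (rule always_eventually, rule allI) (simp only: norm_mult [of "c _ * _"] mult_left_mono [OF nc] norm_ge_zero)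
      show "(\<lambda>n. norm (c n * l ^ (s * n)) * (norm (1 / l) + norm (1 / l) * norm (1 / l))) \<longlonglongrightarrow> 0"
        using tendsto_mult [OF tendsto_norm [OF c] tendsto_const] by simp
    qed
  qed
  then obtain n where "X n = mat 1"
    using isolated [where X = X, OF XS] by (auto simp: mat_1_mk2)
  then have "b n = 0 \<and> c n = 0"
    using l by (simp add: X mat_1_mk2)
  then show ?thesis by (rule exI)
qed

text \<open>Jorgensen's argument iterates \<open>X -> X F X^-1\<close>: the quantity
  \<open>\<beta> b c\<close> contracts to 0, so some iterate is diagonal. Going back from it, the
  antidiagonal alternative is possible only at the very start, because all later iterates have the
  nonzero trace \<open>l + 1 / l\<close>.\<close>

lemma jorgensen_diag:
  assumes F: "mk2 l 0 0 (1 / l) \<in> S" and l: "l \<noteq> 0" and Y: "mk2 A B C D \<in> S"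
    and \<beta>: "\<beta> = (l - 1 / l)\<^sup>2" and nz: "\<beta> \<noteq> 0"
    and small: "cmod (\<beta> * (B * C)) + cmod \<beta> < 1"
  shows "B = 0 \<and> C = 0 \<or> A = 0 \<and> D = 0"
proof -
  define K where "K = rec_nat (mk2 A B C D) (\<lambda>_ X. X ** mk2 l 0 0 (1 / l) ** matrix_inv X)"
  have K0: "K 0 = mk2 A B C D" and KS: "K (Suc n) = K n ** mk2 l 0 0 (1 / l) ** matrix_inv (K n)" for n
    by (simp_all add: K_def)
  have K: "K n \<in> S" for n
    by (induction n) (simp_all add: K0 KS Y mult_closed inv_closed F)
  define a b c d where "a n = K n $ 1 $ 1" and "b n = K n $ 1 $ 2"
    and "c n = K n $ 2 $ 1" and "d n = K n $ 2 $ 2" for n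
  have Kmk: "K n = mk2 (a n) (b n) (c n) (d n)" for n
    unfolding a_def b_def c_def d_def by (rule mk2_eta)
  have det: "a n * d n - b n * c n = 1" for n
    using K [of n] unfolding Kmk by (rule mk2_det_1)
  define m where "m = l - 1 / l"
  have rec: "a (Suc n) = l + b n * c n * m" "b (Suc n) = - (a n * b n * m)"
    "c (Suc n) = c n * d n * m" "d (Suc n) = 1 / l - b n * c n * m" for n
    using KS [of n] unfolding Kmk [of n] diag_conj [OF det l] unfolding Kmk m_def by simp_all
  have mm: "m * m = \<beta>" unfolding \<beta> m_def power2_eq_square ..
  define s where "s n = \<beta> * (b n * c n)" for n
  have sS: "s (Suc n) = - (s n * (\<beta> + s n))" for n
  proof -
    have "s (Suc n) = - (\<beta> * (b n * c n) * ((a n * d n) * (m * m)))"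
      unfolding s_def rec by (simp add: algebra_simps)
    also have "a n * d n = 1 + b n * c n" using det [of n] by (simp add: algebra_simps)
    finally show ?thesis unfolding mm s_def by (simp add: algebra_simps)
  qed
  define \<rho> where "\<rho> = cmod (s 0) + cmod \<beta>"
  have \<rho>: "0 \<le> \<rho>" "\<rho> < 1"
    using small unfolding \<rho>_def s_def by (simp_all add: b_def c_def K0)
  have sb: "cmod (s n) \<le> cmod (s 0) * \<rho> ^ n" for n
  proof (induction n)
    case (Suc n)
    have "cmod (s 0) * \<rho> ^ n \<le> cmod (s 0)"
      using \<rho> by (simp add: mult_left_le power_le_one)
    then have "cmod (\<beta> + s n) \<le> \<rho>"
      using norm_triangle_ineq [of \<beta> "s n"] Suc unfolding \<rho>_def by linarith
    then have "cmod (s n) * cmod (\<beta> + s n) \<le> (cmod (s 0) * \<rho> ^ n) * \<rho>"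
      using Suc by (intro mult_mono) (auto simp: \<rho>)
    then show ?case by (simp add: sS norm_mult mult_ac)
  qed simp
  have "s \<longlonglongrightarrow> 0" using sb \<rho> by (rule geometric_tendsto_zero)
  then have "(\<lambda>n. s n / \<beta>) \<longlonglongrightarrow> 0 / \<beta>" by (intro tendsto_divide tendsto_const nz)
  then have bc: "(\<lambda>n. b n * c n) \<longlonglongrightarrow> 0" using nz by (simp add: s_def)
  have a: "(\<lambda>n. a (Suc n)) \<longlonglongrightarrow> l" and d: "(\<lambda>n. d (Suc n)) \<longlonglongrightarrow> 1 / l"
    unfolding rec
    using tendsto_add [OF tendsto_const tendsto_mult [OF bc tendsto_const], of l m]
      tendsto_diff [OF tendsto_const tendsto_mult [OF bc tendsto_const], of "1 / l" m]
    by simp_all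
  have "(cmod m)\<^sup>2 = cmod \<beta>"
    by (metis mm norm_mult power2_eq_square)
  moreover have "cmod \<beta> < 1" using small norm_ge_zero [of "\<beta> * (B * C)"] by linarith
  ultimately have m1: "cmod m < 1"
    using power_less_imp_less_base [of "cmod m" 2 1] by simp
  \<comment> \<open>By \<open>rec\<close>, one step multiplies \<open>b\<close> asymptotically by
    \<open>- l m\<close> and \<open>c\<close> by \<open>m / l\<close>, where \<open>|m| < 1\<close>.
    This dictates the rescaling by \<open>l ^ n\<close>.\<close>
  have b0: "(\<lambda>n. b (Suc n) / l ^ (1 * n)) \<longlonglongrightarrow> 0"
  proof (rule ratio_tendsto_zero)
    show "b (Suc (Suc n)) / l ^ (1 * Suc n) = - (a (Suc n) * m / l) * (b (Suc n) / l ^ (1 * n))" for n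
      using rec(2) [of "Suc n"] l by (simp add: field_simps)
    show "(\<lambda>n. - (a (Suc n) * m / l)) \<longlonglongrightarrow> - (l * m / l)"
      by (intro tendsto_intros a l)
    show "norm (- (l * m / l)) < 1" using m1 l by simp
  qed
  have c0: "(\<lambda>n. c (Suc n) * l ^ (1 * n)) \<longlonglongrightarrow> 0"
  proof (rule ratio_tendsto_zero)
    show "c (Suc (Suc n)) * l ^ (1 * Suc n) = (d (Suc n) * m * l) * (c (Suc n) * l ^ (1 * n))" for n
      using rec(3) [of "Suc n"] by (simp add: algebra_simps)
    show "(\<lambda>n. d (Suc n) * m * l) \<longlonglongrightarrow> 1 / l * m * l"
      by (intro tendsto_intros d)
    show "norm (1 / l * m * l) < 1" using m1 l by simp
  qed
  obtain n where n: "b (Suc n) = 0 \<and> c (Suc n) = 0"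
    using diag_limit [OF F l K [unfolded Kmk] a d b0 c0] by (rule exE)
  \<comment> \<open>Trace 0 would mean \<open>\<beta> = - 4\<close>.\<close>
  have tr: "a (Suc k) + d (Suc k) \<noteq> 0" for k
  proof
    assume "a (Suc k) + d (Suc k) = 0"
    then have *: "l + 1 / l = 0" unfolding rec by (simp add: algebra_simps)
    have "\<beta> = (l + 1 / l)\<^sup>2 - 4" unfolding \<beta> using l by (simp add: power2_eq_square field_simps)
    then have "\<beta> = - 4" unfolding * by simp
    then show False using \<open>cmod \<beta> < 1\<close> by simp
  qed
  have "m \<noteq> 0" using mm nz by auto
  then have alt: "b k = 0 \<and> c k = 0 \<or> a k = 0 \<and> d k = 0" if "b (Suc k) = 0 \<and> c (Suc k) = 0" for k
    using that unfolding rec by (intro diag_or_antidiag [OF det]) auto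
  have "b (Suc k) = 0 \<and> c (Suc k) = 0 \<Longrightarrow> b 0 = 0 \<and> c 0 = 0 \<or> a 0 = 0 \<and> d 0 = 0" for k
  proof (induction k)
    case 0
    then show ?case by (rule alt)
  next
    case (Suc k)
    have "b (Suc k) = 0 \<and> c (Suc k) = 0"
      using alt [OF Suc.prems] tr [of k] by auto
    then show ?case by (rule Suc.IH)
  qed
  from this [OF n] show ?thesis by (simp add: a_def b_def c_def d_def K0)
qed


text \<open>In the proof \<open>\<sigma> n\<close> is \<open>tr [F, h] - 2\<close> for the matrix
  \<open>h\<close> with \<open>K n = h F h^-1\<close>, and \<open>\<tau> n\<close> is the trace of
  \<open>F ** K n\<close>. If no \<open>\<tau> n\<close> vanishes, the contradiction comes from a
  diagonal iterate; otherwise from Jorgensen's inequality.\<close>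

lemma order4_diag:
  assumes F: "mk2 l 0 0 (1 / l) \<in> S" and l: "l \<noteq> 0" and H: "mk2 A B C D \<in> S"
    and \<delta>: "\<delta> = l\<^sup>2 + 1 / l\<^sup>2" and BC: "B * C \<noteq> 0"
    and small: "cmod ((\<delta> - 2) * (B * C)) + cmod \<delta> < (sqrt 5 - 1) / 2"
  shows False
proof -
  define r where "r = (sqrt 5 - 1) / 2"
  have r: "0 < r" "r < 31/50" "r * r * (2 + r) = 1"
  proof -
    have "sqrt 5 < 2.24" by (rule real_less_lsqrt) (auto simp: power2_eq_square)
    then show "r < 31/50" by (simp add: r_def)
    show "0 < r" by (simp add: r_def)
    have rr: "r * r = 1 - r" unfolding r_def by (simp add: field_simps)
    have "r * r * (2 + r) = 2 - r - r * r" unfolding rr by (simp add: algebra_simps rr)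
    then show "r * r * (2 + r) = 1" unfolding rr by simp
  qed
  define K where "K = rec_nat (mk2 A B C D ** mk2 l 0 0 (1 / l) ** matrix_inv (mk2 A B C D))
    (\<lambda>_ X. (X ** mk2 l 0 0 (1 / l) ** X) ** mk2 l 0 0 (1 / l) ** matrix_inv (X ** mk2 l 0 0 (1 / l) ** X))"
  have K0: "K 0 = mk2 A B C D ** mk2 l 0 0 (1 / l) ** matrix_inv (mk2 A B C D)"
    and KS: "K (Suc n) = (K n ** mk2 l 0 0 (1 / l) ** K n) ** mk2 l 0 0 (1 / l) **
      matrix_inv (K n ** mk2 l 0 0 (1 / l) ** K n)" for n
    by (simp_all add: K_def)
  have K: "K n \<in> S" for n
    by (induction n) (simp_all only: K0 KS H mult_closed inv_closed F)
  define a b c d where "a n = K n $ 1 $ 1" and "b n = K n $ 1 $ 2"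
    and "c n = K n $ 2 $ 1" and "d n = K n $ 2 $ 2" for n
  have Kmk: "K n = mk2 (a n) (b n) (c n) (d n)" for n
    unfolding a_def b_def c_def d_def by (rule mk2_eta)
  have det: "a n * d n - b n * c n = 1" for n
    using K [of n] unfolding Kmk by (rule mk2_det_1)
  have det0: "A * D - B * C = 1" using H by (rule mk2_det_1)
  define m where "m = l - 1 / l"
  define \<beta> where "\<beta> = \<delta> - 2"
  have mm: "m * m = \<beta>"
    unfolding m_def \<beta>_def \<delta> using l by (simp add: power2_eq_square field_simps)
  have s0: "cmod (\<beta> * (B * C)) + cmod \<delta> < r" using small unfolding \<beta>_def r_def .
  have \<delta>r: "cmod \<delta> < r" using s0 norm_ge_zero [of "\<beta> * (B * C)"] by linarith
  have \<beta>2: "cmod \<beta> > 1"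
    using norm_triangle_ineq2 [of 2 \<delta>] \<delta>r r unfolding \<beta>_def by (simp add: norm_minus_commute)
  have nz: "\<beta> \<noteq> 0" "m \<noteq> 0" using \<beta>2 mm by auto
  have rec0: "a 0 = l + B * C * m" "b 0 = - (A * B * m)" "c 0 = C * D * m" "d 0 = 1 / l - B * C * m"
    using K0 unfolding diag_conj [OF det0 l] Kmk m_def by simp_all
  define \<sigma> where "\<sigma> n = m * (l - a n)" for n
  define \<tau> where "\<tau> n = \<delta> - \<sigma> n" for n
  \<comment> \<open>Cayley-Hamilton for the product of \<open>K n\<close> and F, in the form
    \<open>K F K = \<tau> K - F^-1\<close>. The trace premise serves to identify
    \<open>l a + d / l\<close> with \<open>\<delta> - \<sigma>\<close>.\<close>
  have KFK: "K n ** mk2 l 0 0 (1 / l) ** K n =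
      mk2 (\<tau> n * a n - 1 / l) (\<tau> n * b n) (\<tau> n * c n) (\<tau> n * d n - l)" if tr: "a n + d n = l + 1 / l" for n
  proof -
    have t: "\<tau> n = l * a n + d n / l"
    proof -
      have dn: "d n = l + 1 / l - a n" using tr by (simp add: algebra_simps)
      show ?thesis
        unfolding \<tau>_def \<sigma>_def \<delta> m_def dn using l by (simp add: power2_eq_square field_simps)
    qed
    have bc: "b n * c n = a n * d n - 1" using det [of n] by (simp add: algebra_simps)
    have "\<tau> n * a n - 1 / l = a n * l * a n + b n * c n / l"
      "\<tau> n * d n - l = b n * c n * l + d n * d n / l"
      unfolding t bc using l by (simp_all add: field_simps)
    then show "K n ** mk2 l 0 0 (1 / l) ** K n =
      mk2 (\<tau> n * a n - 1 / l) (\<tau> n * b n) (\<tau> n * c n) (\<tau> n * d n - l)"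
      unfolding Kmk by (simp add: t algebra_simps)
  qed
  \<comment> \<open>The trace is kept as a premise because its constancy is proved afterwards, by an
    induction that uses these recursions.\<close>
  have rec': "a (Suc n) = l + \<tau> n * b n * (\<tau> n * c n) * m"
    "b (Suc n) = - ((\<tau> n * a n - 1 / l) * (\<tau> n * b n) * m)"
    "c (Suc n) = \<tau> n * c n * (\<tau> n * d n - l) * m"
    "d (Suc n) = 1 / l - \<tau> n * b n * (\<tau> n * c n) * m"
    "(\<tau> n * a n - 1 / l) * (\<tau> n * d n - l) - \<tau> n * b n * (\<tau> n * c n) = 1"
    if tr: "a n + d n = l + 1 / l" for n
  proof -
    have "K n ** mk2 l 0 0 (1 / l) ** K n \<in> S" by (intro mult_closed K F)
    then show det': "(\<tau> n * a n - 1 / l) * (\<tau> n * d n - l) - \<tau> n * b n * (\<tau> n * c n) = 1"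
      unfolding KFK [OF tr] by (rule mk2_det_1)
    show "a (Suc n) = l + \<tau> n * b n * (\<tau> n * c n) * m"
      "b (Suc n) = - ((\<tau> n * a n - 1 / l) * (\<tau> n * b n) * m)"
      "c (Suc n) = \<tau> n * c n * (\<tau> n * d n - l) * m"
      "d (Suc n) = 1 / l - \<tau> n * b n * (\<tau> n * c n) * m"
      using KS [of n] unfolding KFK [OF tr] diag_conj [OF det' l] unfolding Kmk m_def by simp_all
  qed
  have tr: "a n + d n = l + 1 / l" for n
    by (induction n) (simp_all only: rec0 rec', simp_all)
  note rec = rec' [OF tr]
  have a\<sigma>: "a n = l - \<sigma> n / m" for n unfolding \<sigma>_def using nz by simp
  have d\<sigma>: "d n = 1 / l + \<sigma> n / m" for n using tr [of n] unfolding a\<sigma> by (simp add: algebra_simps)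
  \<comment> \<open>The determinant makes \<open>b c\<close> a function of \<open>\<sigma>\<close>,
    so the recursion closes up on \<open>\<sigma>\<close> alone.\<close>
  have bc: "\<beta> * (b n * c n) = \<sigma> n * (\<beta> - \<sigma> n)" for n
  proof -
    have "b n * c n = a n * d n - 1" using det [of n] by (simp add: algebra_simps)
    also have "\<dots> = \<sigma> n * (l - 1 / l) / m - \<sigma> n * \<sigma> n / (m * m)"
      unfolding a\<sigma> d\<sigma> using l nz by (simp add: field_simps)
    also have "\<dots> = \<sigma> n - \<sigma> n * \<sigma> n / \<beta>"
      unfolding mm using nz by (simp add: m_def [symmetric])
    finally show ?thesis using nz by (simp add: field_simps)
  qed
  have \<sigma>0: "\<sigma> 0 = - (\<beta> * (B * C))"
    unfolding \<sigma>_def rec0 mm [symmetric] by (simp add: algebra_simps)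
  have \<sigma>S: "\<sigma> (Suc n) = \<sigma> n * (\<tau> n * \<tau> n * (\<sigma> n + 2 - \<delta>))" for n
  proof -
    have "\<sigma> (Suc n) = - (\<tau> n * \<tau> n * ((m * m) * (b n * c n)))"
      unfolding \<sigma>_def rec by (simp add: algebra_simps)
    also have "\<dots> = - (\<tau> n * \<tau> n * (\<sigma> n * (\<beta> - \<sigma> n)))"
      unfolding mm bc ..
    finally show ?thesis unfolding \<beta>_def by (simp add: algebra_simps)
  qed
  \<comment> \<open>While \<open>\<sigma>\<close> has not grown, \<open>|\<tau>| \<le> R\<close> and
    \<open>|\<sigma> + 2 - \<delta>| = |2 - \<tau>| \<le> 2 + R\<close>. Hence \<open>q\<close> is
    the contraction factor, and \<open>q < 1\<close> is exactly where \<open>r^2 (2 + r) = 1\<close>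
    enters.\<close>
  define R where "R = cmod (\<sigma> 0) + cmod \<delta>"
  define q where "q = R * R * (2 + R)"
  have R: "0 \<le> R" "R < r" using s0 by (simp_all add: R_def \<sigma>0)
  have q: "0 \<le> q" "q < 1"
  proof -
    show "0 \<le> q" using R by (simp add: q_def)
    have "R * R < r * r" using R by (intro mult_strict_mono') auto
    then have "R * R * (2 + R) < r * r * (2 + r)" using R r by (intro mult_strict_mono') auto
    then show "q < 1" unfolding q_def r(3) .
  qed
  have near: "cmod (\<tau> n) \<le> R" "cmod (\<sigma> n + 2 - \<delta>) \<le> 2 + R" if "cmod (\<sigma> n) \<le> cmod (\<sigma> 0)" for n
  proof -
    show "cmod (\<tau> n) \<le> R"
      using norm_triangle_ineq4 [of \<delta> "\<sigma> n"] that unfolding R_def \<tau>_def by linarith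
    then show "cmod (\<sigma> n + 2 - \<delta>) \<le> 2 + R"
      using norm_triangle_ineq4 [of 2 "\<tau> n"] unfolding \<tau>_def by (simp add: algebra_simps)
  qed
  have \<sigma>b: "cmod (\<sigma> n) \<le> cmod (\<sigma> 0) * q ^ n" for n
  proof (induction n)
    case (Suc n)
    have "cmod (\<sigma> 0) * q ^ n \<le> cmod (\<sigma> 0)"
      using q by (simp add: mult_left_le power_le_one)
    with Suc have "cmod (\<sigma> n) \<le> cmod (\<sigma> 0)" by linarith
    note near = near [OF this]
    have "cmod (\<tau> n) * cmod (\<tau> n) * cmod (\<sigma> n + 2 - \<delta>) \<le> q"
      unfolding q_def using near R by (intro mult_mono) auto
    then have "cmod (\<sigma> n) * (cmod (\<tau> n) * cmod (\<tau> n) * cmod (\<sigma> n + 2 - \<delta>)) \<le> (cmod (\<sigma> 0) * q ^ n) * q"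
      using Suc q by (intro mult_mono) auto
    then show ?case unfolding \<sigma>S norm_mult by (simp only: power_Suc mult_ac)
  qed simp
  have \<sigma>le: "cmod (\<sigma> n) \<le> cmod (\<sigma> 0)" for n
  proof -
    have "cmod (\<sigma> 0) * q ^ n \<le> cmod (\<sigma> 0)"
      using q by (simp add: mult_left_le power_le_one)
    with \<sigma>b [of n] show ?thesis by linarith
  qed
  have \<sigma>lim: "\<sigma> \<longlonglongrightarrow> 0" using \<sigma>b q by (rule geometric_tendsto_zero)
  then have "(\<lambda>n. \<sigma> n / m) \<longlonglongrightarrow> 0 / m" by (intro tendsto_divide tendsto_const nz)
  then have \<sigma>m: "(\<lambda>n. \<sigma> n / m) \<longlonglongrightarrow> 0" by simp
  have alim: "a \<longlonglongrightarrow> l" and dlim: "d \<longlonglongrightarrow> 1 / l"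
    unfolding a\<sigma> [abs_def] d\<sigma> [abs_def]
    using tendsto_diff [OF tendsto_const \<sigma>m, of l] tendsto_add [OF tendsto_const \<sigma>m, of "1 / l"]
    by simp_all
  have \<tau>lim: "\<tau> \<longlonglongrightarrow> \<delta>"
    unfolding \<tau>_def [abs_def] using tendsto_diff [OF tendsto_const \<sigma>lim, of \<delta>] by simp
  have \<delta>l: "\<delta> * l - 1 / l = l ^ 3" "\<delta> / l - l = 1 / l ^ 3"
    unfolding \<delta> using l by (simp_all add: power2_eq_square power3_eq_cube field_simps)
  \<comment> \<open>One step multiplies \<open>b\<close> asymptotically by
    \<open>- l^3 \<delta> m\<close> and \<open>c\<close> by \<open>\<delta> m / l^3\<close>, hence
    the exponent 3 below. As \<open>m^2 = \<delta> - 2\<close>, the number \<open>q\<close> bounds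
    \<open>|\<delta> m|^2\<close> as well.\<close>
  have \<delta>m: "cmod (\<delta> * m) < 1"
  proof -
    have "cmod \<delta> \<le> R" by (simp add: R_def)
    moreover from this have "cmod \<beta> \<le> 2 + R"
      using norm_triangle_ineq4 [of \<delta> 2] by (simp add: \<beta>_def)
    ultimately have "cmod \<delta> * cmod \<delta> * cmod \<beta> \<le> q"
      unfolding q_def using R by (intro mult_mono) auto
    moreover have "(cmod (\<delta> * m))\<^sup>2 = cmod \<delta> * cmod \<delta> * cmod \<beta>"
      unfolding mm [symmetric] by (simp add: norm_mult power2_eq_square)
    ultimately have "(cmod (\<delta> * m))\<^sup>2 < 1" using q by linarith
    then show ?thesis using power_less_imp_less_base [of "cmod (\<delta> * m)" 2 1] by simp
  qed
  have b0: "(\<lambda>n. b n / l ^ (3 * n)) \<longlonglongrightarrow> 0"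
  proof (rule ratio_tendsto_zero)
    show "b (Suc n) / l ^ (3 * Suc n) = - ((\<tau> n * a n - 1 / l) * \<tau> n * m / l ^ 3) * (b n / l ^ (3 * n))" for n
      unfolding rec(2) [of n] using l by (simp add: field_simps power_add)
    show "(\<lambda>n. - ((\<tau> n * a n - 1 / l) * \<tau> n * m / l ^ 3)) \<longlonglongrightarrow> - ((\<delta> * l - 1 / l) * \<delta> * m / l ^ 3)"
      using l by (intro tendsto_intros alim \<tau>lim) auto
    show "norm (- ((\<delta> * l - 1 / l) * \<delta> * m / l ^ 3)) < 1" unfolding \<delta>l using \<delta>m l by simp
  qed
  have c0: "(\<lambda>n. c n * l ^ (3 * n)) \<longlonglongrightarrow> 0"
  proof (rule ratio_tendsto_zero)
    show "c (Suc n) * l ^ (3 * Suc n) = (\<tau> n * (\<tau> n * d n - l) * m * l ^ 3) * (c n * l ^ (3 * n))" for n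
      unfolding rec(3) [of n] by (simp add: algebra_simps power_add)
    show "(\<lambda>n. \<tau> n * (\<tau> n * d n - l) * m * l ^ 3) \<longlonglongrightarrow> \<delta> * (\<delta> * (1 / l) - l) * m * l ^ 3"
      by (intro tendsto_intros dlim \<tau>lim)
    show "norm (\<delta> * (\<delta> * (1 / l) - l) * m * l ^ 3) < 1"
      using \<delta>l(2) \<delta>m l by simp
  qed
  have xnz: "l + 1 / l \<noteq> 0"
  proof
    assume *: "l + 1 / l = 0"
    have "\<delta> + 2 = (l + 1 / l) * (l + 1 / l)"
      unfolding \<delta> using l by (simp add: power2_eq_square field_simps)
    then have "\<delta> + 2 = 0" unfolding * by simp
    then have "\<delta> = - 2" by (simp add: eq_neg_iff_add_eq_0)
    with \<delta>r r show False by simp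
  qed
  \<comment> \<open>If no \<open>\<tau>\<close> vanishes, diagonality passes back to
    \<open>K 0\<close>. Then \<open>A = 0\<close> and \<open>B C = - 1\<close>, so the smallness
    assumption would give \<open>|\<beta>| < r\<close>, impossible for
    \<open>\<beta> = \<delta> - 2\<close>.\<close>
  have "\<exists>j. \<tau> j = 0"
  proof (rule ccontr)
    assume "\<nexists>j. \<tau> j = 0"
    then have \<tau>nz: "\<tau> j \<noteq> 0" for j by auto
    obtain n where n: "b n = 0 \<and> c n = 0"
      using diag_limit [OF F l K [unfolded Kmk] alim dlim b0 c0] by (rule exE)
    have step: "b k = 0 \<and> c k = 0" if bc': "b (Suc k) = 0 \<and> c (Suc k) = 0" for k
    proof -
      have "(\<tau> k * a k - 1 / l) * (\<tau> k * b k) = 0" "\<tau> k * c k * (\<tau> k * d k - l) = 0"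
        using bc' nz unfolding rec(2,3) by (simp_all only: neg_equal_0_iff_equal mult_eq_0_iff simp_thms)
      then have "\<tau> k * b k = 0 \<and> \<tau> k * c k = 0 \<or> \<tau> k * a k - 1 / l = 0 \<and> \<tau> k * d k - l = 0"
        by (rule diag_or_antidiag [OF rec(5)])
      \<comment> \<open>Adding the two equations and using the constant nonzero trace gives
        \<open>\<tau> k = 1\<close>, which exceeds \<open>R\<close>.\<close>
      moreover have False if "\<tau> k * a k - 1 / l = 0 \<and> \<tau> k * d k - l = 0"
      proof -
        have "\<tau> k * (a k + d k) = l + 1 / l" using that by (simp add: algebra_simps)
        then have "\<tau> k * (l + 1 / l) = 1 * (l + 1 / l)" unfolding tr mult_1_left .
        then have "\<tau> k = 1" using mult_right_cancel [OF xnz] by (rule iffD1 [rotated])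
        moreover have "cmod (\<tau> k) \<le> R" by (rule near(1) [OF \<sigma>le])
        ultimately show False using R(2) r(2) by simp
      qed
      ultimately have "\<tau> k * b k = 0 \<and> \<tau> k * c k = 0" by blast
      then show ?thesis using \<tau>nz [of k] by simp
    qed
    have "b k = 0 \<and> c k = 0 \<Longrightarrow> b 0 = 0 \<and> c 0 = 0" for k
    proof (induction k)
      case (Suc k)
      show ?case by (rule Suc.IH [OF step [OF Suc.prems]])
    qed
    from this [OF n] have "A * B * m = 0" unfolding rec0 by simp
    then have "A = 0" using BC nz(2) by simp
    then have "B * C = - 1" using det0 by (simp add: minus_equation_iff [of _ 1])
    then have "cmod \<beta> + cmod \<delta> < r" using s0 by simp
    then show False using \<beta>2 r norm_ge_zero [of \<delta>] by linarith
  qed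
  \<comment> \<open>The first zero is taken: no earlier factor of \<open>\<sigma> j\<close>
    vanishes, so \<open>\<sigma> j = \<delta>\<close> is nonzero.\<close>
  define j where "j = (LEAST j. \<tau> j = 0)"
  have j: "\<tau> j = 0" and jmin: "\<And>i. i < j \<Longrightarrow> \<tau> i \<noteq> 0"
    using LeastI_ex [OF \<open>\<exists>j. \<tau> j = 0\<close>] not_less_Least unfolding j_def by blast+
  have \<sigma>nz: "i \<le> j \<Longrightarrow> \<sigma> i \<noteq> 0" for i
  proof (induction i)
    case 0
    show ?case using BC nz by (simp add: \<sigma>0)
  next
    case (Suc i)
    have "\<sigma> i + 2 - \<delta> \<noteq> 0"
    proof
      assume "\<sigma> i + 2 - \<delta> = 0"
      then have "\<tau> i = 2" unfolding \<tau>_def by (simp add: algebra_simps)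
      then show False using near(1) [OF \<sigma>le [of i]] R r by simp
    qed
    with Suc jmin [of i] show ?case by (simp add: \<sigma>S)
  qed
  have \<delta>\<sigma>: "\<sigma> j = \<delta>" using j by (simp add: \<tau>_def)
  then have \<delta>nz: "\<delta> \<noteq> 0" using \<sigma>nz [of j] by auto
  \<comment> \<open>From \<open>|\<delta>| = |\<sigma> j| \<le> |\<sigma> 0|\<close> follows
    \<open>2 |\<delta>| \<le> R < 31/50\<close>.\<close>
  have \<delta>small: "cmod \<delta> < 31/100"
    using \<sigma>le [of j] R r unfolding R_def \<delta>\<sigma> by linarith
  have bcj: "\<beta> * (b j * c j) = - (2 * \<delta>)"
    using bc [of j] unfolding \<delta>\<sigma> \<beta>_def by (simp add: algebra_simps)
  text \<open>\<open>F ** K j\<close> has order two and the fourth power of \<open>F\<close> is near the identity.\<close>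
  have F4: "mk2 (l ^ 4) 0 0 (1 / l ^ 4) \<in> S" by (rule diag_power_closed(1) [OF F])
  have Y: "mk2 (l * a j) (l * b j) (c j / l) (d j / l) \<in> S"
    using mult_closed [OF F K [of j]] unfolding Kmk by simp
  define \<beta>4 where "\<beta>4 = (l ^ 4 - 1 / l ^ 4)\<^sup>2"
  have \<beta>4: "\<beta>4 = \<delta> * \<delta> * (\<delta> + 2) * \<beta>"
  proof -
    have "l ^ 4 - 1 / l ^ 4 = \<delta> * (l + 1 / l) * m"
      unfolding \<delta> m_def using l by (simp add: field_simps power2_eq_square power4_eq_xxxx)
    moreover have "(l + 1 / l)\<^sup>2 = \<delta> + 2"
      unfolding \<delta> using l by (simp add: power2_eq_square field_simps)
    ultimately show ?thesis
      unfolding \<beta>4_def mm [symmetric] by (simp add: power_mult_distrib power2_eq_square mult_ac)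
  qed
  have \<delta>2: "\<delta> + 2 \<noteq> 0" "cmod (\<delta> + 2) \<le> 231/100" "cmod \<beta> \<le> 231/100"
  proof -
    show "cmod (\<delta> + 2) \<le> 231/100" using norm_triangle_ineq [of \<delta> 2] \<delta>small by simp
    show "cmod \<beta> \<le> 231/100" unfolding \<beta>_def using norm_triangle_ineq4 [of \<delta> 2] \<delta>small by simp
    show "\<delta> + 2 \<noteq> 0" using \<delta>small by (auto simp: add_eq_0_iff2)
  qed
  have 1: "cmod \<beta>4 \<le> 31/100 * (31/100) * (231/100) * (231/100)"
    unfolding \<beta>4 norm_mult using \<delta>small \<delta>2 by (intro mult_mono) auto
  have e: "\<beta>4 * (l * b j * (c j / l)) = - (\<delta> * \<delta> * (\<delta> + 2) * (2 * \<delta>))"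
  proof -
    have "l * b j * (c j / l) = b j * c j" using l by simp
    then have "\<beta>4 * (l * b j * (c j / l)) = \<delta> * \<delta> * (\<delta> + 2) * (\<beta> * (b j * c j))"
      unfolding \<beta>4 by (simp only: mult.assoc)
    then show ?thesis unfolding bcj by (simp only: mult_minus_right)
  qed
  have 2: "cmod (\<beta>4 * (l * b j * (c j / l))) \<le> 31/100 * (31/100) * (231/100) * (2 * (31/100))"
  proof -
    have "cmod (\<beta>4 * (l * b j * (c j / l))) = cmod \<delta> * cmod \<delta> * cmod (\<delta> + 2) * (2 * cmod \<delta>)"
      by (simp only: e norm_minus_cancel norm_mult norm_numeral)
    also have "\<dots> \<le> 31/100 * (31/100) * (231/100) * (2 * (31/100))"
      by (intro mult_mono mult_nonneg_nonneg norm_ge_zero \<delta>2(2) less_imp_le [OF \<delta>small] order_refl)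
        simp_all
    finally show ?thesis .
  qed
  have l4: "l ^ 4 \<noteq> 0" using l by simp
  have \<beta>4nz: "\<beta>4 \<noteq> 0" unfolding \<beta>4 using \<delta>nz \<delta>2(1) nz(1) by simp
  have "cmod (\<beta>4 * (l * b j * (c j / l))) + cmod \<beta>4 < 1" using 1 2 by linarith
  \<comment> \<open>This leaves the product of F and \<open>K j\<close> diagonal or antidiagonal.
    The first contradicts \<open>b j \<noteq> 0\<close>, the second the trace of
    \<open>K j\<close>.\<close>
  note jorgensen_diag [OF F4 l4 Y \<beta>4_def \<beta>4nz this]
  moreover have "b j \<noteq> 0" using bcj \<delta>nz by auto
  ultimately have "a j + d j = 0" using l by auto
  then show False using tr xnz by simp
qed

end

section \<open>Limit points of orbits\<close>

text \<open>The Hermitian product of the vectors \<open>(a z + b, a t)\<close> and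
  \<open>(c z + d, c t)\<close>; \<open>row_form A i\<close> is the squared length of the vector
  belonging to row \<open>i\<close>.\<close>

definition pe_num :: "complex^2^2 \<Rightarrow> complex \<Rightarrow> real \<Rightarrow> complex" where
  "pe_num A z t = (A$1$1 * z + A$1$2) * cnj (A$2$1 * z + A$2$2) + A$1$1 * cnj (A$2$1) * of_real (t\<^sup>2)"

definition row_form :: "complex^2^2 \<Rightarrow> 2 \<Rightarrow> complex \<Rightarrow> real \<Rightarrow> real" where
  "row_form A i z t = (cmod (A$i$1 * z + A$i$2))\<^sup>2 + (cmod (A$i$1))\<^sup>2 * t\<^sup>2"

lemma poincare_extension_eq:
  "poincare_extension A (z, t) = (pe_num A z t / of_real (row_form A 2 z t), t / row_form A 2 z t)"
  by (simp add: poincare_extension_def pe_num_def row_form_def Let_def)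

lemma row_form_eq_0:
  assumes "t > 0" "row_form A i z t = 0"
  shows "A$i$1 = 0" "A$i$2 = 0"
proof -
  have "(cmod (A$i$1))\<^sup>2 * t\<^sup>2 = 0" "(cmod (A$i$1 * z + A$i$2))\<^sup>2 = 0"
    using assms(2) unfolding row_form_def
    by (smt (verit) zero_le_power2 mult_nonneg_nonneg)+
  then show "A$i$1 = 0" "A$i$2 = 0" using assms(1) by auto
qed

lemma row_form_pos:
  assumes "t > 0" "det A = 1"
  shows "row_form A 2 z t > 0"
proof -
  have "row_form A 2 z t \<noteq> 0"
    using row_form_eq_0 [OF assms(1), of A 2 z] assms(2) by (auto simp: det_2)
  moreover have "row_form A 2 z t \<ge> 0" by (simp add: row_form_def)
  ultimately show ?thesis by linarith
qed

text \<open>Lagrange's identity for the two row vectors, whose 2 by 2 determinant has modulus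
  \<open>|det A| t\<close>.\<close>

lemma pe_num_norm:
  "(cmod (pe_num A z t))\<^sup>2 + (cmod (det A))\<^sup>2 * t\<^sup>2 = row_form A 1 z t * row_form A 2 z t"
proof -
  have key: "(cmod (u * cnj v + a * cnj c * of_real T))\<^sup>2 + (cmod (a * v - c * u))\<^sup>2 * T =
      ((cmod u)\<^sup>2 + (cmod a)\<^sup>2 * T) * ((cmod v)\<^sup>2 + (cmod c)\<^sup>2 * T)" for u v a c :: complex and T :: real
  proof -
    have "of_real ((cmod (u * cnj v + a * cnj c * of_real T))\<^sup>2 + (cmod (a * v - c * u))\<^sup>2 * T) =
      (of_real (((cmod u)\<^sup>2 + (cmod a)\<^sup>2 * T) * ((cmod v)\<^sup>2 + (cmod c)\<^sup>2 * T)) :: complex)"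
      by (simp only: of_real_add of_real_mult complex_norm_square complex_cnj_add complex_cnj_diff
          complex_cnj_mult complex_cnj_cnj complex_cnj_complex_of_real) (simp add: algebra_simps)
    then show ?thesis by (simp only: of_real_eq_iff)
  qed
  have "det A = A$1$1 * (A$2$1 * z + A$2$2) - A$2$1 * (A$1$1 * z + A$1$2)"
    by (simp add: det_2 algebra_simps)
  then show ?thesis unfolding pe_num_def row_form_def by (simp only: key)
qed

lemma pe_num_scale: "pe_num (r *\<^sub>R A) z t = of_real (r\<^sup>2) * pe_num A z t"
  unfolding pe_num_def vector_scaleR_component
  by (simp add: power2_eq_square scaleR_conv_of_real algebra_simps)

lemma row_form_scale: "row_form (r *\<^sub>R A) i z t = r\<^sup>2 * row_form A i z t"
proof -
  have "(r *\<^sub>R A)$i$1 * z + (r *\<^sub>R A)$i$2 = r *\<^sub>R (A$i$1 * z + A$i$2)"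
    unfolding vector_scaleR_component by (simp add: scaleR_add_right)
  then show ?thesis
    unfolding row_form_def vector_scaleR_component
    by (simp add: power_mult_distrib distrib_left mult.assoc)
qed

lemma tendsto_pe_num: "X \<longlonglongrightarrow> E \<Longrightarrow> (\<lambda>n. pe_num (X n) z t) \<longlonglongrightarrow> pe_num E z t"
  unfolding pe_num_def by (intro tendsto_intros)

lemma tendsto_row_form: "X \<longlonglongrightarrow> E \<Longrightarrow> (\<lambda>n. row_form (X n) i z t) \<longlonglongrightarrow> row_form E i z t"
  unfolding row_form_def by (intro tendsto_intros)

lemma tendsto_det: "X \<longlonglongrightarrow> E \<Longrightarrow> (\<lambda>n. det (X n)) \<longlonglongrightarrow> det (E :: complex^2^2)"
  unfolding det_2 by (intro tendsto_intros)

text \<open>Rescaled elements of the group converge to a matrix of rank one, whose column space is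
  the limit point.\<close>

lemma (in discrete_sl2_group) limit_point_direction:
  assumes t: "t > 0"
    and q: "Some q \<in> closed_hyp_space derived_set_of (Some ` {poincare_extension A (z, t) |A. A \<in> S})"
  shows "\<exists>X E. (\<forall>n. X n \<in> S) \<and> (\<lambda>n. inverse (norm (X n)) *\<^sub>R X n) \<longlonglongrightarrow> E \<and>
    (\<lambda>n. inverse (norm (X n))) \<longlonglongrightarrow> 0 \<and> E \<noteq> 0 \<and> snd q = 0 \<and>
    E$1$1 = fst q * E$2$1 \<and> E$1$2 = fst q * E$2$2"
proof -
  let ?pe = "\<lambda>A. poincare_extension A (z, t)"
  let ?H = "{(z::complex, t::real). t \<ge> 0}"
  have qH: "q \<in> ?H"
    using q unfolding in_derived_set_of closed_hyp_space_def by auto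
  have "\<exists>A. A \<in> S \<and> norm A > real n \<and> dist (?pe A) q < 1 / real (Suc n)" for n
  proof -
    \<comment> \<open>Finitely many elements have norm at most \<open>n\<close>. A ball around
      \<open>q\<close> avoiding their images other than \<open>q\<close> itself contains only orbit
      points of larger elements.\<close>
    have "finite (?pe ` {A \<in> S. norm A \<le> real n})" using finite_bounded by (rule finite_imageI)
    from finite_set_avoid [OF this, of q] obtain e
      where e: "e > 0" "\<And>x. x \<in> ?pe ` {A \<in> S. norm A \<le> real n} \<Longrightarrow> x \<noteq> q \<Longrightarrow> e \<le> dist q x"
      by blast
    define V where "V = Some ` (?H \<inter> ball q (min e (1 / real (Suc n))))"
    have "openin closed_hyp_space V"
      unfolding V_def closed_hyp_space_def openin_Alexandroff_compactification_image_Some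
      by (intro openin_open_Int open_ball)
    moreover have "Some q \<in> V" unfolding V_def using qH e(1) by auto
    ultimately have "\<exists>y. y \<noteq> Some q \<and> y \<in> Some ` {?pe A |A. A \<in> S} \<and> y \<in> V"
      using q unfolding in_derived_set_of by simp
    then obtain y where y: "y \<noteq> Some q" "y \<in> Some ` {?pe A |A. A \<in> S}" "y \<in> V" by (elim exE conjE)
    from y(2) obtain A where A': "A \<in> S" "y = Some (?pe A)" by blast
    have A: "A \<in> S" "?pe A \<noteq> q" "Some (?pe A) \<in> V" using y A' by simp_all
    then have d: "dist q (?pe A) < e" "dist q (?pe A) < 1 / real (Suc n)"
      unfolding V_def by auto
    have "norm A > real n"
    proof (rule ccontr)
      assume "\<not> norm A > real n"
      then have "?pe A \<in> ?pe ` {A \<in> S. norm A \<le> real n}" using A(1) by auto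
      from e(2) [OF this A(2)] d(1) show False by simp
    qed
    with A(1) d(2) show ?thesis by (auto simp: dist_commute)
  qed
  then have "\<forall>n. \<exists>A. A \<in> S \<and> norm A > real n \<and> dist (?pe A) q < 1 / real (Suc n)" by (rule allI)
  from choice [OF this] obtain X0
    where "\<forall>n. X0 n \<in> S \<and> norm (X0 n) > real n \<and> dist (?pe (X0 n)) q < 1 / real (Suc n)"
    by (rule exE)
  then have X0: "X0 n \<in> S" "norm (X0 n) > real n" "dist (?pe (X0 n)) q < 1 / real (Suc n)" for n
    by simp_all
  have Xpos: "norm (X0 n) > 0" for n using X0(2) [of n] by linarith
  have "inverse (norm (X0 n)) *\<^sub>R X0 n \<in> sphere 0 1" for n
    using Xpos [of n] by simp
  then have "\<exists>E\<in>sphere 0 1. \<exists>\<phi>. strict_mono \<phi> \<and> ((\<lambda>n. inverse (norm (X0 n)) *\<^sub>R X0 n) \<circ> \<phi>) \<longlonglongrightarrow> E"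
    using compact_sphere [of "0 :: complex^2^2" 1] unfolding compact_def by simp
  then obtain E \<phi> where E: "norm E = 1" and \<phi>: "strict_mono (\<phi> :: nat \<Rightarrow> nat)"
    and lim: "((\<lambda>n. inverse (norm (X0 n)) *\<^sub>R X0 n) \<circ> \<phi>) \<longlonglongrightarrow> E"
    by auto
  define X where "X n = X0 (\<phi> n)" for n
  define r where "r n = inverse (norm (X n))" for n
  define Y where "Y n = r n *\<^sub>R X n" for n
  have XS: "X n \<in> S" for n by (simp add: X_def X0)
  have r0: "r n > 0" for n using Xpos by (simp add: r_def X_def)
  have Ylim: "Y \<longlonglongrightarrow> E" using lim by (simp add: Y_def [abs_def] r_def X_def o_def)
  have rlim: "r \<longlonglongrightarrow> 0"
  proof (rule Lim_null_comparison)
    have "norm (r n) \<le> inverse (real n)" if "n \<ge> 1" for n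
    proof -
      have "real n \<le> norm (X n)"
        using X0(2) [of "\<phi> n"] seq_suble [OF \<phi>, of n] unfolding X_def by linarith
      then show ?thesis using that by (simp add: r_def le_imp_inverse_le)
    qed
    then show "\<forall>\<^sub>F n in sequentially. norm (r n) \<le> inverse (real n)"
      unfolding eventually_sequentially by auto
    show "(\<lambda>n. inverse (real n)) \<longlonglongrightarrow> 0" by (rule lim_inverse_n)
  qed
  have pelim: "(\<lambda>n. ?pe (X n)) \<longlonglongrightarrow> q"
  proof -
    have "(\<lambda>n. ?pe (X0 n)) \<longlonglongrightarrow> q" using X0(3) by (rule LIMSEQ_dist_less)
    from LIMSEQ_subseq_LIMSEQ [OF this \<phi>] show ?thesis by (simp add: X_def o_def)
  qed
  define N where "N i A = row_form A i z t" for i A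
  have det: "det (X n) = 1" for n using XS by (rule det_1)
  have Npos: "N 2 (Y n) > 0" for n
    unfolding N_def Y_def row_form_scale using row_form_pos [OF t det] r0 [of n] by simp
  have peX: "?pe (X n) = (pe_num (Y n) z t / of_real (N 2 (Y n)), (r n)\<^sup>2 * t / N 2 (Y n))" for n
    unfolding poincare_extension_eq N_def Y_def row_form_scale pe_num_scale using r0 [of n] by simp
  have f1: "(\<lambda>n. pe_num (Y n) z t / of_real (N 2 (Y n))) \<longlonglongrightarrow> fst q"
    and f2: "(\<lambda>n. (r n)\<^sup>2 * t / N 2 (Y n)) \<longlonglongrightarrow> snd q"
    using tendsto_fst [OF pelim] tendsto_snd [OF pelim] unfolding peX by simp_all
  have Nlim: "(\<lambda>n. N i (Y n)) \<longlonglongrightarrow> N i E" for i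
    unfolding N_def by (rule tendsto_row_form [OF Ylim])
  have numlim: "(\<lambda>n. pe_num (Y n) z t) \<longlonglongrightarrow> pe_num E z t" by (rule tendsto_pe_num [OF Ylim])
  have detY: "det (Y n) = of_real ((r n)\<^sup>2)" for n
  proof -
    have "det (Y n) = of_real ((r n)\<^sup>2) * det (X n)"
      unfolding Y_def det_2 vector_scaleR_component
      by (simp add: scaleR_conv_of_real power2_eq_square algebra_simps)
    then show ?thesis by (simp add: det)
  qed
  have "(\<lambda>n. complex_of_real ((r n)\<^sup>2)) \<longlonglongrightarrow> of_real (0\<^sup>2)"
    by (intro tendsto_of_real tendsto_power rlim)
  then have detE: "det E = 0"
    using LIMSEQ_unique [OF tendsto_det [OF Ylim]] unfolding detY by simp
  \<comment> \<open>\<open>pe_num_norm\<close> divided by \<open>N 2\<close>. In the limit it shows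
    that \<open>N 2 E = 0\<close> would entail \<open>N 1 E = 0\<close>, hence \<open>E = 0\<close>;
    finiteness of the limit point \<open>q\<close> is what makes this work.\<close>
  have eq1: "(cmod (pe_num (Y n) z t / of_real (N 2 (Y n))))\<^sup>2 * N 2 (Y n) +
      ((r n)\<^sup>2 * t / N 2 (Y n))\<^sup>2 * N 2 (Y n) = N 1 (Y n)" for n
  proof -
    have "N 1 (Y n) * N 2 (Y n) = (cmod (pe_num (Y n) z t))\<^sup>2 + ((r n)\<^sup>2)\<^sup>2 * t\<^sup>2"
      unfolding N_def pe_num_norm [symmetric] detY by (simp add: norm_power)
    then have "N 1 (Y n) = ((cmod (pe_num (Y n) z t))\<^sup>2 + ((r n)\<^sup>2)\<^sup>2 * t\<^sup>2) / N 2 (Y n)"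
      using Npos [of n] by (simp add: field_simps)
    then show ?thesis
      using Npos [of n] by (simp add: norm_divide power_divide power_mult_distrib power2_eq_square field_simps)
  qed
  have "(\<lambda>n. (cmod (pe_num (Y n) z t / of_real (N 2 (Y n))))\<^sup>2 * N 2 (Y n) +
      ((r n)\<^sup>2 * t / N 2 (Y n))\<^sup>2 * N 2 (Y n)) \<longlonglongrightarrow> (cmod (fst q))\<^sup>2 * N 2 E + (snd q)\<^sup>2 * N 2 E"
    by (intro tendsto_intros f1 f2 Nlim)
  then have N12: "(cmod (fst q))\<^sup>2 * N 2 E + (snd q)\<^sup>2 * N 2 E = N 1 E"
    unfolding eq1 using Nlim LIMSEQ_unique by blast
  have N2: "N 2 E \<noteq> 0"
  proof
    assume 0: "N 2 E = 0"
    then have "N 1 E = 0" using N12 by simp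
    then have "E = 0"
      using 0 row_form_eq_0 [OF t] unfolding N_def by (simp add: vec_eq_iff forall_2)
    then show False using E by simp
  qed
  have "(\<lambda>n. (r n)\<^sup>2 * t / N 2 (Y n)) \<longlonglongrightarrow> 0\<^sup>2 * t / N 2 E"
    by (intro tendsto_intros rlim Nlim N2)
  from LIMSEQ_unique [OF f2 this] have q2: "snd q = 0" by simp
  have "(\<lambda>n. pe_num (Y n) z t / of_real (N 2 (Y n))) \<longlonglongrightarrow> pe_num E z t / of_real (N 2 E)"
    using N2 by (intro tendsto_intros numlim Nlim) simp
  from LIMSEQ_unique [OF f1 this] have q1: "fst q = pe_num E z t / of_real (N 2 E)" .
  obtain \<rho> where \<rho>: "E$1$1 = \<rho> * E$2$1" "E$1$2 = \<rho> * E$2$2"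
  proof (cases "E$2$1 = 0")
    case False
    have "E$1$2 = E$1$1 / E$2$1 * E$2$2" using detE False by (simp add: det_2 field_simps)
    then show ?thesis using False by (intro that [of "E$1$1 / E$2$1"]) auto
  next
    case True
    then have nz: "E$2$2 \<noteq> 0" using N2 by (auto simp: N_def row_form_def)
    then have "E$1$1 = 0" using True detE by (simp add: det_2)
    then show ?thesis using True nz by (intro that [of "E$1$2 / E$2$2"]) auto
  qed
  have "pe_num E z t = \<rho> * of_real (N 2 E)"
    unfolding pe_num_def N_def row_form_def \<rho>
    by (simp add: complex_norm_square algebra_simps del: of_real_power)
  then have "fst q = \<rho>" unfolding q1 using N2 by simp
  then have "E$1$1 = fst q * E$2$1 \<and> E$1$2 = fst q * E$2$2" using \<rho> by simp
  moreover have "E \<noteq> 0" using E by auto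
  moreover have "(\<lambda>n. inverse (norm (X n)) *\<^sub>R X n) \<longlonglongrightarrow> E" "(\<lambda>n. inverse (norm (X n))) \<longlonglongrightarrow> 0"
    using Ylim rlim by (simp_all add: Y_def [abs_def] r_def [abs_def])
  ultimately show ?thesis using XS q2 by auto
qed

text \<open>Orbit points have positive height, so they differ from the boundary point that they
  approach.\<close>

lemma limit_point_derived:
  assumes t: "t > 0" and X: "\<And>n::nat. X n \<in> S" "\<And>n. det (X n) = 1"
    and lim: "(\<lambda>n. poincare_extension (X n) (z, t)) \<longlonglongrightarrow> (\<rho>, 0)"
  shows "Some (\<rho>, 0) \<in> closed_hyp_space derived_set_of (Some ` {poincare_extension A (z, t) |A. A \<in> S})"
  unfolding in_derived_set_of
proof (intro conjI allI impI)
  show "Some (\<rho>, 0) \<in> topspace closed_hyp_space"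
    by (simp add: closed_hyp_space_def)
  fix U assume U: "Some (\<rho>, 0) \<in> U \<and> openin closed_hyp_space U"
  have "openin (top_of_set {(z::complex, t::real). t \<ge> 0}) {x \<in> topspace (top_of_set {(z, t). t \<ge> 0}). Some x \<in> U}"
    using U openin_continuous_map_preimage [OF continuous_map_Some] unfolding closed_hyp_space_def by blast
  then obtain T where T: "open T" "{x \<in> {(z::complex, t::real). t \<ge> 0}. Some x \<in> U} = {(z, t). t \<ge> 0} \<inter> T"
    unfolding openin_open by auto
  have "(\<rho>, 0) \<in> {x \<in> {(z::complex, t::real). t \<ge> 0}. Some x \<in> U}" using U by simp
  then have "(\<rho>, 0) \<in> T" unfolding T(2) by simp
  then have "\<forall>\<^sub>F n in sequentially. poincare_extension (X n) (z, t) \<in> T"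
    using topological_tendstoD [OF lim T(1)] by blast
  then obtain n where n: "poincare_extension (X n) (z, t) \<in> T"
    using eventually_happens' [OF sequentially_bot] by blast
  have pos: "snd (poincare_extension (X n) (z, t)) > 0"
    using row_form_pos [OF t X(2)] t by (simp add: poincare_extension_eq)
  then have "poincare_extension (X n) (z, t) \<in> {(z::complex, t::real). t \<ge> 0} \<inter> T"
    using n by (simp add: case_prod_beta)
  then have "Some (poincare_extension (X n) (z, t)) \<in> U" unfolding T(2) [symmetric] by simp
  moreover have "Some (poincare_extension (X n) (z, t)) \<noteq> Some (\<rho>, 0)" using pos by auto
  moreover have "Some (poincare_extension (X n) (z, t)) \<in> Some ` {poincare_extension A (z, t) |A. A \<in> S}"
    using X(1) [of n] by (intro imageI CollectI exI [of _ "X n"]) simp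
  ultimately show "\<exists>y. y \<noteq> Some (\<rho>, 0) \<and> y \<in> Some ` {poincare_extension A (z, t) |A. A \<in> S} \<and> y \<in> U"
    by (intro exI conjI)
qed

section \<open>The lower bound\<close>

lemma conj_scaleR:
  fixes A P Q :: "complex^2^2"
  shows "Q ** (k *\<^sub>R A) ** P = k *\<^sub>R (Q ** A ** P)"
  by (simp add: vec_eq_iff forall_2 matrix_matrix_mult_def sum_2 scaleR_add_right distrib_right)

text \<open>In the basis given by the columns of P the group is upper triangular, and either its
  diagonals are unimodular or it is diagonal. The rank-one limits of
  \<open>limit_point_direction\<close> then have one of the two columns of P as image, which leaves
  two finite limit points.\<close>

lemma elementary_of_reducible:
  fixes P Q :: "complex^2^2"
  assumes disc: "discrete_sl2_group (\<Union>G)" and PQ: "P ** Q = mat 1" "Q ** P = mat 1"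
    and tri: "\<And>A. A \<in> \<Union>G \<Longrightarrow> (Q ** A ** P)$2$1 = 0"
    and alt: "(\<forall>A\<in>\<Union>G. cmod ((Q ** A ** P)$1$1) = 1) \<or> (\<forall>A\<in>\<Union>G. (Q ** A ** P)$1$2 = 0)"
  shows "elementary G"
  unfolding elementary_def
proof
  interpret discrete_sl2_group "\<Union>G" by fact
  fix p assume "p \<in> hyp_space"
  then obtain z t where p: "p = (z, t)" and t: "t > 0" by (auto simp: hyp_space_def)
  let ?D = "closed_hyp_space derived_set_of (Some ` psl_orbit G p)"
  \<comment> \<open>A column of P with second entry 0 stands for infinity, which \<open>None\<close>
    covers; division by zero then merely lists the extra point 0.\<close>
  have "x \<in> {None, Some (P$1$1 / P$2$1, 0), Some (P$1$2 / P$2$2, 0)}" if x: "x \<in> ?D" for x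
  proof (cases x)
    case (Some q)
    have "Some q \<in> closed_hyp_space derived_set_of (Some ` {poincare_extension A (z, t) |A. A \<in> \<Union>G})"
      using x unfolding Some psl_orbit_def p .
    from limit_point_direction [OF t this] obtain X E where *: "(\<forall>n. X n \<in> \<Union>G) \<and>
      (\<lambda>n. inverse (norm (X n)) *\<^sub>R X n) \<longlonglongrightarrow> E \<and> (\<lambda>n. inverse (norm (X n))) \<longlonglongrightarrow> 0 \<and>
      E \<noteq> 0 \<and> snd q = 0 \<and> E$1$1 = fst q * E$2$1 \<and> E$1$2 = fst q * E$2$2"
      by (elim exE)
    have X: "X n \<in> \<Union>G" for n by (rule spec [OF conjunct1 [OF *]])
    note * = conjunct2 [OF *]
    have lim: "(\<lambda>n. inverse (norm (X n)) *\<^sub>R X n) \<longlonglongrightarrow> E" by (rule conjunct1 [OF *])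
    have rlim: "(\<lambda>n. inverse (norm (X n))) \<longlonglongrightarrow> 0" by (rule conjunct1 [OF conjunct2 [OF *]])
    have E: "E \<noteq> 0" "snd q = 0" "E$1$1 = fst q * E$2$1" "E$1$2 = fst q * E$2$2"
      using conjunct2 [OF conjunct2 [OF *]] by simp_all
    define E' where "E' = Q ** E ** P"
    define r where "r n = complex_of_real (inverse (norm (X n)))" for n
    define Y where "Y n = Q ** X n ** P" for n
    have YS: "X n \<in> \<Union>G" for n by (rule X)
    have detY: "det (Y n) = 1" for n
      unfolding Y_def by (rule matrix_inv_conj(2) [OF det_1 [OF X] PQ])
    have "(\<lambda>n. inverse (norm (X n)) *\<^sub>R Y n) \<longlonglongrightarrow> E'"
      unfolding E'_def Y_def conj_scaleR [symmetric]
      by (intro tendsto_matrix_mult tendsto_const lim)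
    then have "(\<lambda>n. (inverse (norm (X n)) *\<^sub>R Y n) $ i $ j) \<longlonglongrightarrow> E' $ i $ j" for i j
      by (intro tendsto_vec_nth)
    then have ent: "(\<lambda>n. r n * Y n $ i $ j) \<longlonglongrightarrow> E' $ i $ j" for i j
      unfolding vector_scaleR_component r_def by (simp add: scaleR_conv_of_real)
    have r0: "r \<longlonglongrightarrow> 0"
      using tendsto_of_real [OF rlim, where 'a = complex] unfolding r_def [abs_def] by simp
    have Y21: "Y n $2$1 = 0" for n unfolding Y_def by (rule tri [OF YS])
    have Y1122: "Y n $1$1 * Y n $2$2 = 1" for n
      using detY [of n] by (simp add: det_2 Y21)
    have E21: "E' $2$1 = 0" using ent [of 2 1] by (simp add: Y21 LIMSEQ_const_iff)
    \<comment> \<open>Scaling by \<open>r n\<close> kills unimodular entries. In the diagonal case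
      only the product of the two scaled entries is known to tend to 0, hence the
      alternative.\<close>
    have "E'$2$2 = 0 \<or> (E'$1$1 = 0 \<and> E'$1$2 = 0)"
      using alt
    proof
      assume u: "\<forall>A\<in>\<Union>G. cmod ((Q ** A ** P)$1$1) = 1"
      have Y11: "cmod (Y n $1$1) = 1" for n using bspec [OF u X] unfolding Y_def .
      have Y22: "cmod (Y n $2$2) = 1" for n
        using arg_cong [OF Y1122 [of n], of cmod] unfolding norm_mult Y11 by simp
      have "(\<lambda>n. cmod (r n * Y n $2$2)) \<longlonglongrightarrow> 0"
        using tendsto_norm_zero [OF r0] by (simp only: norm_mult Y22 mult_1_right)
      then have "(\<lambda>n. r n * Y n $2$2) \<longlonglongrightarrow> 0" by (rule tendsto_norm_zero_cancel)
      from LIMSEQ_unique [OF ent [of 2 2] this] show ?thesis ..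
    next
      assume u: "\<forall>A\<in>\<Union>G. (Q ** A ** P)$1$2 = 0"
      have "Y n $1$2 = 0" for n using bspec [OF u X] unfolding Y_def .
      then have E12: "E'$1$2 = 0" using ent [of 1 2] by (simp add: LIMSEQ_const_iff)
      have lim2: "(\<lambda>n. (r n * Y n $1$1) * (r n * Y n $2$2)) \<longlonglongrightarrow> E'$1$1 * E'$2$2"
        by (intro tendsto_mult ent)
      have rr: "(r n * Y n $1$1) * (r n * Y n $2$2) = r n * r n" for n
      proof -
        have "(r n * Y n $1$1) * (r n * Y n $2$2) = r n * r n * (Y n $1$1 * Y n $2$2)"
          by (simp only: mult_ac)
        then show ?thesis unfolding Y1122 by simp
      qed
      have "(\<lambda>n. r n * r n) \<longlonglongrightarrow> 0 * 0" by (intro tendsto_mult r0)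
      with lim2 [unfolded rr] have "E'$1$1 * E'$2$2 = 0 * 0" by (rule LIMSEQ_unique)
      then show ?thesis using E12 by auto
    qed
    have "E = P ** (E' ** Q)"
    proof -
      have "P ** (E' ** Q) = (P ** Q) ** E ** (P ** Q)"
        unfolding E'_def by (simp only: matrix_mul_assoc)
      then show ?thesis by (simp add: PQ)
    qed
    have mm: "(A ** B) $ i $ j = A$i$1 * B$1$j + A$i$2 * B$2$j" for A B :: "complex^2^2" and i j
      by (simp add: matrix_matrix_mult_def sum_2)
    have Eent: "E $ i $ j = P$i$1 * (E' ** Q)$1$j + P$i$2 * (E' ** Q)$2$j" for i j
      using arg_cong [OF \<open>E = P ** (E' ** Q)\<close>, of "\<lambda>M. M $ i $ j"] unfolding mm [of P] .
    have EQ: "(E' ** Q) $ i $ j = E'$i$1 * Q$1$j + E'$i$2 * Q$2$j" for i j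
      by (rule mm)
    have col: "fst q = P$1$k / P$2$k" if k: "\<And>i j. E $ i $ j = P$i$k * v j" for k v
    proof -
      have E0: "E = 0" if "\<And>i j. E $ i $ j = 0"
        using that by (simp add: vec_eq_iff)
      have "v 1 \<noteq> 0 \<or> v 2 \<noteq> 0"
      proof (rule ccontr)
        assume "\<not> (v 1 \<noteq> 0 \<or> v 2 \<noteq> 0)"
        then have "v j = 0" for j using exhaust_2 [of j] by auto
        then have "E = 0" by (intro E0) (simp only: k mult_zero_right)
        with E(1) show False ..
      qed
      moreover have "P$1$k * v 1 = (fst q * P$2$k) * v 1" "P$1$k * v 2 = (fst q * P$2$k) * v 2"
        using E(3,4) unfolding k mult.assoc by simp_all
      ultimately have eq: "P$1$k = fst q * P$2$k"
        unfolding mult_cancel_right by blast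
      have "P$2$k \<noteq> 0"
      proof
        assume P2: "P$2$k = 0"
        have P1: "P$1$k = 0" unfolding eq P2 by simp
        have "P$i$k = 0" for i using exhaust_2 [of i] P1 P2 by auto
        then have "E = 0" by (intro E0) (simp only: k mult_zero_left)
        with E(1) show False ..
      qed
      then show ?thesis unfolding eq by simp
    qed
    from \<open>E'$2$2 = 0 \<or> (E'$1$1 = 0 \<and> E'$1$2 = 0)\<close> have "fst q = P$1$1 / P$2$1 \<or> fst q = P$1$2 / P$2$2"
    proof (elim disjE conjE)
      assume "E'$2$2 = 0"
      then have "E $ i $ j = P$i$1 * (E' ** Q)$1$j" for i j
        unfolding Eent EQ [of 2] by (simp only: E21 mult_zero_left mult_zero_right add_0_right)
      then have "fst q = P$1$1 / P$2$1" by (rule col)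
      then show ?thesis ..
    next
      assume "E'$1$1 = 0" "E'$1$2 = 0"
      then have "E $ i $ j = P$i$2 * (E' ** Q)$2$j" for i j
        unfolding Eent EQ [of 1] by (simp only: mult_zero_left mult_zero_right add_0_left)
      then have "fst q = P$1$2 / P$2$2" by (rule col)
      then show ?thesis ..
    qed
    then have "q = (P$1$1 / P$2$1, 0) \<or> q = (P$1$2 / P$2$2, 0)"
      using E(2) by (simp add: prod_eq_iff)
    then show ?thesis unfolding Some by (elim disjE) simp_all
  qed simp
  then have "?D \<subseteq> {None, Some (P$1$1 / P$2$1, 0), Some (P$1$2 / P$2$2, 0)}" by (rule subsetI)
  then show "finite ?D" by (rule finite_subset) simp
qed

text \<open>Pulls a matrix group in eigenbasis coordinates back to the original ones, in the shape
  that \<open>Union_generate_subset\<close> asks for.\<close>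

lemma sl2_group_conj:
  fixes P Q :: "complex^2^2"
  assumes "sl2_group U" and PQ: "P ** Q = mat 1" "Q ** P = mat 1"
  shows "sl2_group {A. det A = 1 \<and> Q ** A ** P \<in> U}"
proof -
  interpret sl2_group U by fact
  show ?thesis
  proof
    show "mat 1 \<in> {A. det A = 1 \<and> Q ** A ** P \<in> U}"
      using one_closed PQ by simp
  next
    fix A B assume "A \<in> {A. det A = 1 \<and> Q ** A ** P \<in> U}" "B \<in> {A. det A = 1 \<and> Q ** A ** P \<in> U}"
    then have AB: "det A = 1" "det B = 1" "Q ** A ** P \<in> U" "Q ** B ** P \<in> U" by auto
    have "(Q ** A ** P) ** (Q ** B ** P) = Q ** A ** (P ** Q) ** B ** P"
      by (simp only: matrix_mul_assoc)
    also have "\<dots> = Q ** (A ** B) ** P" by (simp add: PQ matrix_mul_assoc)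
    finally show "A ** B \<in> {A. det A = 1 \<and> Q ** A ** P \<in> U}"
      using AB mult_closed [OF AB(3,4)] by (simp add: det_mul)
  next
    fix A assume "A \<in> {A. det A = 1 \<and> Q ** A ** P \<in> U}"
    then show "matrix_inv A \<in> {A. det A = 1 \<and> Q ** A ** P \<in> U}"
      using inv_closed by (auto simp: det_one_inverse matrix_inv_conj(1) [OF _ PQ, symmetric])
  qed simp
qed

lemma conj_diag:
  fixes A P D :: "complex^2^2"
  assumes "A ** P = P ** D" "det P \<noteq> 0"
  obtains Q where "P ** Q = mat 1" "Q ** P = mat 1" "Q ** A ** P = (D :: complex^2^2)"
proof -
  have "invertible P" using assms(2) by (simp add: invertible_det_nz)
  then obtain Q where Q: "P ** Q = mat 1" "Q ** P = mat 1" unfolding invertible_def by blast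
  have "Q ** A ** P = Q ** (A ** P)" by (simp only: matrix_mul_assoc)
  also have "\<dots> = (Q ** P) ** D" unfolding assms(1) by (simp only: matrix_mul_assoc)
  finally show thesis using Q by (intro that) auto
qed

lemma diagonalize:
  fixes A :: "complex^2^2"
  assumes "det A = 1" "trace A = l + 1 / l" "l \<noteq> 0" "l \<noteq> 1 / l"
  shows "\<exists>P Q. P ** Q = mat 1 \<and> Q ** P = mat 1 \<and> Q ** A ** P = mk2 l 0 0 (1 / l)"
proof -
  define k where "k = 1 / l"
  have lk: "l * k = 1" "l \<noteq> k" using assms(3,4) by (simp_all add: k_def)
  obtain a b c d where A: "A = mk2 a b c d" by (rule mk2_cases)
  have d: "d = l + k - a" using assms(2) by (simp add: A k_def algebra_simps)
  have det: "a * d - b * c = 1" using assms(1) by (simp add: A)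
  have bc: "b * c = - ((a - l) * (a - k))" using det lk(1) unfolding d by algebra
  have "\<exists>P. A ** P = P ** mk2 l 0 0 k \<and> det P \<noteq> 0"
  proof (cases "c = 0")
    case False
    have 1: "a * (a - k) + b * c = (a - k) * l" "a * (a - l) + b * c = (a - l) * k"
      using bc by algebra+
    have 2: "c * (a - k) + d * c = c * l" "c * (a - l) + d * c = c * k"
      unfolding d by algebra+
    \<comment> \<open>For an eigenvalue \<open>x\<close> the column \<open>(x - d, c)\<close> is an
      eigenvector, and \<open>l - d = a - k\<close>. If \<open>c = 0\<close> but
      \<open>b \<noteq> 0\<close>, the column \<open>(b, x - a)\<close> is used below.\<close>
    have "A ** mk2 (a - k) (a - l) c c = mk2 (a - k) (a - l) c c ** mk2 l 0 0 k"
      unfolding A by (simp add: 1 2)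
    moreover have "det (mk2 (a - k) (a - l) c c) \<noteq> 0"
    proof -
      have "det (mk2 (a - k) (a - l) c c) = c * (l - k)" by (simp add: algebra_simps)
      then show ?thesis using False lk(2) by simp
    qed
    ultimately show ?thesis by blast
  next
    case c: True
    then have a: "a = l \<or> a = k" using bc by auto
    show ?thesis
    proof (cases "b = 0")
      case False
      have 1: "a * b + b * (l - a) = b * l" "a * b + b * (k - a) = b * k" by algebra+
      have 2: "d * (l - a) = (l - a) * l" "d * (k - a) = (k - a) * k"
        using a unfolding d by auto
      have "A ** mk2 b b (l - a) (k - a) = mk2 b b (l - a) (k - a) ** mk2 l 0 0 k"
        unfolding A by (simp add: 1 2 c)
      moreover have "det (mk2 b b (l - a) (k - a)) \<noteq> 0"
      proof -
        have "det (mk2 b b (l - a) (k - a)) = b * (k - l)" by (simp add: algebra_simps)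
        then show ?thesis using False lk(2) by simp
      qed
      ultimately show ?thesis by blast
    next
      case b: True
      from a show ?thesis
      proof
        assume "a = l"
        then have "A ** mat 1 = mat 1 ** mk2 l 0 0 k" by (simp add: A b c d)
        moreover have "det (mat 1 :: complex^2^2) \<noteq> 0" by simp
        ultimately show ?thesis by blast
      next
        assume "a = k"
        then have "A ** mk2 0 1 1 0 = mk2 0 1 1 0 ** mk2 l 0 0 k" by (simp add: A b c d)
        moreover have "det (mk2 0 1 1 0) \<noteq> 0" by simp
        ultimately show ?thesis by blast
      qed
    qed
  qed
  then obtain P where P: "A ** P = P ** mk2 l 0 0 k" "det P \<noteq> 0" by blast
  from conj_diag [OF this] obtain Q
    where "P ** Q = mat 1" "Q ** P = mat 1" "Q ** A ** P = mk2 l 0 0 k" .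
  then show ?thesis unfolding k_def by blast
qed

text \<open>Conjugation by powers of the diagonal element, or of its inverse, shrinks the
  translation \<open>w\<close> to 0, which discreteness allows only for
  \<open>w = 0\<close>.\<close>

lemma (in discrete_sl2_group) no_parabolic_fixing_loxodromic_point:
  assumes F: "mk2 l 0 0 (1 / l) \<in> S" and l: "l \<noteq> 0" "cmod l \<noteq> 1" and T: "mk2 1 w 0 1 \<in> S"
  shows "w = 0"
proof -
  have "\<exists>h. h \<noteq> 0 \<and> cmod h < 1 \<and> mk2 h 0 0 (1 / h) \<in> S"
  proof (cases "cmod l < 1")
    case True
    then show ?thesis using F l by blast
  next
    case False
    then have "cmod (1 / l) < 1" using l by (simp add: norm_divide)
    moreover have "mk2 (1 / l) 0 0 (1 / (1 / l)) \<in> S" using inv_closed_mk2 [OF F] by simp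
    ultimately show ?thesis using l by (intro exI [of _ "1 / l"]) simp
  qed
  then obtain h where h: "h \<noteq> 0" "cmod h < 1" "mk2 h 0 0 (1 / h) \<in> S" by blast
  have eq: "mk2 (h ^ n) 0 0 (1 / h ^ n) ** mk2 1 w 0 1 ** mk2 (1 / h ^ n) 0 0 (h ^ n) =
      mk2 1 (h ^ n * h ^ n * w) 0 1" for n
    using h(1) by simp
  have XS: "mk2 1 (h ^ n * h ^ n * w) 0 1 \<in> S" for n
    unfolding eq [symmetric] by (intro mult_closed diag_power_closed T h(3))
  have "(\<lambda>n. h ^ n * h ^ n * w) \<longlonglongrightarrow> 0 * 0 * w"
    by (intro tendsto_mult LIMSEQ_power_zero tendsto_const h(2))
  then have "(\<lambda>n. mk2 1 (h ^ n * h ^ n * w) 0 1) \<longlonglongrightarrow> mk2 1 0 0 1"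
    by (intro tendsto_mk2 tendsto_const) simp
  then obtain n where "mk2 1 (h ^ n * h ^ n * w) 0 1 = mat 1"
    using isolated [where X = "\<lambda>n. mk2 1 (h ^ n * h ^ n * w) 0 1", OF XS] by (auto simp: mat_1_mk2)
  then show ?thesis using h(1) by (simp add: mat_1_mk2)
qed

text \<open>Here order two of the second generator enters: \<open>a^2 = - 1\<close>, so its diagonal
  is unimodular. If \<open>|l| = 1\<close>, all diagonals in the group are unimodular. Otherwise the
  commutator of the generators is a translation sharing a fixed point with a loxodromic element,
  hence trivial; this gives \<open>b = 0\<close> and a diagonal group.\<close>

lemma elementary_triangular:
  fixes P Q A B :: "complex^2^2"
  assumes disc: "discrete_sl2_group (\<Union>G)" and G: "G = generate PSL2C {{A, - A}, {B, - B}}"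
    and AB: "A \<in> \<Union>G" "B \<in> \<Union>G"
    and PQ: "P ** Q = mat 1" "Q ** P = mat 1" and A: "Q ** A ** P = mk2 l 0 0 (1 / l)"
    and l: "l \<noteq> 0" "l\<^sup>2 \<noteq> 1" and B: "Q ** B ** P = mk2 a b 0 (- a)"
  shows "elementary G"
proof -
  interpret G: discrete_sl2_group "\<Union>G" by fact
  interpret D: discrete_sl2_group "(\<lambda>A. Q ** A ** P) ` \<Union>G" by (rule discrete_conj [OF disc PQ])
  have FS: "mk2 l 0 0 (1 / l) \<in> (\<lambda>A. Q ** A ** P) ` \<Union>G" using AB(1) A by (metis imageI)
  have HS: "mk2 a b 0 (- a) \<in> (\<lambda>A. Q ** A ** P) ` \<Union>G" using AB(2) B by (metis imageI)
  have det: "det A = 1" "det B = 1" using AB G.det_1 by blast+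
  have aa: "a * a = - 1" using D.mk2_det_1 [OF HS] by (simp add: equation_minus_iff)
  then have na: "cmod a = 1"
  proof -
    have "cmod a * cmod a = 1" unfolding norm_mult [symmetric] aa by simp
    then show ?thesis using norm_ge_zero [of a] square_eq_1_iff [of "cmod a"] by auto
  qed
  have anz: "a \<noteq> 0" using na by auto
  have ainv: "- a = 1 / a" using aa anz by (simp add: eq_divide_eq)
  have mQP: "Q ** (- mat 1) ** P = - mat 1"
    using PQ by (simp add: matrix_mult_minus_left matrix_mult_minus_right)
  have sub: "\<Union>G \<subseteq> {A. det A = 1 \<and> Q ** A ** P \<in> U}"
    if U: "sl2_group U" "- mat 1 \<in> U" "mk2 l 0 0 (1 / l) \<in> U" "mk2 a b 0 (- a) \<in> U" for U
    unfolding G using U det A B mQP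
    by (intro Union_generate_subset sl2_group_conj PQ) (auto simp: det_minus_2)
  have b0: "b = 0" if l1: "cmod l \<noteq> 1"
  proof -
    have mem: "mk2 l 0 0 (1 / l) ** mk2 a b 0 (- a) ** mk2 (1 / l) 0 0 l ** mk2 (- a) (- b) 0 a \<in>
        (\<lambda>A. Q ** A ** P) ` \<Union>G"
      using D.inv_closed_mk2 [OF FS] D.inv_closed_mk2 [OF HS]
      by (intro D.mult_closed FS HS) simp_all
    have eq: "mk2 l 0 0 k ** mk2 a b 0 (- a) ** mk2 k 0 0 l ** mk2 (- a) (- b) 0 a =
        mk2 1 (a * b * (l\<^sup>2 - 1)) 0 1" if "l * k = 1" for k
    proof -
      have "l * a * k * (- a) = 1" "l * a * k * (- b) + l * b * l * a = a * b * (l\<^sup>2 - 1)"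
        "k * (- a) * l * a = 1"
        using that aa by algebra+
      then show ?thesis by simp
    qed
    have "l * (1 / l) = 1" using l(1) by simp
    from mem have "mk2 1 (a * b * (l\<^sup>2 - 1)) 0 1 \<in> (\<lambda>A. Q ** A ** P) ` \<Union>G"
      unfolding eq [OF \<open>l * (1 / l) = 1\<close>] .
    then have "a * b * (l\<^sup>2 - 1) = 0"
      by (rule D.no_parabolic_fixing_loxodromic_point [OF FS l(1) l1])
    then show ?thesis using l(2) anz by simp
  qed
  \<comment> \<open>One condition for both cases, so that closure under the group operations is
    checked once.\<close>
  let ?ok = "\<lambda>u v. u \<noteq> 0 \<and> (if cmod l = 1 then cmod u = 1 else v = 0)"
  let ?U = "{mk2 u v 0 (1 / u) |u v. ?ok u v}"
  have UI: "mk2 u v 0 (1 / u) \<in> ?U" if ok: "?ok u v" for u v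
    by (rule CollectI, rule exI [of _ u], rule exI [of _ v], rule conjI [OF refl ok])
  have "sl2_group ?U"
  proof
    show "det A = 1" if "A \<in> ?U" for A using that by auto
    show "mat 1 \<in> ?U" using UI [of 1 0] by (simp add: mat_1_mk2)
    fix A assume "A \<in> ?U"
    then obtain u v where A: "A = mk2 u v 0 (1 / u)" "?ok u v" by blast
    have "matrix_inv A = mk2 (1 / u) (- v) 0 u"
      unfolding A(1) by (subst matrix_inv_mk2) (use A(2) in simp_all)
    then show "matrix_inv A \<in> ?U"
      using UI [of "1 / u" "- v"] A(2) by (simp add: norm_divide split: if_splits)
    fix B assume "B \<in> ?U"
    then obtain u' v' where B: "B = mk2 u' v' 0 (1 / u')" "?ok u' v'" by blast
    have "A ** B = mk2 (u * u') (u * v' + v / u') 0 (1 / (u * u'))" unfolding A(1) B(1) by simp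
    then show "A ** B \<in> ?U"
      using UI [of "u * u'" "u * v' + v / u'"] A(2) B(2) by (simp add: norm_mult split: if_splits)
  qed
  moreover have "- mat 1 \<in> ?U" using UI [of "- 1" 0] by (simp add: mat_1_mk2)
  moreover have "mk2 l 0 0 (1 / l) \<in> ?U" using UI [of l 0] l(1) by simp
  moreover have "mk2 a b 0 (- a) \<in> ?U" using UI [of a b] na anz b0 unfolding ainv by simp
  ultimately have "\<Union>G \<subseteq> {A. det A = 1 \<and> Q ** A ** P \<in> ?U}" by (rule sub)
  then have *: "\<exists>u v. Q ** A ** P = mk2 u v 0 (1 / u) \<and> ?ok u v" if "A \<in> \<Union>G" for A
    using that by blast
  show ?thesis
  proof (rule elementary_of_reducible [OF disc PQ])
    show "(Q ** A ** P)$2$1 = 0" if "A \<in> \<Union>G" for A using * [OF that] by auto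
    have "if cmod l = 1 then cmod ((Q ** A ** P)$1$1) = 1 else (Q ** A ** P)$1$2 = 0" if "A \<in> \<Union>G" for A
      using * [OF that] by (auto split: if_splits)
    then show "(\<forall>A\<in>\<Union>G. cmod ((Q ** A ** P)$1$1) = 1) \<or> (\<forall>A\<in>\<Union>G. (Q ** A ** P)$1$2 = 0)"
      by (cases "cmod l = 1") simp_all
  qed
qed

lemma ex_eigenvalue:
  fixes x :: complex
  shows "\<exists>l. l \<noteq> 0 \<and> x = l + 1 / l"
proof -
  define s where "s = csqrt (x\<^sup>2 - 4)"
  have "s\<^sup>2 = x\<^sup>2 - 4" by (simp add: s_def)
  then have p: "((x + s) / 2) * ((x - s) / 2) = 1" by (simp add: power2_eq_square field_simps)
  then have nz: "(x + s) / 2 \<noteq> 0" by auto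
  have "(x - s) / 2 = 1 / ((x + s) / 2)" using p nz by (simp add: eq_divide_eq mult.commute)
  moreover have "x = (x + s) / 2 + (x - s) / 2" by (simp add: field_simps)
  ultimately have "x = (x + s) / 2 + 1 / ((x + s) / 2)" by (simp only:)
  with nz show ?thesis by blast
qed

lemma trace_conj:
  fixes X P Q :: "complex^2^2"
  assumes "P ** Q = mat 1"
  shows "trace (Q ** X ** P) = trace X"
  using trace_mul_sym [of "Q ** X" P] by (simp add: matrix_mul_assoc assms)

lemma commutator_conj:
  fixes A B P Q :: "complex^2^2"
  assumes "det A = 1" "det B = 1" and PQ: "P ** Q = mat 1" "Q ** P = mat 1"
  shows "trace (A ** B ** matrix_inv A ** matrix_inv B) =
    trace ((Q ** A ** P) ** (Q ** B ** P) ** matrix_inv (Q ** A ** P) ** matrix_inv (Q ** B ** P))"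
proof -
  have m: "(Q ** X ** P) ** (Q ** Y ** P) = Q ** (X ** Y) ** P" for X Y :: "complex^2^2"
  proof -
    have "(Q ** X ** P) ** (Q ** Y ** P) = Q ** X ** (P ** Q) ** Y ** P"
      by (simp only: matrix_mul_assoc)
    then show ?thesis by (simp add: PQ matrix_mul_assoc)
  qed
  show ?thesis
    unfolding matrix_inv_conj(1) [OF assms(1) PQ] matrix_inv_conj(1) [OF assms(2) PQ] m
      trace_conj [OF PQ(1)] by (simp only: matrix_mul_assoc)
qed

lemma trace_commutator_diag:
  assumes "a * d - b * c = 1" "l \<noteq> 0"
  shows "trace (mk2 l 0 0 (1 / l) ** mk2 a b c d ** matrix_inv (mk2 l 0 0 (1 / l)) **
    matrix_inv (mk2 a b c d)) - 2 = - ((l\<^sup>2 + 1 / l\<^sup>2 - 2) * (b * c))"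
proof -
  define k where "k = 1 / l"
  have lk: "l * k = 1" using assms(2) by (simp add: k_def)
  have sq: "1 / l\<^sup>2 = k\<^sup>2" by (simp add: k_def power_divide)
  have inv: "matrix_inv (mk2 l 0 0 k) = mk2 k 0 0 l" "matrix_inv (mk2 a b c d) = mk2 d (- b) (- c) a"
    using lk assms(1) by (simp_all add: matrix_inv_mk2)
  have "trace (mk2 l 0 0 k ** mk2 a b c d ** mk2 k 0 0 l ** mk2 d (- b) (- c) a) =
      l * a * k * d - l * b * l * c + (k * d * l * a - k * c * k * b)"
    by (simp add: algebra_simps)
  also have "\<dots> - 2 = - ((l\<^sup>2 + k\<^sup>2 - 2) * (b * c))"
    using lk assms(1) by algebra
  finally show ?thesis unfolding sq unfolding k_def [symmetric] inv .
qed

theorem kleinian_lower_bound: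
  assumes f: "f \<in> carrier PSL2C" and g: "g \<in> carrier PSL2C"
    and K: "kleinian (generate PSL2C {f, g})" and bg: "beta g = - 4"
  shows "cmod (gamma f g) + cmod (beta f + 2) \<ge> (sqrt 5 - 1) / 2"
proof (rule ccontr)
  let ?G = "generate PSL2C {f, g}"
  assume "\<not> ?thesis"
  then have small: "cmod (gamma f g) + cmod (beta f + 2) < (sqrt 5 - 1) / 2" by simp
  obtain A where A: "det A = 1" "f = {A, - A}" using f carrier_PSL2C [of f] by auto
  obtain B where B: "det B = 1" "g = {B, - B}" using g carrier_PSL2C [of g] by auto
  have Af: "A \<in> f" and Bg: "B \<in> g" using A B by auto
  have tB: "trace B = 0" using bg beta_eq [OF g Bg] by simp
  obtain l where l: "l \<noteq> 0" "trace A = l + 1 / l" using ex_eigenvalue by blast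
  define \<delta> where "\<delta> = l\<^sup>2 + 1 / l\<^sup>2"
  have \<delta>: "beta f + 2 = \<delta>"
    unfolding beta_eq [OF f Af] l(2) \<delta>_def using l(1) by (simp add: power2_eq_square field_simps)
  have "sqrt 5 < 3" by (rule real_less_lsqrt) auto
  then have "(sqrt 5 - 1) / 2 < 1" by simp
  then have d1: "cmod \<delta> < 1"
    using small norm_ge_zero [of "gamma f g"] unfolding \<delta> by linarith
  have l2: "l\<^sup>2 \<noteq> 1"
  proof
    assume "l\<^sup>2 = 1"
    then have "\<delta> = 2" by (simp add: \<delta>_def)
    with d1 show False by simp
  qed
  then have "l \<noteq> 1 / l" using l(1) by (simp add: eq_divide_eq power2_eq_square)
  from diagonalize [OF A(1) l(2,1) this] obtain P Q
    where PQ: "P ** Q = mat 1" "Q ** P = mat 1" and FA: "Q ** A ** P = mk2 l 0 0 (1 / l)"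
    by blast
  have sub: "subgroup ?G PSL2C" and dt: "subtopology PSL2C_topology ?G = discrete_topology ?G"
    and ne: "\<not> elementary ?G" using K unfolding kleinian_def by auto
  have disc: "discrete_sl2_group (\<Union>?G)" by (rule discrete_sl2_group_Union [OF sub dt])
  interpret D: discrete_sl2_group "(\<lambda>A. Q ** A ** P) ` \<Union>?G" by (rule discrete_conj [OF disc PQ])
  have AG: "A \<in> \<Union>?G"
    by (rule UnionI [OF generate.incl Af]) simp
  have BG: "B \<in> \<Union>?G"
    by (rule UnionI [OF generate.incl Bg]) simp
  obtain a b c d where FB: "Q ** B ** P = mk2 a b c d" by (rule mk2_cases)
  have FS: "mk2 l 0 0 (1 / l) \<in> (\<lambda>A. Q ** A ** P) ` \<Union>?G" using AG FA by (metis imageI)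
  have HS: "mk2 a b c d \<in> (\<lambda>A. Q ** A ** P) ` \<Union>?G" using BG FB by (metis imageI)
  have det: "a * d - b * c = 1" using HS by (rule D.mk2_det_1)
  have tr: "d = - a"
    using trace_conj [OF PQ(1), of B] unfolding tB FB by (simp add: eq_neg_iff_add_eq_0 add.commute)
  have \<gamma>: "gamma f g = - ((\<delta> - 2) * (b * c))"
    unfolding gamma_eq [OF f Af g Bg] commutator_conj [OF A(1) B(1) PQ] FA FB
      trace_commutator_diag [OF det l(1)] \<delta>_def ..
  have G: "?G = generate PSL2C {{A, - A}, {B, - B}}" unfolding A(2) B(2) ..
  show False
  proof (cases "b * c = 0")
    case False
    have "cmod ((\<delta> - 2) * (b * c)) + cmod \<delta> < (sqrt 5 - 1) / 2"
      using small unfolding \<delta> \<gamma> norm_minus_cancel .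
    then show False by (rule D.order4_diag [OF FS l(1) HS \<delta>_def False])
  next
    case True
    then consider "c = 0" | "b = 0" by auto
    then have "elementary ?G"
    proof cases
      case 1
      show ?thesis
        by (rule elementary_triangular [OF disc G AG BG PQ FA l(1) l2, of a b])
          (simp add: FB 1 tr)
    next
      case 2
      \<comment> \<open>Exchanging the basis vectors makes lower triangular matrices upper
        triangular and replaces \<open>l\<close> by \<open>1 / l\<close>.\<close>
      let ?J = "mk2 0 1 1 0"
      have J: "?J ** ?J = mat 1" by (simp add: mat_1_mk2)
      have c: "(?J ** Q) ** X ** (P ** ?J) = ?J ** (Q ** X ** P) ** ?J" for X
        by (simp only: matrix_mul_assoc)
      have PQ': "(P ** ?J) ** (?J ** Q) = mat 1" "(?J ** Q) ** (P ** ?J) = mat 1"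
      proof -
        have "(P ** ?J) ** (?J ** Q) = P ** (?J ** ?J) ** Q" by (simp only: matrix_mul_assoc)
        then show "(P ** ?J) ** (?J ** Q) = mat 1" unfolding J by (simp add: PQ)
        have "(?J ** Q) ** (P ** ?J) = ?J ** (Q ** P) ** ?J" by (simp only: matrix_mul_assoc)
        then show "(?J ** Q) ** (P ** ?J) = mat 1" unfolding PQ by (simp only: matrix_mul_rid J)
      qed
      show ?thesis
      proof (rule elementary_triangular [OF disc G AG BG PQ', of "1 / l" "d" "c"])
        show "?J ** Q ** A ** (P ** ?J) = mk2 (1 / l) 0 0 (1 / (1 / l))"
          unfolding c FA by simp
        show "?J ** Q ** B ** (P ** ?J) = mk2 d c 0 (- d)"
          unfolding c FB by (simp add: 2 tr)
        show "1 / l \<noteq> 0" using l(1) by simp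
        show "(1 / l)\<^sup>2 \<noteq> 1" using l2 by (simp add: power_divide)
      qed
    qed
    with ne show False ..
  qed
qed

section \<open>Discreteness of the (2,4,5) triangle group\<close>

definition golden :: real where "golden = (1 + sqrt 5) / 2"

definition golden_conj :: real where "golden_conj = (1 - sqrt 5) / 2"

lemma golden_sq: "golden * golden = golden + 1" "golden_conj * golden_conj = golden_conj + 1"
  by (simp_all add: golden_def golden_conj_def field_simps)

lemma sqrt5_bounds: "2.236 < sqrt 5" "sqrt 5 < 2.237"
  by (rule real_less_rsqrt real_less_lsqrt; simp add: power2_eq_square)+

text \<open>Descent: an odd \<open>p\<close> or \<open>q\<close> makes the form odd, so a solution
  could be halved forever.\<close>

lemma golden_int_norm_zero:
  fixes p q :: int
  assumes "p * p + p * q - q * q = 0"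
  shows "q = 0"
  using assms
proof (induction "nat \<bar>q\<bar>" arbitrary: p q rule: less_induct)
  case less
  show ?case
  proof (rule ccontr)
    assume q: "q \<noteq> 0"
    have "even (p * p + p * q - q * q)" using less.prems by simp
    then have "even p" "even q" by auto
    then obtain p' q' where pq: "p = 2 * p'" "q = 2 * q'" by (elim evenE)
    have "nat \<bar>q'\<bar> < nat \<bar>q\<bar>" using q pq by simp
    moreover have "p' * p' + p' * q' - q' * q' = 0" using less.prems unfolding pq by simp
    ultimately have "q' = 0" by (rule less.hyps)
    with q pq show False by simp
  qed
qed

text \<open>\<open>conj_pair x x'\<close> says that \<open>x\<close> lies in \<open>Z[golden]\<close> and that \<open>x'\<close> is its Galois conjugate.\<close>

definition conj_pair :: "complex \<Rightarrow> real \<Rightarrow> bool" where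
  "conj_pair x x' \<longleftrightarrow> (\<exists>p q :: int. x = of_int p + of_int q * of_real golden \<and>
     x' = of_int p + of_int q * golden_conj)"

lemma conj_pair_int: "conj_pair (of_int n) (of_int n)"
  unfolding conj_pair_def by (intro exI [of _ n] exI [of _ 0]) simp

lemma conj_pair_golden: "conj_pair (of_real golden) golden_conj"
  unfolding conj_pair_def by (intro exI [of _ 0] exI [of _ 1]) simp

lemma conj_pair_add: "conj_pair x x' \<Longrightarrow> conj_pair y y' \<Longrightarrow> conj_pair (x + y) (x' + y')"
proof -
  assume "conj_pair x x'" "conj_pair y y'"
  then obtain p q u v :: int where
    "x = of_int p + of_int q * of_real golden" "x' = of_int p + of_int q * golden_conj"
    "y = of_int u + of_int v * of_real golden" "y' = of_int u + of_int v * golden_conj"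
    unfolding conj_pair_def by blast
  then show ?thesis
    unfolding conj_pair_def by (intro exI [of _ "p + u"] exI [of _ "q + v"]) (simp add: algebra_simps)
qed

lemma conj_pair_minus: "conj_pair x x' \<Longrightarrow> conj_pair (- x) (- x')"
proof -
  assume "conj_pair x x'"
  then obtain p q :: int where
    "x = of_int p + of_int q * of_real golden" "x' = of_int p + of_int q * golden_conj"
    unfolding conj_pair_def by blast
  then show ?thesis
    unfolding conj_pair_def by (intro exI [of _ "- p"] exI [of _ "- q"]) (simp add: algebra_simps)
qed

lemma conj_pair_diff: "conj_pair x x' \<Longrightarrow> conj_pair y y' \<Longrightarrow> conj_pair (x - y) (x' - y')"
  using conj_pair_add [OF _ conj_pair_minus] by simp

lemma conj_pair_mult: "conj_pair x x' \<Longrightarrow> conj_pair y y' \<Longrightarrow> conj_pair (x * y) (x' * y')"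
proof -
  assume "conj_pair x x'" "conj_pair y y'"
  then obtain p q u v :: int where
    *: "x = of_int p + of_int q * of_real golden" "x' = of_int p + of_int q * golden_conj"
    "y = of_int u + of_int v * of_real golden" "y' = of_int u + of_int v * golden_conj"
    unfolding conj_pair_def by blast
  have c: "complex_of_real golden * complex_of_real golden = complex_of_real golden + 1"
    using golden_sq(1) by (metis of_real_1 of_real_add of_real_mult)
  have "x * y = of_int (p * u) + of_int (p * v + q * u) * of_real golden +
      of_int (q * v) * (complex_of_real golden * complex_of_real golden)"
    unfolding * by (simp add: algebra_simps)
  moreover have "x' * y' = of_int (p * u) + of_int (p * v + q * u) * golden_conj +
      of_int (q * v) * (golden_conj * golden_conj)"
    unfolding * by (simp add: algebra_simps)
  ultimately show ?thesis
    unfolding conj_pair_def c golden_sq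
    by (intro exI [of _ "p * u + q * v"] exI [of _ "p * v + q * u + q * v"]) (simp add: algebra_simps)
qed

lemmas conj_pair_intros = conj_pair_add conj_pair_minus conj_pair_diff conj_pair_mult
  conj_pair_golden conj_pair_int [of 0, simplified] conj_pair_int [of 1, simplified]
  conj_pair_int [of 2, simplified]

text \<open>Amounts to the irrationality of \<open>golden\<close>. It is applied to determinants:
  being integers, they keep their value at the conjugate place.\<close>

lemma conj_pair_int_unique:
  assumes "conj_pair (of_int n) x'"
  shows "x' = of_int n"
proof -
  from assms obtain p q :: int where
    *: "of_int n = complex_of_int p + of_int q * of_real golden" "x' = of_int p + of_int q * golden_conj"
    unfolding conj_pair_def by blast
  have "complex_of_real (of_int n) = complex_of_real (of_int p + of_int q * golden)"
    using *(1) by simp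
  then have "real_of_int n = of_int p + of_int q * golden" by (simp only: of_real_eq_iff)
  then have r: "real_of_int (p - n) = - (of_int q * golden)" by simp
  define u where "u = p - n"
  have "real_of_int (u * u + u * q - q * q) = real_of_int u * real_of_int u + real_of_int u * of_int q - of_int q * of_int q"
    by simp
  also have "\<dots> = of_int q * of_int q * (golden * golden - golden - 1)"
    unfolding u_def r by (simp add: algebra_simps)
  finally have "real_of_int (u * u + u * q - q * q) = 0" using golden_sq by simp
  then have "u * u + u * q - q * q = 0" by (simp only: of_int_eq_0_iff)
  then have "q = 0" by (rule golden_int_norm_zero)
  then show ?thesis using r *(2) by simp
qed

text \<open>The two embeddings make \<open>Z[golden]\<close> a lattice in the plane:
  \<open>x - x' = q sqrt 5\<close> bounds \<open>q\<close>, and then \<open>x'\<close> bounds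
  \<open>p\<close>.\<close>

lemma finite_conj_pair: "finite {x. \<exists>x'. conj_pair x x' \<and> cmod x \<le> K \<and> \<bar>x'\<bar> \<le> K}"
proof -
  let ?f = "\<lambda>(p::int, q::int). complex_of_int p + of_int q * of_real golden"
  define L where "L = \<lceil>3 * K\<rceil>"
  have "x \<in> ?f ` ({- L..L} \<times> {- L..L})" if x: "conj_pair x x'" "cmod x \<le> K" "\<bar>x'\<bar> \<le> K" for x x'
  proof -
    obtain p q :: int where
      *: "x = complex_of_int p + of_int q * of_real golden" "x' = of_int p + of_int q * golden_conj"
      using x(1) unfolding conj_pair_def by blast
    have "x = complex_of_real (of_int p + of_int q * golden)" unfolding * by simp
    then have "\<bar>of_int p + of_int q * golden\<bar> \<le> K" using x(2) by (simp only: norm_of_real)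
    moreover have "of_int q * sqrt 5 = (of_int p + of_int q * golden) - x'"
      unfolding * golden_def golden_conj_def by (simp add: field_simps)
    ultimately have "\<bar>of_int q * sqrt 5\<bar> \<le> 2 * K" using x(3) by linarith
    then have "\<bar>real_of_int q\<bar> * sqrt 5 \<le> 2 * K" by (simp add: abs_mult)
    moreover have "\<bar>real_of_int q\<bar> * 2 \<le> \<bar>real_of_int q\<bar> * sqrt 5"
      using sqrt5_bounds by (intro mult_left_mono) auto
    ultimately have q: "\<bar>real_of_int q\<bar> \<le> K" by linarith
    have "\<bar>of_int q * golden_conj\<bar> \<le> \<bar>real_of_int q\<bar> * 1"
      unfolding abs_mult using sqrt5_bounds by (intro mult_left_mono) (auto simp: golden_conj_def)
    then have p: "\<bar>real_of_int p\<bar> \<le> 3 * K" using x(3) q unfolding * by linarith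
    have "K \<ge> 0" using q by linarith
    then have "\<bar>real_of_int q\<bar> \<le> 3 * K" using q by linarith
    then have "\<bar>p\<bar> \<le> L" "\<bar>q\<bar> \<le> L" unfolding L_def using p by linarith+
    then have "(p, q) \<in> {- L..L} \<times> {- L..L}" by (simp add: abs_le_iff)
    then show ?thesis unfolding * by force
  qed
  then have "{x. \<exists>x'. conj_pair x x' \<and> cmod x \<le> K \<and> \<bar>x'\<bar> \<le> K} \<subseteq> ?f ` ({- L..L} \<times> {- L..L})"
    by (auto simp del: image_iff)
  then show ?thesis by (rule finite_subset) simp
qed

section \<open>The quaternion order and its norm form\<close>

text \<open>The determinant of \<open>x0 + x1 s A + x2 s B + x3 A B\<close> for
  \<open>s^2 = 2\<close> and \<open>tr (A B) = \<phi>\<close>. The factors \<open>s\<close> in the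
  basis make its coefficients polynomials in \<open>\<phi>\<close>; the type is generic because it
  is evaluated at \<open>golden\<close> in the complex numbers and at \<open>golden_conj\<close> in
  the reals.\<close>

definition norm_form :: "'a::field \<Rightarrow> 'a \<Rightarrow> 'a \<Rightarrow> 'a \<Rightarrow> 'a \<Rightarrow> 'a" where
  "norm_form \<phi> x0 x1 x2 x3 = x0 * x0 + 2 * (x1 * x1) + 2 * (x2 * x2) + x3 * x3 + 2 * (x0 * x1) +
     \<phi> * (x0 * x3) - 2 * \<phi> * (x1 * x2) + 2 * (x2 * x3)"

text \<open>At the conjugate place the reduced norm is positive definite.\<close>

lemma norm_form_conj_bound:
  assumes "norm_form golden_conj x0 x1 x2 x3 \<le> 2"
  shows "\<bar>x0\<bar> \<le> 10 \<and> \<bar>x1\<bar> \<le> 10 \<and> \<bar>x2\<bar> \<le> 10 \<and> \<bar>x3\<bar> \<le> 10"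
proof -
  let ?p = golden_conj
  \<comment> \<open>By completing squares, \<open>\<kappa> = 1 - golden_conj\<close> carries the
    signature. It exceeds 1 because \<open>golden_conj\<close> is negative; with
    \<open>golden\<close> instead it would be negative and the form indefinite.\<close>
  define \<kappa> where "\<kappa> = 2 - ?p * ?p"
  have \<kappa>: "\<kappa> > 1" unfolding \<kappa>_def golden_sq using sqrt5_bounds by (simp add: golden_conj_def)
  have p: "- 1 < ?p" "?p < 0" using sqrt5_bounds by (simp_all add: golden_conj_def)
  define s1 s2 s3 s4 where "s1 = x0 + x1 + ?p * x3 / 2" and "s2 = x1 - ?p * x3 / 2 - ?p * x2"
    and "s3 = x2 + x3 / 2" and "s4 = x3 / 2"
  have "norm_form ?p x0 x1 x2 x3 = s1 * s1 + s2 * s2 + \<kappa> * (s3 * s3 + s4 * s4)"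
    unfolding norm_form_def s1_def s2_def s3_def s4_def \<kappa>_def by (simp add: field_simps)
  moreover have "s3 * s3 + s4 * s4 \<le> \<kappa> * (s3 * s3 + s4 * s4)"
    using \<kappa> mult_right_mono [of 1 \<kappa> "s3 * s3 + s4 * s4"] by simp
  ultimately have sum: "s1 * s1 + s2 * s2 + (s3 * s3 + s4 * s4) \<le> 2" using assms by linarith
  have *: "\<bar>s\<bar> \<le> 2" if "s * s \<le> 2" for s :: real
  proof (rule ccontr)
    assume "\<not> \<bar>s\<bar> \<le> 2"
    then have "2 * 2 < \<bar>s\<bar> * \<bar>s\<bar>" by (intro mult_strict_mono) auto
    then show False using that by simp
  qed
  have "s1 * s1 \<le> 2" "s2 * s2 \<le> 2" "s3 * s3 \<le> 2" "s4 * s4 \<le> 2"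
    using sum zero_le_square [of s1] zero_le_square [of s2] zero_le_square [of s3] zero_le_square [of s4]
    by linarith+
  note b = this [THEN *]
  have x3: "\<bar>x3\<bar> \<le> 4" using b(4) unfolding s4_def by linarith
  have x2: "\<bar>x2\<bar> \<le> 4" using b(3) b(4) unfolding s3_def s4_def by linarith
  have px: "\<bar>?p * x\<bar> \<le> \<bar>x\<bar>" for x
  proof -
    have "\<bar>?p\<bar> * \<bar>x\<bar> \<le> 1 * \<bar>x\<bar>" using p by (intro mult_right_mono) auto
    then show ?thesis by (simp add: abs_mult)
  qed
  have x1: "\<bar>x1\<bar> \<le> 8" using b(2) x2 x3 px [of x2] px [of x3] unfolding s2_def by linarith
  have "s1 - s2 = x0 + ?p * x3 + ?p * x2" unfolding s1_def s2_def by (simp add: field_simps)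
  then have "x0 = s1 - s2 - ?p * x3 - ?p * x2" by simp
  moreover have "?p * x3 + ?p * x2 = ?p * (2 * s3 - x2)" unfolding s3_def by (simp add: field_simps)
  moreover have "\<bar>?p * (2 * s3 - x2)\<bar> \<le> 6"
  proof -
    have "2 * s3 - x2 = s3 + s4" unfolding s3_def s4_def by simp
    then show ?thesis using px [of "2 * s3 - x2"] b by linarith
  qed
  ultimately have "\<bar>x0\<bar> \<le> 10" using b by linarith
  then show ?thesis using x1 x2 x3 by linarith
qed

text \<open>This is \<open>k0 + k1 A + k2 B + k3 A B\<close>; with the entries written out, its
  identities are polynomial identities in the entries of \<open>A\<close> and
  \<open>B\<close>.\<close>

definition lincomb :: "complex^2^2 \<Rightarrow> complex^2^2 \<Rightarrow> complex \<Rightarrow> complex \<Rightarrow> complex \<Rightarrow> complex \<Rightarrow> complex^2^2" where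
  "lincomb A B k0 k1 k2 k3 =
     mk2 (k0 + k1 * A$1$1 + k2 * B$1$1 + k3 * (A ** B)$1$1) (k1 * A$1$2 + k2 * B$1$2 + k3 * (A ** B)$1$2)
         (k1 * A$2$1 + k2 * B$2$1 + k3 * (A ** B)$2$1) (k0 + k1 * A$2$2 + k2 * B$2$2 + k3 * (A ** B)$2$2)"

text \<open>The coefficients of a matrix in terms of 1, A, B, A B are determined by its trace
  pairings with these four; this bounds the pairings.\<close>

lemma norm_trace_mult_le: "cmod (trace (w ** Z)) \<le> 4 * norm w * norm (Z :: complex^2^2)"
proof -
  have e: "cmod (X $ i $ j) \<le> norm X" for X :: "complex^2^2" and i j
    using Finite_Cartesian_Product.norm_nth_le [of "X $ i" j] Finite_Cartesian_Product.norm_nth_le [of X i] by linarith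
  have p: "cmod (w $ i $ j * Z $ j $ i) \<le> norm w * norm Z" for i j
    unfolding norm_mult by (intro mult_mono e) auto
  have "trace (w ** Z) = w$1$1 * Z$1$1 + w$1$2 * Z$2$1 + (w$2$1 * Z$1$2 + w$2$2 * Z$2$2)"
    by (simp add: trace_def matrix_matrix_mult_def sum_2)
  also have "cmod \<dots> \<le> cmod (w$1$1 * Z$1$1) + cmod (w$1$2 * Z$2$1) + (cmod (w$2$1 * Z$1$2) + cmod (w$2$2 * Z$2$2))"
    by (intro order_trans [OF norm_triangle_ineq] add_mono norm_triangle_ineq)
  also have "\<dots> \<le> 4 * (norm w * norm Z)"
    using p [of 1 1] p [of 1 2] p [of 2 1] p [of 2 2] by linarith
  finally show ?thesis by (simp add: mult.assoc)
qed

locale order4_order2 =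
  fixes A B :: "complex^2^2" and s \<phi> :: complex
  assumes det: "det A = 1" "det B = 1" and s2: "s * s = 2"
    and tr: "trace A = s" "trace B = 0" "trace (A ** B) = \<phi>"
begin

abbreviation "L \<equiv> lincomb A B"

lemma entries:
  obtains a b c e f g where "A = mk2 a b c (s - a)" "B = mk2 e f g (- e)"
    "a * (s - a) - b * c = 1" "e * e + f * g = - 1" "\<phi> = a * e + b * g + (c * f - (s - a) * e)"
proof -
  obtain a b c d where A: "A = mk2 a b c d" by (rule mk2_cases)
  obtain e f g h where B: "B = mk2 e f g h" by (rule mk2_cases)
  have d: "d = s - a" using tr(1) by (simp add: A algebra_simps)
  have h: "h = - e" using tr(2) by (simp add: B eq_neg_iff_add_eq_0 add.commute)
  have 1: "a * (s - a) - b * c = 1" using det(1) by (simp add: A d)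
  have "e * (- e) - f * g = 1" using det(2) by (simp add: B h)
  then have 2: "e * e + f * g = - 1" by algebra
  have 3: "\<phi> = a * e + b * g + (c * f - (s - a) * e)"
    unfolding tr(3) [symmetric] A B d h by (simp add: algebra_simps)
  show thesis by (rule that [OF A [unfolded d] B [unfolded h] 1 2 3])
qed

text \<open>Cayley-Hamilton, \<open>A^2 = s A - 1\<close>.\<close>

lemma A_lincomb: "A ** L k0 k1 k2 k3 = L (- k1) (k0 + s * k1) (- k3) (k2 + s * k3)"
proof -
  obtain a b c e f g where *: "A = mk2 a b c (s - a)" "B = mk2 e f g (- e)"
    "a * (s - a) - b * c = 1" "e * e + f * g = - 1" "\<phi> = a * e + b * g + (c * f - (s - a) * e)"
    by (rule entries)
  show ?thesis
    unfolding lincomb_def *(1,2) mk2_mult mk2_nth mk2_eq_iff using *(3)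
    by (intro conjI; algebra)
qed

text \<open>From \<open>B^2 = - 1\<close> and the polarized Cayley-Hamilton relation
  \<open>A B + B A = s B + \<phi>\<close>.\<close>

lemma B_lincomb: "B ** L k0 k1 k2 k3 = L (\<phi> * k1 - k2 - s * k3) k3 (k0 + s * k1 + \<phi> * k3) (- k1)"
proof -
  obtain a b c e f g where *: "A = mk2 a b c (s - a)" "B = mk2 e f g (- e)"
    "a * (s - a) - b * c = 1" "e * e + f * g = - 1" "\<phi> = a * e + b * g + (c * f - (s - a) * e)"
    by (rule entries)
  show ?thesis
    unfolding lincomb_def *(1,2) mk2_mult mk2_nth mk2_eq_iff *(5) using *(3,4)
    by (intro conjI; algebra)
qed

lemma inv_A_lincomb: "matrix_inv A ** L k0 k1 k2 k3 = L (s * k0 + k1) (- k0) (s * k2 + k3) (- k2)"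
proof -
  obtain a b c e f g where *: "A = mk2 a b c (s - a)" "B = mk2 e f g (- e)"
    "a * (s - a) - b * c = 1" "e * e + f * g = - 1" "\<phi> = a * e + b * g + (c * f - (s - a) * e)"
    by (rule entries)
  show ?thesis
    unfolding lincomb_def *(1,2) matrix_inv_mk2 [OF *(3)] mk2_mult mk2_nth mk2_eq_iff using *(3)
    by (intro conjI; algebra)
qed

lemma inv_B: "matrix_inv B = - B"
proof -
  obtain a b c e f g where *: "A = mk2 a b c (s - a)" "B = mk2 e f g (- e)"
    "a * (s - a) - b * c = 1" "e * e + f * g = - 1" "\<phi> = a * e + b * g + (c * f - (s - a) * e)"
    by (rule entries)
  have "e * (- e) - f * g = 1" using *(4) by algebra
  from matrix_inv_mk2 [OF this] show ?thesis unfolding *(2) by simp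
qed

lemma minus_lincomb: "- L k0 k1 k2 k3 = L (- k0) (- k1) (- k2) (- k3)"
  by (simp add: lincomb_def algebra_simps)

lemma det_lincomb:
  "det (L k0 k1 k2 k3) = k0 * k0 + k1 * k1 + k2 * k2 + k3 * k3 + s * (k0 * k1) + \<phi> * (k0 * k3) -
     \<phi> * (k1 * k2) + s * (k2 * k3)"
proof -
  obtain a b c e f g where *: "A = mk2 a b c (s - a)" "B = mk2 e f g (- e)"
    "a * (s - a) - b * c = 1" "e * e + f * g = - 1" "\<phi> = a * e + b * g + (c * f - (s - a) * e)"
    by (rule entries)
  show ?thesis
    unfolding lincomb_def *(1,2) mk2_mult mk2_nth mk2_det *(5) using *(3,4)
    by algebra
qed

lemma trace_lincomb:
  "trace (L k0 k1 k2 k3 ** mat 1) = 2 * k0 + s * k1 + \<phi> * k3"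
  "trace (L k0 k1 k2 k3 ** A) = s * k0 + \<phi> * k2 + s * \<phi> * k3"
  "trace (L k0 k1 k2 k3 ** B) = \<phi> * k1 - 2 * k2 - s * k3"
  "trace (L k0 k1 k2 k3 ** (A ** B)) = \<phi> * k0 + s * \<phi> * k1 - s * k2 + (\<phi> * \<phi> - 2) * k3"
proof -
  obtain a b c e f g where *: "A = mk2 a b c (s - a)" "B = mk2 e f g (- e)"
    "a * (s - a) - b * c = 1" "e * e + f * g = - 1" "\<phi> = a * e + b * g + (c * f - (s - a) * e)"
    by (rule entries)
  show "trace (L k0 k1 k2 k3 ** mat 1) = 2 * k0 + s * k1 + \<phi> * k3"
    unfolding lincomb_def *(1,2) mat_1_mk2 mk2_mult mk2_nth mk2_trace *(5) by algebra
  show "trace (L k0 k1 k2 k3 ** A) = s * k0 + \<phi> * k2 + s * \<phi> * k3"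
    unfolding lincomb_def *(1,2) mk2_mult mk2_nth mk2_trace *(5) using *(3) s2 by algebra
  show "trace (L k0 k1 k2 k3 ** B) = \<phi> * k1 - 2 * k2 - s * k3"
    unfolding lincomb_def *(1,2) mk2_mult mk2_nth mk2_trace *(5) using *(4) by algebra
  show "trace (L k0 k1 k2 k3 ** (A ** B)) = \<phi> * k0 + s * \<phi> * k1 - s * k2 + (\<phi> * \<phi> - 2) * k3"
    unfolding lincomb_def *(1,2) mk2_mult mk2_nth mk2_trace *(5) using *(3,4) by algebra
qed

end

lemma finite_sequence_limit:
  fixes X :: "nat \<Rightarrow> 'a::t1_space"
  assumes "finite F" "\<And>n. X n \<in> F" "X \<longlonglongrightarrow> l"
  shows "\<exists>n. X n = l"
proof (rule ccontr)
  assume "\<nexists>n. X n = l"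
  then have ne: "X n \<noteq> l" for n by auto
  have "open (- (F - {l}))" using assms(1) by (intro open_Compl finite_imp_closed) simp
  then have "\<forall>\<^sub>F n in sequentially. X n \<in> - (F - {l})"
    by (rule topological_tendstoD [OF assms(3)]) simp
  then obtain n where "X n \<in> - (F - {l})" using eventually_happens' [OF sequentially_bot] by blast
  with assms(2) [of n] ne [of n] show False by simp
qed

text \<open>The elements of the group lie in the order spanned by \<open>1\<close>, \<open>s A\<close>, \<open>s B\<close>, \<open>A B\<close> over
  \<open>Z[golden]\<close>, or in \<open>1/s\<close> times it, according to the parity of the word length.\<close>

locale group_245 = order4_order2 A B s "of_real golden" for A B s
begin

definition Z :: "complex set" where "Z = {x. \<exists>x'. conj_pair x x'}"

lemma Z_closed:
  "x \<in> Z \<Longrightarrow> y \<in> Z \<Longrightarrow> x + y \<in> Z" "x \<in> Z \<Longrightarrow> - x \<in> Z" "x \<in> Z \<Longrightarrow> y \<in> Z \<Longrightarrow> x - y \<in> Z"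
  "x \<in> Z \<Longrightarrow> y \<in> Z \<Longrightarrow> x * y \<in> Z" "of_real golden \<in> Z" "0 \<in> Z" "1 \<in> Z" "2 \<in> Z"
  unfolding Z_def mem_Collect_eq
  by (auto intro: conj_pair_add conj_pair_minus conj_pair_diff conj_pair_mult conj_pair_golden
      conj_pair_int [of 0, simplified] conj_pair_int [of 1, simplified] conj_pair_int [of 2, simplified]
      elim!: exE)

definition even_words :: "(complex^2^2) set" where
  "even_words = {L x0 (s * x1) (s * x2) x3 |x0 x1 x2 x3. x0 \<in> Z \<and> x1 \<in> Z \<and> x2 \<in> Z \<and> x3 \<in> Z}"

definition odd_words :: "(complex^2^2) set" where
  "odd_words = {L (s * x0) x1 x2 (s * x3) |x0 x1 x2 x3. x0 \<in> Z \<and> x1 \<in> Z \<and> x2 \<in> Z \<and> x3 \<in> Z}"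

lemma even_I:
  "w = L x0 (s * x1) (s * x2) x3 \<Longrightarrow> x0 \<in> Z \<Longrightarrow> x1 \<in> Z \<Longrightarrow> x2 \<in> Z \<Longrightarrow> x3 \<in> Z \<Longrightarrow> w \<in> even_words"
  unfolding even_words_def by (intro CollectI exI conjI)

lemma odd_I:
  "w = L (s * x0) x1 x2 (s * x3) \<Longrightarrow> x0 \<in> Z \<Longrightarrow> x1 \<in> Z \<Longrightarrow> x2 \<in> Z \<Longrightarrow> x3 \<in> Z \<Longrightarrow> w \<in> odd_words"
  unfolding odd_words_def by (intro CollectI exI conjI)

lemma ss: "s * (s * x) = 2 * x"
  using s2 by (simp add: mult.assoc [symmetric])

lemma words_step:
  assumes "w \<in> even_words"
  shows "A ** w \<in> odd_words" "B ** w \<in> odd_words" "matrix_inv A ** w \<in> odd_words" "- w \<in> even_words"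
proof -
  obtain x0 x1 x2 x3 where w: "w = L x0 (s * x1) (s * x2) x3"
    and Z: "x0 \<in> Z" "x1 \<in> Z" "x2 \<in> Z" "x3 \<in> Z"
    using assms unfolding even_words_def by blast
  let ?g = "complex_of_real golden"
  show "A ** w \<in> odd_words"
    by (rule odd_I [of _ "- x1" "x0 + 2 * x1" "- x3" "x2 + x3"])
      (simp_all add: w A_lincomb ss distrib_left Z Z_closed)
  show "B ** w \<in> odd_words"
    by (rule odd_I [of _ "?g * x1 - x2 - x3" x3 "x0 + 2 * x1 + ?g * x3" "- x1"])
      (simp_all add: w B_lincomb ss algebra_simps Z Z_closed)
  show "matrix_inv A ** w \<in> odd_words"
    by (rule odd_I [of _ "x0 + x1" "- x0" "2 * x2 + x3" "- x2"])
      (simp_all add: w inv_A_lincomb ss distrib_left Z Z_closed)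
  show "- w \<in> even_words"
    by (rule even_I [of _ "- x0" "- x1" "- x2" "- x3"])
      (simp_all add: w minus_lincomb Z Z_closed)
qed

lemma words_step':
  assumes "w \<in> odd_words"
  shows "A ** w \<in> even_words" "B ** w \<in> even_words" "matrix_inv A ** w \<in> even_words" "- w \<in> odd_words"
proof -
  obtain x0 x1 x2 x3 where w: "w = L (s * x0) x1 x2 (s * x3)"
    and Z: "x0 \<in> Z" "x1 \<in> Z" "x2 \<in> Z" "x3 \<in> Z"
    using assms unfolding odd_words_def by blast
  let ?g = "complex_of_real golden"
  show "A ** w \<in> even_words"
    by (rule even_I [of _ "- x1" "x0 + x1" "- x3" "x2 + 2 * x3"])
      (simp_all add: w A_lincomb ss distrib_left Z Z_closed)
  show "B ** w \<in> even_words"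
    by (rule even_I [of _ "?g * x1 - x2 - 2 * x3" x3 "x0 + x1 + ?g * x3" "- x1"])
      (simp_all add: w B_lincomb ss algebra_simps Z Z_closed)
  show "matrix_inv A ** w \<in> even_words"
    by (rule even_I [of _ "2 * x0 + x1" "- x0" "x2 + x3" "- x2"])
      (simp_all add: w inv_A_lincomb ss distrib_left Z Z_closed)
  show "- w \<in> odd_words"
    by (rule odd_I [of _ "- x0" "- x1" "- x2" "- x3"])
      (simp_all add: w minus_lincomb Z Z_closed)
qed

definition words :: "(complex^2^2) set" where "words = even_words \<union> odd_words"

text \<open>\<open>words\<close> itself is not shown to be a group. The matrices that, together with
  their inverses, preserve it under left multiplication do form one and include the generators;
  letting them act on \<open>mat 1\<close> gives the claim.\<close>

lemma generate_subset_words: "\<Union>(generate PSL2C {{A, - A}, {B, - B}}) \<subseteq> words"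
proof -
  have stepA: "A ** u \<in> words" and stepA': "matrix_inv A ** u \<in> words"
    and stepB: "B ** u \<in> words" and stepm: "- u \<in> words" if u: "u \<in> words" for u
    using u words_step [of u] words_step' [of u] unfolding words_def by auto
  let ?V = "{w. det w = 1 \<and> (\<forall>u\<in>words. w ** u \<in> words \<and> matrix_inv w ** u \<in> words)}"
  have m1: "matrix_inv (- mat 1 :: complex^2^2) = - mat 1"
    by (rule matrix_inv_unique) (simp_all add: det_minus_2 matrix_mult_minus_left)
  have m0: "matrix_inv (mat 1 :: complex^2^2) = mat 1"
    by (rule matrix_inv_unique) simp_all
  have "sl2_group ?V"
  proof
    show "mat 1 \<in> ?V" by (simp add: m0)
    fix w w' assume w: "w \<in> ?V" and w': "w' \<in> ?V"
    have d: "det w = 1" "det w' = 1" using w w' by auto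
    have i: "matrix_inv (w ** w') = matrix_inv w' ** matrix_inv w"
    proof (rule matrix_inv_unique)
      show "det (w ** w') = 1" by (simp add: det_mul d)
      have "(w ** w') ** (matrix_inv w' ** matrix_inv w) = w ** (w' ** matrix_inv w') ** matrix_inv w"
        by (simp only: matrix_mul_assoc)
      then show "(w ** w') ** (matrix_inv w' ** matrix_inv w) = mat 1"
        by (simp add: det_one_inverse d)
    qed
    have "(w ** w') ** u \<in> words" "matrix_inv (w ** w') ** u \<in> words" if u: "u \<in> words" for u
    proof -
      have "w ** (w' ** u) \<in> words" "matrix_inv w' ** (matrix_inv w ** u) \<in> words"
        using w w' u by simp_all
      then show "(w ** w') ** u \<in> words" "matrix_inv (w ** w') ** u \<in> words"
        unfolding i by (simp_all only: matrix_mul_assoc)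
    qed
    then show "w ** w' \<in> ?V" by (simp add: det_mul d)
  next
    fix w assume w: "w \<in> ?V"
    then have d: "det w = 1" by simp
    have "matrix_inv (matrix_inv w) = w"
      by (rule matrix_inv_unique) (simp_all add: det_one_inverse d)
    then show "matrix_inv w \<in> ?V" using w by (simp add: det_one_inverse)
  qed simp
  moreover have "- mat 1 \<in> ?V"
    by (simp add: m1 det_minus_2 matrix_mult_minus_left stepm)
  moreover have "A \<in> ?V" by (simp add: det stepA stepA')
  moreover have "B \<in> ?V"
    by (simp add: det inv_B stepB matrix_mult_minus_left stepm)
  ultimately have sub: "\<Union>(generate PSL2C {{A, - A}, {B, - B}}) \<subseteq> ?V" by (rule Union_generate_subset)
  have "mat 1 \<in> even_words"
    by (rule even_I [of _ 1 0 0 0]) (simp_all add: lincomb_def mat_1_mk2 Z_closed)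
  then have one: "mat 1 \<in> words" by (simp add: words_def)
  show ?thesis
  proof
    fix w assume "w \<in> \<Union>(generate PSL2C {{A, - A}, {B, - B}})"
    with sub have "w \<in> ?V" by (rule subsetD)
    then have "w ** mat 1 \<in> words" using one by blast
    then show "w \<in> words" by simp
  qed
qed

text \<open>The four trace equations are solved by elimination. The pivot is
  \<open>\<phi>^2 - 2 = golden - 1\<close>, which is at least 1/2; the numerical constants are
  merely generous.\<close>

lemma coefficient_bound:
  assumes w: "w = L x0 (s * x1) (s * x2) x3" and T: "0 \<le> T"
    and t: "cmod (trace (w ** mat 1)) \<le> T" "cmod (s * trace (w ** A)) \<le> T"
      "cmod (s * trace (w ** B)) \<le> T" "cmod (trace (w ** (A ** B))) \<le> T"
  shows "cmod x0 \<le> 100 * T \<and> cmod x1 \<le> 100 * T \<and> cmod x2 \<le> 100 * T \<and> cmod x3 \<le> 100 * T"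
proof -
  define \<phi> where "\<phi> = complex_of_real golden"
  define t0 t1 t2 t3 where "t0 = trace (w ** mat 1)" and "t1 = s * trace (w ** A)"
    and "t2 = s * trace (w ** B)" and "t3 = trace (w ** (A ** B))"
  have tt0: "t0 = 2 * x0 + 2 * x1 + \<phi> * x3"
    unfolding t0_def w trace_lincomb \<phi>_def [symmetric] ss ..
  have "t1 = (s * s) * (x0 + \<phi> * x2 + \<phi> * x3)"
    unfolding t1_def w trace_lincomb \<phi>_def [symmetric] by algebra
  then have tt1: "t1 = 2 * x0 + 2 * \<phi> * x2 + 2 * \<phi> * x3"
    unfolding s2 by algebra
  have "t2 = (s * s) * (\<phi> * x1 - 2 * x2 - x3)"
    unfolding t2_def w trace_lincomb \<phi>_def [symmetric] by algebra
  then have tt2: "t2 = 2 * \<phi> * x1 - 4 * x2 - 2 * x3"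
    unfolding s2 by algebra
  have "t3 = \<phi> * x0 + (s * s) * \<phi> * x1 - (s * s) * x2 + (\<phi> * \<phi> - 2) * x3"
    unfolding t3_def w trace_lincomb \<phi>_def [symmetric] by algebra
  then have tt3: "t3 = \<phi> * x0 + 2 * \<phi> * x1 - 2 * x2 + (\<phi> * \<phi> - 2) * x3"
    unfolding s2 .
  note tt = tt0 tt1 tt2 tt3
  have k: "(\<phi> * \<phi> - 2) * x3 = 2 * t3 - \<phi> * t0 - t2"
    "(\<phi> * \<phi> - 2) * (2 * x2) = 2 * t2 - 2 * t3 + \<phi> * t1"
    "2 * x1 = t0 - t1 + 2 * \<phi> * x2 + \<phi> * x3" "2 * x0 = t0 - 2 * x1 - \<phi> * x3"
    unfolding tt by (algebra, algebra, algebra, algebra)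
  have \<phi>b: "cmod (\<phi> * y) \<le> 2 * cmod y" for y
  proof -
    have "cmod \<phi> \<le> 2" unfolding \<phi>_def norm_of_real golden_def using sqrt5_bounds by simp
    then show ?thesis unfolding norm_mult by (intro mult_right_mono) auto
  qed
  have \<kappa>: "cmod y \<le> 2 * cmod ((\<phi> * \<phi> - 2) * y)" for y
  proof -
    have "\<phi> * \<phi> - 2 = complex_of_real (golden - 1)"
      unfolding \<phi>_def of_real_mult [symmetric] golden_sq by simp
    then have "cmod (\<phi> * \<phi> - 2) = \<bar>golden - 1\<bar>" by (simp only: norm_of_real)
    then have "1 / 2 \<le> cmod (\<phi> * \<phi> - 2)" unfolding golden_def using sqrt5_bounds by (simp add: field_simps)
    then have "1 / 2 * cmod y \<le> cmod (\<phi> * \<phi> - 2) * cmod y" by (rule mult_right_mono) simp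
    then show ?thesis unfolding norm_mult by simp
  qed
  have tb: "cmod t0 \<le> T" "cmod t1 \<le> T" "cmod t2 \<le> T" "cmod t3 \<le> T"
    using t unfolding t0_def t1_def t2_def t3_def by simp_all
  have two: "cmod (2 * y) = 2 * cmod y" for y by (simp add: norm_mult)
  have x3: "cmod x3 \<le> 10 * T"
    using \<kappa> [of x3] \<phi>b [of t0] norm_triangle_ineq4 [of "2 * t3 - \<phi> * t0" t2]
      norm_triangle_ineq4 [of "2 * t3" "\<phi> * t0"] tb two [of t3] unfolding k(1) by linarith
  have "cmod (2 * x2) \<le> 2 * cmod (2 * t2 - 2 * t3 + \<phi> * t1)"
    using \<kappa> [of "2 * x2"] unfolding k(2) .
  then have x2: "cmod x2 \<le> 6 * T"
    using \<phi>b [of t1] norm_triangle_ineq [of "2 * t2 - 2 * t3" "\<phi> * t1"]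
      norm_triangle_ineq4 [of "2 * t2" "2 * t3"] tb two [of t2] two [of t3] two [of x2] by linarith
  have p2: "cmod (2 * \<phi> * x2) \<le> 4 * cmod x2"
    using \<phi>b [of x2] two [of "\<phi> * x2"] by (simp add: mult.assoc)
  have x1: "cmod x1 \<le> 23 * T"
    using two [of x1] p2 \<phi>b [of x3] norm_triangle_ineq [of "t0 - t1 + 2 * \<phi> * x2" "\<phi> * x3"]
      norm_triangle_ineq [of "t0 - t1" "2 * \<phi> * x2"] norm_triangle_ineq4 [of t0 t1] tb x2 x3
    unfolding k(3) by linarith
  have "cmod x0 \<le> 100 * T"
    using two [of x0] \<phi>b [of x3] norm_triangle_ineq4 [of "t0 - 2 * x1" "\<phi> * x3"]
      norm_triangle_ineq4 [of t0 "2 * x1"] two [of x1] tb x1 x3 T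
    unfolding k(4) by linarith
  then show ?thesis using x1 x2 x3 T by linarith
qed

text \<open>An element is given by four numbers of \<open>Z[golden]\<close>, up to halves, which the
  traces bound at the given place and the definite norm form bounds at the conjugate place.\<close>

lemma finite_words_bounded: "finite {w \<in> words. det w = 1 \<and> norm w \<le> R}"
proof (cases "R \<ge> 0")
  case False
  have "\<not> norm w \<le> R" for w :: "complex^2^2"
    using False norm_ge_zero [of w] by linarith
  then show ?thesis by simp
next
  case R: True
  define M where "M = norm (mat 1 :: complex^2^2) + norm A + norm B + norm (A ** B)"
  have M: "norm (mat 1 :: complex^2^2) \<le> M" "norm A \<le> M" "norm B \<le> M" "norm (A ** B) \<le> M"
    unfolding M_def by (simp_all add: add_nonneg_nonneg)
  have M0: "M \<ge> 0" using M(2) norm_ge_zero [of A] by linarith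
  \<comment> \<open>\<open>4 * R * M\<close> bounds the traces of \<open>w\<close>. One factor 2
    pays for scaling odd words by \<open>s\<close>, the other for the \<open>s\<close> in the
    pairings with \<open>A\<close> and \<open>B\<close>.\<close>
  define T where "T = 2 * (2 * (4 * R * M))"
  have T: "0 \<le> T" unfolding T_def using R M0 by simp
  define K where "K = 100 * T + 10"
  define F where "F = {x. \<exists>x'. conj_pair x x' \<and> cmod x \<le> K \<and> \<bar>x'\<bar> \<le> K}"
  have F: "finite F" unfolding F_def by (rule finite_conj_pair)
  have sn: "cmod s \<le> 2"
  proof -
    have "cmod s * cmod s = 2" unfolding norm_mult [symmetric] s2 by simp
    show ?thesis
    proof (rule ccontr)
      assume "\<not> cmod s \<le> 2"
      then have "2 * 2 < cmod s * cmod s" by (intro mult_strict_mono) auto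
      with \<open>cmod s * cmod s = 2\<close> show False by simp
    qed
  qed
  have bound: "x0 \<in> F \<and> x1 \<in> F \<and> x2 \<in> F \<and> x3 \<in> F"
    if Z: "x0 \<in> Z" "x1 \<in> Z" "x2 \<in> Z" "x3 \<in> Z"
      and d: "det (L x0 (s * x1) (s * x2) x3) = of_int n" "n \<le> 2"
      and t: "\<And>Y. norm Y \<le> M \<Longrightarrow> cmod (trace (L x0 (s * x1) (s * x2) x3 ** Y)) \<le> 2 * (4 * R * M)"
    for x0 x1 x2 x3 n
  proof -
    obtain x0' x1' x2' x3' where c: "conj_pair x0 x0'" "conj_pair x1 x1'" "conj_pair x2 x2'" "conj_pair x3 x3'"
      using Z unfolding Z_def by blast
    have "conj_pair (norm_form (of_real golden) x0 x1 x2 x3) (norm_form golden_conj x0' x1' x2' x3')"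
      unfolding norm_form_def by (intro conj_pair_intros c)
    moreover have "norm_form (of_real golden) x0 x1 x2 x3 = of_int n"
    proof -
      have "det (L x0 (s * x1) (s * x2) x3) = x0 * x0 + (s * s) * (x1 * x1) + (s * s) * (x2 * x2) + x3 * x3 +
          (s * s) * (x0 * x1) + of_real golden * (x0 * x3) - (s * s) * of_real golden * (x1 * x2) + (s * s) * (x2 * x3)"
        unfolding det_lincomb by algebra
      then show ?thesis unfolding d(1) s2 norm_form_def by simp
    qed
    ultimately have "norm_form golden_conj x0' x1' x2' x3' = of_int n"
      using conj_pair_int_unique by (simp only:)
    then have "norm_form golden_conj x0' x1' x2' x3' \<le> 2" using d(2) by simp
    then have b': "\<bar>x0'\<bar> \<le> 10 \<and> \<bar>x1'\<bar> \<le> 10 \<and> \<bar>x2'\<bar> \<le> 10 \<and> \<bar>x3'\<bar> \<le> 10"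
      by (rule norm_form_conj_bound)
    have st: "cmod (s * y) \<le> T" if y: "cmod y \<le> 2 * (4 * R * M)" for y
      unfolding norm_mult T_def using sn y by (intro mult_mono) auto
    have "2 * (4 * R * M) \<le> T" unfolding T_def using R M0 by simp
    then have "cmod x0 \<le> 100 * T \<and> cmod x1 \<le> 100 * T \<and> cmod x2 \<le> 100 * T \<and> cmod x3 \<le> 100 * T"
      using coefficient_bound [OF refl T order_trans [OF t [OF M(1)]] st [OF t [OF M(2)]]
          st [OF t [OF M(3)]] order_trans [OF t [OF M(4)]]] by blast
    with b' T have "cmod x0 \<le> K \<and> cmod x1 \<le> K \<and> cmod x2 \<le> K \<and> cmod x3 \<le> K"
      "\<bar>x0'\<bar> \<le> K \<and> \<bar>x1'\<bar> \<le> K \<and> \<bar>x2'\<bar> \<le> K \<and> \<bar>x3'\<bar> \<le> K"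
      unfolding K_def by linarith+
    then show ?thesis unfolding F_def using c by blast
  qed
  have tr: "cmod (trace (w ** Y)) \<le> 4 * R * M" if w: "norm w \<le> R" and Y: "norm Y \<le> M" for w Y :: "complex^2^2"
  proof -
    have "4 * norm w * norm Y \<le> 4 * R * M" using w Y R by (intro mult_mono) auto
    then show ?thesis using norm_trace_mult_le [of w Y] by linarith
  qed
  let ?E = "(\<lambda>(x0, x1, x2, x3). L x0 (s * x1) (s * x2) x3) ` (F \<times> F \<times> F \<times> F)"
  let ?F2 = "(\<lambda>x. x / 2) ` F"
  let ?O = "(\<lambda>(x0, x1, x2, x3). L (s * x0) x1 x2 (s * x3)) ` (?F2 \<times> F \<times> F \<times> ?F2)"
  have "w \<in> ?E \<union> ?O" if w: "w \<in> words" "det w = 1" "norm w \<le> R" for w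
  proof (cases "w \<in> even_words")
    case True
    then obtain x0 x1 x2 x3 where x: "w = L x0 (s * x1) (s * x2) x3"
      and Z: "x0 \<in> Z" "x1 \<in> Z" "x2 \<in> Z" "x3 \<in> Z"
      unfolding even_words_def by blast
    have "cmod (trace (w ** Y)) \<le> 2 * (4 * R * M)" if "norm Y \<le> M" for Y
    proof -
      have "0 \<le> 4 * R * M" using R M0 by simp
      then show ?thesis using tr [OF w(3) that] by linarith
    qed
    then have "x0 \<in> F \<and> x1 \<in> F \<and> x2 \<in> F \<and> x3 \<in> F"
      using w(2) unfolding x by (intro bound [OF Z, of 1]) simp_all
    then have "(x0, x1, x2, x3) \<in> F \<times> F \<times> F \<times> F" by simp
    then have "w \<in> ?E" unfolding x by (rule rev_image_eqI) simp
    then show ?thesis by (rule UnI1)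
  next
    case False
    then have "w \<in> odd_words" using w(1) by (simp add: words_def)
    then obtain x0 x1 x2 x3 where x: "w = L (s * x0) x1 x2 (s * x3)"
      and Z: "x0 \<in> Z" "x1 \<in> Z" "x2 \<in> Z" "x3 \<in> Z"
      unfolding odd_words_def by blast
    \<comment> \<open>Scaling by \<open>s\<close> brings an odd word into the even shape at the
      price of determinant 2; this is why \<open>bound\<close> and
      \<open>norm_form_conj_bound\<close> admit values up to 2.\<close>
    have E: "L (2 * x0) (s * x1) (s * x2) (2 * x3) = mk2 s 0 0 s ** w"

    proof -
      have "mk2 s 0 0 s ** w = L ((s * s) * x0) (s * x1) (s * x2) ((s * s) * x3)"
        unfolding x lincomb_def mk2_mult mk2_eq_iff by (intro conjI; algebra)
      then show ?thesis unfolding s2 ..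
    qed
    have dE: "det (L (2 * x0) (s * x1) (s * x2) (2 * x3)) = of_int 2"
      unfolding E det_mul w(2) using s2 by simp
    have trE: "trace (L (2 * x0) (s * x1) (s * x2) (2 * x3) ** Y) = s * trace (w ** Y)" for Y
    proof -
      have "trace (mk2 s 0 0 s ** X) = s * trace X" for X
        by (cases X rule: mk2_cases) (simp add: distrib_left)
      then show ?thesis unfolding E matrix_mul_assoc [symmetric] .
    qed
    have "cmod (trace (L (2 * x0) (s * x1) (s * x2) (2 * x3) ** Y)) \<le> 2 * (4 * R * M)" if "norm Y \<le> M" for Y
      unfolding trE norm_mult using sn tr [OF w(3) that] by (intro mult_mono) auto
    then have xF: "2 * x0 \<in> F \<and> x1 \<in> F \<and> x2 \<in> F \<and> 2 * x3 \<in> F"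
      by (intro bound [OF _ _ _ _ dE]) (simp_all add: Z Z_closed)
    have "x0 \<in> ?F2" "x3 \<in> ?F2"
      using xF by (auto intro: rev_image_eqI)
    with xF have "(x0, x1, x2, x3) \<in> ?F2 \<times> F \<times> F \<times> ?F2" by (simp only: mem_Sigma_iff simp_thms)
    then have "w \<in> ?O" unfolding x by (rule rev_image_eqI) simp
    then show ?thesis by (rule UnI2)
  qed
  then have "{w \<in> words. det w = 1 \<and> norm w \<le> R} \<subseteq> ?E \<union> ?O" by blast
  moreover have "finite (?E \<union> ?O)" by (intro finite_UnI finite_imageI finite_cartesian_product F)
  ultimately show ?thesis by (rule finite_subset)
qed

lemma discrete: "discrete_sl2_group (\<Union>(generate PSL2C {{A, - A}, {B, - B}}))"
proof -
  interpret P: group PSL2C by (rule group_PSL2C)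
  have "subgroup (generate PSL2C {{A, - A}, {B, - B}}) PSL2C"
    using carrier_PSL2C_I det by (intro P.generate_is_subgroup) auto
  then interpret G: sl2_group "\<Union>(generate PSL2C {{A, - A}, {B, - B}})" by (rule sl2_group_Union)
  show ?thesis
  proof
    fix X :: "nat \<Rightarrow> complex^2^2"
    assume X: "\<And>n. X n \<in> \<Union>(generate PSL2C {{A, - A}, {B, - B}})" and lim: "X \<longlonglongrightarrow> mat 1"
    have "Bseq X" using lim by (intro convergent_imp_Bseq convergentI)
    then obtain R where R: "\<And>n. norm (X n) \<le> R" unfolding Bseq_def by blast
    have "X n \<in> {w \<in> words. det w = 1 \<and> norm w \<le> R}" for n
      using subsetD [OF generate_subset_words X [of n]] G.det_1 [OF X [of n]] R [of n] by simp
    with finite_words_bounded show "\<exists>n. X n = mat 1"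
      using lim by (rule finite_sequence_limit)
  qed
qed

end

section \<open>Non-elementarity\<close>

lemma poincare_extension_limit:
  fixes X :: "nat \<Rightarrow> complex^2^2"
  assumes t: "t > 0" and r: "\<And>n. r n > 0" "r \<longlonglongrightarrow> 0" and lim: "(\<lambda>n. r n *\<^sub>R X n) \<longlonglongrightarrow> E"
    and E: "E$1$1 = \<rho> * E$2$1" "E$1$2 = \<rho> * E$2$2" "E$2$1 \<noteq> 0 \<or> E$2$2 \<noteq> 0"
  shows "(\<lambda>n. poincare_extension (X n) (z, t)) \<longlonglongrightarrow> (\<rho>, 0)"
proof -
  define Y where "Y n = r n *\<^sub>R X n" for n
  have Ylim: "Y \<longlonglongrightarrow> E" using lim by (simp add: Y_def [abs_def])
  have peX: "poincare_extension (X n) (z, t) =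
      (pe_num (Y n) z t / of_real (row_form (Y n) 2 z t), (r n)\<^sup>2 * t / row_form (Y n) 2 z t)" for n
    unfolding poincare_extension_eq Y_def row_form_scale pe_num_scale using r(1) [of n] by simp
  have N: "row_form E 2 z t \<noteq> 0" using row_form_eq_0 [OF t, of E 2 z] E(3) by auto
  have "pe_num E z t = \<rho> * of_real (row_form E 2 z t)"
    unfolding pe_num_def row_form_def E
    by (simp add: complex_norm_square algebra_simps del: of_real_power)
  then have \<rho>: "pe_num E z t / of_real (row_form E 2 z t) = \<rho>" using N by simp
  have "(\<lambda>n. (pe_num (Y n) z t / of_real (row_form (Y n) 2 z t), (r n)\<^sup>2 * t / row_form (Y n) 2 z t)) \<longlonglongrightarrow>
      (pe_num E z t / of_real (row_form E 2 z t), 0\<^sup>2 * t / row_form E 2 z t)"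
    using N by (intro tendsto_intros tendsto_pe_num tendsto_row_form Ylim r(2)) simp_all
  then show ?thesis unfolding peX \<rho> by simp
qed

context order4_order2
begin

text \<open>The first is Fricke's identity \<open>tr [A, B] = x^2 + y^2 + z^2 - x y z - 2\<close> at
  \<open>(s, 0, \<phi>)\<close>. Behind the second is
  \<open>tr (h A) = tr h tr A - tr (h A^-1)\<close> for \<open>h = [A, B]\<close>, where
  \<open>A^-1 h = B A^-1 B^-1\<close> has trace \<open>s\<close>.\<close>

lemma trace_commutator:
  "trace (A ** B ** matrix_inv A ** matrix_inv B) = \<phi> * \<phi>"
  "trace (A ** B ** matrix_inv A ** matrix_inv B ** A) = s * (\<phi> * \<phi> - 1)"
proof -
  obtain a b c e f g where *: "A = mk2 a b c (s - a)" "B = mk2 e f g (- e)"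
    "a * (s - a) - b * c = 1" "e * e + f * g = - 1" "\<phi> = a * e + b * g + (c * f - (s - a) * e)"
    by (rule entries)
  have "trace (A ** B ** matrix_inv A ** matrix_inv B) = s * s + \<phi> * \<phi> - 2"
    unfolding inv_B unfolding *(1,2) matrix_inv_mk2 [OF *(3)] mk2_mult mk2_uminus mk2_trace *(5)
    using *(3,4) by algebra
  then show "trace (A ** B ** matrix_inv A ** matrix_inv B) = \<phi> * \<phi>" unfolding s2 by simp
  have "trace (A ** B ** matrix_inv A ** matrix_inv B ** A) = s * (s * s + \<phi> * \<phi> - 2) - s"
    unfolding inv_B unfolding *(1,2) matrix_inv_mk2 [OF *(3)] mk2_mult mk2_uminus mk2_trace *(5)
    using *(3,4) by algebra
  then show "trace (A ** B ** matrix_inv A ** matrix_inv B ** A) = s * (\<phi> * \<phi> - 1)"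
    unfolding s2 by (simp add: algebra_simps)
qed

end

lemma ratio_eq_iff:
  fixes a b c d x y x' y' :: complex
  assumes "a * d - b * c \<noteq> 0" "c * x + d * y \<noteq> 0" "c * x' + d * y' \<noteq> 0"
    and "(a * x + b * y) / (c * x + d * y) = (a * x' + b * y') / (c * x' + d * y')"
  shows "x * y' = x' * y"
proof -
  have "(a * x + b * y) * (c * x' + d * y') = (a * x' + b * y') * (c * x + d * y)"
    using assms(2-4) by (simp add: frac_eq_eq)
  then have "(a * d - b * c) * (x * y' - x' * y) = 0" by algebra
  then show ?thesis using assms(1) by simp
qed

context group_245
begin

text \<open>Let \<open>p\<close> be the attracting fixed point of \<open>h = [A, B]\<close>. As n
  grows, \<open>A h^m A^-1 h^n\<close> moves the base point to \<open>A h^m A^-1 p\<close>. These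
  limits differ for different m because \<open>A^-1 p\<close> is not fixed by \<open>h\<close>,
  which in the eigenbasis of \<open>h\<close> means that \<open>c\<close> and \<open>d\<close> are
  nonzero.\<close>

lemma not_elementary: "\<not> elementary (generate PSL2C {{A, - A}, {B, - B}})"
proof
  let ?G = "generate PSL2C {{A, - A}, {B, - B}}"
  assume elem: "elementary ?G"
  interpret G: discrete_sl2_group "\<Union>?G" by (rule discrete)
  define h where "h = A ** B ** matrix_inv A ** matrix_inv B"
  have AG: "A \<in> \<Union>?G" by (rule UnionI [OF generate.incl [of "{A, - A}"]]) simp_all
  have BG: "B \<in> \<Union>?G" by (rule UnionI [OF generate.incl [of "{B, - B}"]]) simp_all
  have hG: "h \<in> \<Union>?G" unfolding h_def by (intro G.mult_closed G.inv_closed AG BG)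
  define \<tau> where "\<tau> = golden * golden"
  have \<tau>g: "\<tau> = golden + 1" unfolding \<tau>_def golden_sq(1) ..
  have \<tau>: "\<tau> > 2" unfolding \<tau>g golden_def using sqrt5_bounds by simp
  \<comment> \<open>The larger root of \<open>x^2 - \<tau> x + 1\<close>, real since
    \<open>\<tau> > 2\<close>: \<open>h\<close> is hyperbolic.\<close>
  define \<rho> where "\<rho> = (\<tau> + sqrt (\<tau> * \<tau> - 4)) / 2"
  have "2 * 2 < \<tau> * \<tau>" using \<tau> by (intro mult_strict_mono) auto
  then have sq: "sqrt (\<tau> * \<tau> - 4) * sqrt (\<tau> * \<tau> - 4) = \<tau> * \<tau> - 4" "sqrt (\<tau> * \<tau> - 4) > 0" by simp_all
  have \<rho>1: "\<rho> > 1" using add_strict_mono [OF \<tau> sq(2)] unfolding \<rho>_def by simp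
  have "\<rho> * \<rho> - \<tau> * \<rho> + 1 = (sqrt (\<tau> * \<tau> - 4) * sqrt (\<tau> * \<tau> - 4) - (\<tau> * \<tau> - 4)) / 4"
    unfolding \<rho>_def by (simp add: field_simps)
  then have "\<rho> * \<rho> + 1 = \<tau> * \<rho>" unfolding sq(1) by simp
  then have \<tau>\<rho>: "\<tau> = \<rho> + 1 / \<rho>" using \<rho>1 by (simp add: field_simps)
  define l where "l = complex_of_real \<rho>"
  have l0: "l \<noteq> 0" using \<rho>1 by (simp add: l_def)
  have lp: "l + 1 \<noteq> 0"
  proof -
    have "l + 1 = complex_of_real (\<rho> + 1)" by (simp add: l_def)
    moreover have "\<rho> + 1 \<noteq> 0" using \<rho>1 by simp
    ultimately show ?thesis by (simp only: of_real_eq_0_iff not_False_eq_True)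
  qed
  have ll: "l * l \<noteq> 1"
  proof -
    have "1 * 1 < \<rho> * \<rho>" using \<rho>1 by (intro mult_strict_mono) auto
    then have "\<rho> * \<rho> \<noteq> 1" by simp
    moreover have "l * l = complex_of_real (\<rho> * \<rho>)" by (simp add: l_def)
    ultimately show ?thesis by (simp only: of_real_eq_1_iff not_False_eq_True)
  qed
  have trh: "trace h = l + 1 / l"
  proof -
    have "trace h = complex_of_real \<tau>" unfolding h_def trace_commutator \<tau>_def by simp
    then show ?thesis unfolding \<tau>\<rho> l_def by simp
  qed
  have "l \<noteq> 1 / l" using ll l0 by (simp add: eq_divide_eq)
  from diagonalize [OF G.det_1 [OF hG] trh l0 this] obtain P Q
    where PQ: "P ** Q = mat 1" "Q ** P = mat 1" and H: "Q ** h ** P = mk2 l 0 0 (1 / l)"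
    by blast
  interpret D: discrete_sl2_group "(\<lambda>A. Q ** A ** P) ` \<Union>?G" by (rule discrete_conj [OF discrete PQ])
  obtain a b c d where FA: "Q ** A ** P = mk2 a b c d" by (rule mk2_cases)
  have HS: "mk2 l 0 0 (1 / l) \<in> (\<lambda>A. Q ** A ** P) ` \<Union>?G" using hG H by (metis imageI)
  have FS: "mk2 a b c d \<in> (\<lambda>A. Q ** A ** P) ` \<Union>?G" using AG FA by (metis imageI)
  have dt: "a * d - b * c = 1" using FS by (rule D.mk2_det_1)
  have ad: "a + d = s" using trace_conj [OF PQ(1), of A] unfolding FA tr(1) by simp
  \<comment> \<open>The traces of \<open>A\<close> and \<open>h ** A\<close> together determine the
    diagonal entries of \<open>A\<close> in the eigenbasis of \<open>h\<close>.\<close>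
  have had: "l * a + d / l = s * (l + 1 / l - 1)"
  proof -
    have "Q ** (h ** A) ** P = (Q ** h ** P) ** (Q ** A ** P)"
    proof -
      have "(Q ** h ** P) ** (Q ** A ** P) = Q ** h ** (P ** Q) ** A ** P" by (simp only: matrix_mul_assoc)
      then show ?thesis by (simp add: PQ matrix_mul_assoc)
    qed
    then have "trace (h ** A) = l * a + d / l"
      using trace_conj [OF PQ(1), of "h ** A"] unfolding H FA by simp
    moreover have "trace (h ** A) = s * (trace h - 1)"
      unfolding h_def trace_commutator ..
    ultimately show ?thesis unfolding trh by simp
  qed
  have s0: "s \<noteq> 0" using s2 by auto
  have "l * (l * a + d / l) = l * (s * (l + 1 / l - 1))" unfolding had ..
  moreover have "l * (l * a + d / l) = l * l * a + d" "l * (s * (l + 1 / l - 1)) = s * (l * l + 1 - l)"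
    using l0 by (simp_all add: field_simps)
  ultimately have e1: "l * l * a + d = s * (l * l + 1 - l)" by (simp only:)
  have al: "a * (l + 1) = s * l"
  proof -
    have "(l - 1) * (a * (l + 1) - s * l) = 0" using e1 ad by algebra
    moreover have "l - 1 \<noteq> 0" using ll by auto
    ultimately show ?thesis by simp
  qed
  then have dl: "d * (l + 1) = s" using ad by algebra
  have d0: "d \<noteq> 0" using dl s0 by auto
  \<comment> \<open>Otherwise \<open>a d = 1\<close>, so \<open>2 l = (l + 1)^2\<close> and
    \<open>l^2 = - 1\<close>, although \<open>l\<close> is real.\<close>
  have c0: "c \<noteq> 0"
  proof
    assume "c = 0"
    then have "a * d = 1" using dt by simp
    then have "(a * (l + 1)) * (d * (l + 1)) = (l + 1) * (l + 1)" by algebra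
    then have "(s * s) * l = (l + 1) * (l + 1)" unfolding al dl by algebra
    then have "l * l + 1 = 0" unfolding s2 by algebra
    then have "complex_of_real (\<rho> * \<rho> + 1) = 0" by (simp add: l_def)
    then have "\<rho> * \<rho> + 1 = 0" by (simp only: of_real_eq_0_iff)
    moreover have "\<rho> * \<rho> \<ge> 0" by simp
    ultimately show False by linarith
  qed
  define R where "R = P ** mk2 a b c d"
  \<comment> \<open>In the eigenbasis, \<open>(x m, y m)\<close> is the first basis vector, that is
    \<open>p\<close>, after \<open>A^-1\<close> and \<open>h^m\<close>. The matrix \<open>R\<close>
    applies \<open>A\<close> and returns to the original coordinates.\<close>
  define x where "x m = l ^ m * d" for m :: nat
  define y where "y m = - (c / l ^ m)" for m :: nat
  define u where "u i m = R$i$1 * x m + R$i$2 * y m" for i m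
  have detR: "R$1$1 * R$2$2 - R$1$2 * R$2$1 \<noteq> 0"
  proof -
    have "det P * det Q = 1" using PQ(1) by (metis det_I det_mul)
    then have "det P \<noteq> 0" by auto
    then have "det R \<noteq> 0" unfolding R_def det_mul using dt by simp
    then show ?thesis unfolding det_2 .
  qed
  have lne: "l ^ m * l ^ m \<noteq> l ^ m' * l ^ m'" if "m < m'" for m m' :: nat
  proof
    assume "l ^ m * l ^ m = l ^ m' * l ^ m'"
    then have "l ^ (m + m) = l ^ (m' + m')" unfolding power_add .
    then have "\<rho> ^ (m + m) = \<rho> ^ (m' + m')" unfolding l_def by (metis of_real_eq_iff of_real_power)
    moreover have "\<rho> ^ (m + m) < \<rho> ^ (m' + m')" using that \<rho>1 by (intro power_strict_increasing) auto
    ultimately show False by simp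
  qed
  have xy: "x m * y m' \<noteq> x m' * y m" if "m \<noteq> m'" for m m'
  proof
    assume "x m * y m' = x m' * y m"
    then have "l ^ m * l ^ m = l ^ m' * l ^ m'"
      unfolding x_def y_def using l0 c0 d0 by (simp add: field_simps)
    then show False using lne [of m m'] lne [of m' m] that by (metis linorder_neqE_nat)
  qed
  \<comment> \<open>At most one exponent gives the limit point at infinity; it is left out.\<close>
  define good where "good = {m. u 2 m \<noteq> 0}"
  have inj: "inj_on (\<lambda>m. u 1 m / u 2 m) good"
  proof (rule inj_onI, rule ccontr)
    fix m m' assume m: "m \<in> good" "m' \<in> good" "u 1 m / u 2 m = u 1 m' / u 2 m'" "m \<noteq> m'"
    have "x m * y m' = x m' * y m"
      by (rule ratio_eq_iff [OF detR]) (use m in \<open>simp_all add: good_def u_def\<close>)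
    with xy [OF m(4)] show False ..
  qed
  have "infinite good"
  proof -
    have "m = m'" if "u 2 m = 0" "u 2 m' = 0" for m m'
    proof (rule ccontr)
      assume "m \<noteq> m'"
      have "R$2$1 * (x m * y m' - x m' * y m) = 0" "R$2$2 * (x m * y m' - x m' * y m) = 0"
        using that unfolding u_def by algebra+
      then have "R$2$1 = 0" "R$2$2 = 0" using xy [OF \<open>m \<noteq> m'\<close>] by auto
      then show False using detR by simp
    qed
    then have "finite {m. u 2 m = 0}"
      by (metis (mono_tags, lifting) finite.emptyI finite_insert finite_subset insertI1 mem_Collect_eq subsetI)
    moreover have "(UNIV :: nat set) = good \<union> {m. u 2 m = 0}" unfolding good_def by auto
    ultimately show ?thesis by (metis finite_UnI infinite_UNIV_nat)
  qed
  have der: "Some (u 1 m / u 2 m, 0) \<in> closed_hyp_space derived_set_of (Some ` psl_orbit ?G (0, 1))"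
    if "m \<in> good" for m
    unfolding psl_orbit_def
  proof -
    let ?A = "mk2 a b c d"
    define W where "W n = ?A ** mk2 (l ^ m) 0 0 (1 / l ^ m) ** mk2 d (- b) (- c) a ** mk2 (l ^ n) 0 0 (1 / l ^ n)" for n
    have WS: "W n \<in> (\<lambda>A. Q ** A ** P) ` \<Union>?G" for n
      unfolding W_def by (intro D.mult_closed FS D.diag_power_closed HS D.inv_closed_mk2 [OF FS])
    define X where "X n = P ** W n ** Q" for n
    have XG: "X n \<in> \<Union>?G" for n
    proof -
      obtain Y where Y: "Y \<in> \<Union>?G" "W n = Q ** Y ** P" using WS [of n] by blast
      have "X n = (P ** Q) ** Y ** (P ** Q)" unfolding X_def Y(2) by (simp only: matrix_mul_assoc)
      then show ?thesis using Y(1) by (simp add: PQ)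
    qed
    define r where "r n = 1 / \<rho> ^ n" for n
    have rr: "complex_of_real (r n) = 1 / l ^ n" for n by (simp add: r_def l_def)
    define E0 where "E0 = mk2 (a * x m + b * y m) 0 (c * x m + d * y m) 0"
    have rW: "r n *\<^sub>R W n = mk2 (a * x m + b * y m) ((- (a * b * l ^ m) + a * b / l ^ m) * (1 / l ^ n * (1 / l ^ n)))
        (c * x m + d * y m) ((- (b * c * l ^ m) + a * d / l ^ m) * (1 / l ^ n * (1 / l ^ n)))" for n
    proof -
      have "r n *\<^sub>R mk2 p q p' q' = mk2 (1 / l ^ n * p) (1 / l ^ n * q) (1 / l ^ n * p') (1 / l ^ n * q')" for p q p' q'
        unfolding vec_eq_iff forall_2 vector_scaleR_component mk2_nth
          scaleR_conv_of_real [where 'a = complex] rr by simp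
      then show ?thesis
        unfolding W_def mk2_mult x_def y_def using l0 by (simp add: field_simps)
    qed
    have "norm (1 / l) < 1" using \<rho>1 by (simp add: l_def norm_divide)
    then have "(\<lambda>n. (1 / l) ^ n) \<longlonglongrightarrow> 0" by (rule LIMSEQ_power_zero)
    then have l0': "(\<lambda>n. 1 / l ^ n) \<longlonglongrightarrow> 0" by (simp only: power_one_over)
    have z: "(\<lambda>n. k * (1 / l ^ n * (1 / l ^ n))) \<longlonglongrightarrow> 0" for k
      using tendsto_mult [OF tendsto_const [of k] tendsto_mult [OF l0' l0']] by simp
    have "(\<lambda>n. r n *\<^sub>R W n) \<longlonglongrightarrow> E0"
      unfolding rW E0_def by (intro tendsto_mk2 tendsto_const z)
    then have lim: "(\<lambda>n. r n *\<^sub>R X n) \<longlonglongrightarrow> P ** E0 ** Q"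
      unfolding X_def conj_scaleR [symmetric] by (intro tendsto_matrix_mult tendsto_const)
    have uu: "(P ** E0) $ i $ 1 = u i m" "(P ** E0) $ i $ 2 = 0" for i
      unfolding E0_def u_def R_def by (simp_all add: matrix_matrix_mult_def sum_2 algebra_simps)
    have EE: "(P ** E0 ** Q) $ i $ j = u i m * Q$1$j" for i j
    proof -
      have "(P ** E0 ** Q) $ i $ j = (P ** E0)$i$1 * Q$1$j + (P ** E0)$i$2 * Q$2$j"
        by (simp add: matrix_matrix_mult_def [of "P ** E0"] sum_2)
      then show ?thesis unfolding uu by simp
    qed
    have Q1: "Q$1$1 \<noteq> 0 \<or> Q$1$2 \<noteq> 0"
    proof (rule ccontr)
      assume "\<not> (Q$1$1 \<noteq> 0 \<or> Q$1$2 \<noteq> 0)"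
      then have "det Q = 0" by (simp add: det_2)
      then have "det (P ** Q) = 0" by (simp add: det_mul)
      then show False unfolding PQ by simp
    qed
    have u2: "u 2 m \<noteq> 0" using that by (simp add: good_def)
    have "(\<lambda>n. poincare_extension (X n) (0, 1)) \<longlonglongrightarrow> (u 1 m / u 2 m, 0)"
    proof (rule poincare_extension_limit [OF _ _ _ lim])
      show "r n > 0" for n using \<rho>1 by (simp add: r_def)
      have "(\<lambda>n. (1 / \<rho>) ^ n) \<longlonglongrightarrow> 0" using \<rho>1 by (intro LIMSEQ_power_zero) simp
      then show "r \<longlonglongrightarrow> 0" unfolding r_def [abs_def] power_one_over .
    qed (use u2 Q1 in \<open>simp_all add: EE\<close>)
    then show "Some (u 1 m / u 2 m, 0) \<in> closed_hyp_space derived_set_of (Some ` {poincare_extension A (0, 1) |A. A \<in> \<Union>?G})"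
      by (intro limit_point_derived [where X = X] XG G.det_1) simp_all
  qed
  have "finite (closed_hyp_space derived_set_of (Some ` psl_orbit ?G (0, 1)))"
    using elem unfolding elementary_def hyp_space_def by simp
  moreover have "(\<lambda>m. Some (u 1 m / u 2 m, 0 :: real)) ` good \<subseteq> closed_hyp_space derived_set_of (Some ` psl_orbit ?G (0, 1))"
    using der by (intro image_subsetI)
  ultimately have "finite ((\<lambda>m. Some (u 1 m / u 2 m, 0 :: real)) ` good)" by (rule finite_subset [rotated])
  moreover have "inj_on (\<lambda>m. Some (u 1 m / u 2 m, 0 :: real)) good"
    using inj by (simp add: inj_on_def)
  ultimately have "finite good" by (rule finite_imageD)
  with \<open>infinite good\<close> show False ..
qed

lemma kleinian: "kleinian (generate PSL2C {{A, - A}, {B, - B}})"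
proof -
  interpret P: group PSL2C by (rule group_PSL2C)
  have "subgroup (generate PSL2C {{A, - A}, {B, - B}}) PSL2C"
    using carrier_PSL2C_I det by (intro P.generate_is_subgroup) auto
  then show ?thesis
    unfolding kleinian_def using not_elementary
      discrete_topology_PSL2C [OF subgroup.subset discrete] by blast
qed

end

section \<open>Isometries of the hyperbolic plane\<close>

definition rmat :: "real \<Rightarrow> real \<Rightarrow> real \<Rightarrow> real \<Rightarrow> complex^2^2" where
  "rmat a b c d = mk2 (of_real a) (of_real b) (of_real c) (of_real d)"

text \<open>The matrices \<open>(orientation sign e, A)\<close> act on the half-plane by \<open>z \<mapsto> (az + b) / (cz + d)\<close>
  if \<open>e\<close> is false, and by \<open>z \<mapsto> (a cnj z + b) / (c cnj z + d)\<close> if \<open>e\<close> is true.\<close>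

definition cnj_if :: "bool \<Rightarrow> complex \<Rightarrow> complex" where
  "cnj_if e z = (if e then cnj z else z)"

definition act :: "bool \<Rightarrow> complex^2^2 \<Rightarrow> complex \<Rightarrow> complex" where
  "act e A z = (A$1$1 * cnj_if e z + A$1$2) / (A$2$1 * cnj_if e z + A$2$2)"

definition Act :: "bool \<Rightarrow> complex^2^2 \<Rightarrow> complex \<Rightarrow> complex" where
  "Act e A = (\<lambda>z\<in>hyp_plane. act e A z)"

text \<open>Acting on the conjugate variable, a real matrix preserves the upper half-plane exactly
  if its determinant is negative, hence the sign.\<close>

definition isom_mat :: "bool \<Rightarrow> complex^2^2 \<Rightarrow> bool" where
  "isom_mat e A \<longleftrightarrow> (\<exists>a b c d. A = rmat a b c d \<and> a * d - b * c = (if e then - 1 else 1))"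

lemma isom_matE:
  assumes "isom_mat e A"
  obtains a b c d where "A = rmat a b c d" "a * d - b * c = (if e then - 1 else 1)"
  using assms unfolding isom_mat_def by blast

lemma isom_matI: "a * d - b * c = (if e then - 1 else 1) \<Longrightarrow> isom_mat e (rmat a b c d)"
  unfolding isom_mat_def by blast

lemma rmat_mult:
  "rmat a b c d ** rmat a' b' c' d' =
     rmat (a * a' + b * c') (a * b' + b * d') (c * a' + d * c') (c * b' + d * d')"
  by (simp add: rmat_def)

lemma rmat_uminus: "- rmat a b c d = rmat (- a) (- b) (- c) (- d)"
  by (simp add: rmat_def)

lemma rmat_one: "mat 1 = rmat 1 0 0 1"
  by (simp add: rmat_def mat_1_mk2)

lemma rmat_det: "det (rmat a b c d) = of_real (a * d - b * c)"
  by (simp add: rmat_def)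

lemma isom_mat_det: "isom_mat False A \<Longrightarrow> det A = 1"
  by (elim isom_matE) (simp add: rmat_det)

lemma isom_mat_one: "isom_mat False (mat 1)"
  unfolding rmat_one by (rule isom_matI) simp

lemma isom_mat_mult: "isom_mat e A \<Longrightarrow> isom_mat e' B \<Longrightarrow> isom_mat (e \<noteq> e') (A ** B)"
proof -
  assume "isom_mat e A" "isom_mat e' B"
  then obtain a b c d a' b' c' d' where *: "A = rmat a b c d" "a * d - b * c = (if e then - 1 else 1)"
    "B = rmat a' b' c' d'" "a' * d' - b' * c' = (if e' then - 1 else 1)"
    by (elim isom_matE) blast
  have "(a * a' + b * c') * (c * b' + d * d') - (a * b' + b * d') * (c * a' + d * c') =
      (a * d - b * c) * (a' * d' - b' * c')" by (simp add: algebra_simps)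
  also have "\<dots> = (if e \<noteq> e' then - 1 else 1)" unfolding *(2,4) by simp
  finally show ?thesis unfolding *(1,3) rmat_mult by (rule isom_matI)
qed

lemma isom_mat_uminus: "isom_mat e A \<Longrightarrow> isom_mat e (- A)"
  by (elim isom_matE) (simp add: rmat_uminus isom_matI)

lemma isom_mat_inverse:
  assumes "isom_mat e A"
  shows "\<exists>B. isom_mat e B \<and> B ** A = mat 1 \<and> A ** B = mat 1"
proof -
  obtain a b c d where *: "A = rmat a b c d" "a * d - b * c = (if e then - 1 else 1)"
    using assms by (rule isom_matE)
  define \<epsilon> :: real where "\<epsilon> = (if e then - 1 else 1)"
  have \<epsilon>: "a * d - b * c = \<epsilon>" "\<epsilon> * \<epsilon> = 1" using *(2) by (simp_all add: \<epsilon>_def)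
  have \<epsilon>ad: "\<epsilon> * (a * d - b * c) = 1" unfolding \<epsilon> ..
  let ?B = "rmat (\<epsilon> * d) (- (\<epsilon> * b)) (- (\<epsilon> * c)) (\<epsilon> * a)"
  have "\<epsilon> * d * (\<epsilon> * a) - - (\<epsilon> * b) * - (\<epsilon> * c) = \<epsilon> * \<epsilon> * (a * d - b * c)"
    by (simp add: algebra_simps)
  then have "isom_mat e ?B" using *(2) unfolding \<epsilon>(2) by (intro isom_matI) simp
  moreover have "?B ** A = mat 1" "A ** ?B = mat 1"
  proof -
    have "\<epsilon> * d * a + - (\<epsilon> * b) * c = 1" "\<epsilon> * d * b + - (\<epsilon> * b) * d = 0"
      "- (\<epsilon> * c) * a + \<epsilon> * a * c = 0" "- (\<epsilon> * c) * b + \<epsilon> * a * d = 1"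
      "a * (\<epsilon> * d) + b * - (\<epsilon> * c) = 1" "a * - (\<epsilon> * b) + b * (\<epsilon> * a) = 0"
      "c * (\<epsilon> * d) + d * - (\<epsilon> * c) = 0" "c * - (\<epsilon> * b) + d * (\<epsilon> * a) = 1"
      using \<epsilon>ad by (simp_all add: algebra_simps)
    then show "?B ** A = mat 1" "A ** ?B = mat 1"
      unfolding *(1) rmat_mult rmat_one by (simp_all only:)
  qed
  ultimately show ?thesis by blast
qed

lemma real_linear_nonzero:
  assumes "Im z \<noteq> 0" "c \<noteq> 0 \<or> d \<noteq> 0"
  shows "complex_of_real c * z + of_real d \<noteq> 0"
proof
  assume *: "complex_of_real c * z + of_real d = 0"
  from arg_cong [OF *, of Im] have "c = 0" using assms(1) by simp
  with arg_cong [OF *, of Re] assms(2) show False by simp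
qed

lemma cnj_if_Im: "Im z > 0 \<Longrightarrow> Im (cnj_if e z) \<noteq> 0"
  by (simp add: cnj_if_def)

lemma act_denom_nonzero:
  assumes "Im z > 0" "a * d - b * c = (if e' then - 1 else 1)"
  shows "complex_of_real c * cnj_if e z + of_real d \<noteq> 0"
  using assms(2) by (intro real_linear_nonzero cnj_if_Im assms(1)) (auto split: if_splits)

lemma act_Im:
  assumes "isom_mat e A" "Im z > 0"
  shows "Im (act e A z) > 0"
proof -
  obtain a b c d where *: "A = rmat a b c d" "a * d - b * c = (if e then - 1 else 1)"
    using assms(1) by (rule isom_matE)
  let ?w = "cnj_if e z"
  let ?D = "complex_of_real c * ?w + of_real d"
  have nz: "?D \<noteq> 0" using act_denom_nonzero [OF assms(2) *(2)] .
  have "act e A z = (complex_of_real a * ?w + of_real b) * cnj ?D / of_real ((cmod ?D)\<^sup>2)"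
    unfolding act_def *(1) rmat_def mk2_nth by (subst complex_div_cnj) simp
  then have "Im (act e A z) = Im ((complex_of_real a * ?w + of_real b) * cnj ?D) / (cmod ?D)\<^sup>2"
    by (simp only: Im_divide_of_real)
  also have "Im ((complex_of_real a * ?w + of_real b) * cnj ?D) = (a * d - b * c) * Im ?w"
    by (simp add: algebra_simps)
  also have "\<dots> = Im z" unfolding *(2) cnj_if_def by simp
  finally show ?thesis using assms(2) nz by simp
qed

text \<open>Real entries commute with conjugation, so the orientation signs add modulo 2 while the
  matrices simply multiply.\<close>

lemma act_act:
  assumes "isom_mat e A" "isom_mat e' B" "Im z > 0"
  shows "act e A (act e' B z) = act (e \<noteq> e') (A ** B) z"
proof -
  obtain a b c d where A: "A = rmat a b c d" "a * d - b * c = (if e then - 1 else 1)"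
    using assms(1) by (rule isom_matE)
  obtain a' b' c' d' where B: "B = rmat a' b' c' d'" "a' * d' - b' * c' = (if e' then - 1 else 1)"
    using assms(2) by (rule isom_matE)
  define w where "w = cnj_if (e \<noteq> e') z"
  have w': "cnj_if e (act e' B z) = (of_real a' * w + of_real b') / (of_real c' * w + of_real d')"
    unfolding act_def B(1) rmat_def mk2_nth w_def cnj_if_def by (cases e; cases e') simp_all
  have nz: "complex_of_real c' * w + of_real d' \<noteq> 0"
    unfolding w_def by (rule act_denom_nonzero [OF assms(3) B(2)])
  have frac: "(p * (n / k) + q) / (r * (n / k) + t) = (p * n + q * k) / (r * n + t * k)"
    if "k \<noteq> 0" for p q r t n k :: complex
  proof -
    have "p * (n / k) + q = (p * n + q * k) / k" "r * (n / k) + t = (r * n + t * k) / k"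
      using that by (simp_all add: add_divide_distrib)
    then show ?thesis using that by simp
  qed
  have "act e A (act e' B z) = (of_real a * ((of_real a' * w + of_real b') / (of_real c' * w + of_real d')) + of_real b) /
      (of_real c * ((of_real a' * w + of_real b') / (of_real c' * w + of_real d')) + of_real d)"
    by (simp only: act_def [of e] w') (simp add: A(1) rmat_def)
  also have "\<dots> = (of_real a * (of_real a' * w + of_real b') + of_real b * (of_real c' * w + of_real d')) /
      (of_real c * (of_real a' * w + of_real b') + of_real d * (of_real c' * w + of_real d'))"
    by (rule frac [OF nz])
  also have "\<dots> = act (e \<noteq> e') (A ** B) z"
    unfolding act_def A(1) B(1) rmat_mult unfolding rmat_def mk2_nth w_def [symmetric]
    by (simp add: algebra_simps)
  finally show ?thesis .
qed

lemma act_one: "act False (mat 1) z = z"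
  by (simp add: act_def cnj_if_def mat_1_mk2)

lemma act_uminus: "act e (- A) z = act e A z"
proof -
  have m: "- p * w + - q = - (p * w + q)" for p q w :: complex by simp
  show ?thesis unfolding act_def vector_uminus_component m minus_divide_divide ..
qed

lemma Act_uminus: "Act e (- A) = Act e A"
  unfolding Act_def act_uminus ..

lemma moebius_Act: "moebius A = Act False A"
  by (simp add: moebius_def Act_def act_def cnj_if_def)

lemma Act_Bij:
  assumes "isom_mat e A"
  shows "Act e A \<in> Bij hyp_plane"
proof -
  obtain B where B: "isom_mat e B" "B ** A = mat 1" "A ** B = mat 1"
    using isom_mat_inverse [OF assms] by blast
  have "bij_betw (Act e A) hyp_plane hyp_plane"
  proof (rule bij_betwI [where g = "act e B"])
    show "Act e A \<in> hyp_plane \<rightarrow> hyp_plane"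
      using act_Im [OF assms] by (simp add: Act_def hyp_plane_def)
    show "act e B \<in> hyp_plane \<rightarrow> hyp_plane"
      using act_Im [OF B(1)] by (simp add: hyp_plane_def)
    show "act e B (Act e A z) = z" if "z \<in> hyp_plane" for z
    proof -
      have "Im z > 0" using that by (simp add: hyp_plane_def)
      from act_act [OF B(1) assms this] show ?thesis using that by (simp add: Act_def B(2) act_one)
    qed
    show "Act e A (act e B z) = z" if "z \<in> hyp_plane" for z
    proof -
      have z: "Im z > 0" using that by (simp add: hyp_plane_def)
      from act_act [OF assms B(1) this] show ?thesis
        using act_Im [OF B(1) z] by (simp add: Act_def B(3) act_one hyp_plane_def)
    qed
  qed
  then show ?thesis by (simp add: Bij_def Act_def)
qed

lemma Act_mult:
  assumes "isom_mat e A" "isom_mat e' B"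
  shows "Act e A \<otimes>\<^bsub>BijGroup hyp_plane\<^esub> Act e' B = Act (e \<noteq> e') (A ** B)"
proof -
  have "Act e A \<otimes>\<^bsub>BijGroup hyp_plane\<^esub> Act e' B = compose hyp_plane (Act e A) (Act e' B)"
    using Act_Bij [OF assms(1)] Act_Bij [OF assms(2)] by (simp add: BijGroup_def)
  also have "\<dots> = Act (e \<noteq> e') (A ** B)"
  proof
    fix z
    show "compose hyp_plane (Act e A) (Act e' B) z = Act (e \<noteq> e') (A ** B) z"
    proof (cases "z \<in> hyp_plane")
      case True
      then have z: "Im z > 0" by (simp add: hyp_plane_def)
      then have "act e' B z \<in> hyp_plane" using act_Im [OF assms(2)] by (simp add: hyp_plane_def)
      then show ?thesis using True act_act [OF assms z] by (simp add: compose_def Act_def)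
    next
      case False
      then show ?thesis by (simp add: compose_def Act_def)
    qed
  qed
  finally show ?thesis .
qed

lemma Act_one: "Act False (mat 1) = \<one>\<^bsub>BijGroup hyp_plane\<^esub>"
  by (simp add: BijGroup_def Act_def act_one)

lemma Act_inv:
  assumes "isom_mat e A" "isom_mat e B" "B ** A = mat 1"
  shows "inv\<^bsub>BijGroup hyp_plane\<^esub> (Act e A) = Act e B"
proof -
  interpret group "BijGroup hyp_plane" by (rule group_BijGroup)
  have c: "Act e A \<in> carrier (BijGroup hyp_plane)" "Act e B \<in> carrier (BijGroup hyp_plane)"
    using Act_Bij assms by (simp_all add: BijGroup_def)
  show ?thesis
    by (rule inv_equality [OF _ c]) (simp add: Act_mult [OF assms(2,1)] assms(3) Act_one)
qed

text \<open>Fixing \<open>\<i>\<close> and \<open>2 \<i>\<close> leaves, up to sign, the identity or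
  the reflection in the imaginary axis, and \<open>1 + \<i>\<close> excludes the latter.\<close>

lemma Act_eq_one:
  assumes "isom_mat e A" and eq: "\<And>z. Im z > 0 \<Longrightarrow> act e A z = z"
  shows "\<not> e \<and> (A = mat 1 \<or> A = - mat 1)"
proof -
  obtain a b c d where *: "A = rmat a b c d" "a * d - b * c = (if e then - 1 else 1)"
    using assms(1) by (rule isom_matE)
  have e: "of_real a * cnj_if e z + of_real b = z * (of_real c * cnj_if e z + of_real d)" if "Im z > 0" for z
    using eq [OF that] act_denom_nonzero [OF that *(2)]
    unfolding act_def *(1) rmat_def mk2_nth by (simp add: divide_eq_eq)
  have 1: "Im \<i> > 0" "Im (2 * \<i>) > 0" "Im (1 + \<i>) > 0" by simp_all
  show ?thesis
  proof (cases e)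
    case False
    have "a = d" "b = - c"
      using e [OF 1(1)] False by (simp_all add: cnj_if_def complex_eq_iff)
    moreover have "b = - (4 * c)"
      using e [OF 1(2)] False by (simp add: cnj_if_def complex_eq_iff)
    ultimately have bc: "b = 0" "c = 0" "d = a" by simp_all
    then have "a * a = 1" using *(2) False by simp
    then have "a = 1 \<or> a = - 1" by (simp add: square_eq_1_iff)
    then show ?thesis using False by (auto simp: *(1) bc rmat_one rmat_uminus)
  next
    case True
    have "d = - a" "b = c"
      using e [OF 1(1)] True by (simp_all add: cnj_if_def complex_eq_iff)
    moreover have "b = 4 * c"
      using e [OF 1(2)] True by (simp add: cnj_if_def complex_eq_iff)
    ultimately have bc: "b = 0" "c = 0" "d = - a" by simp_all
    have "a = 0" using e [OF 1(3)] True by (simp add: cnj_if_def complex_eq_iff bc)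
    then show ?thesis using *(2) bc by (simp split: if_splits)
  qed
qed

lemma Act_inj:
  assumes "isom_mat e A" "isom_mat e' B" and eq: "Act e A = Act e' B"
  shows "e = e' \<and> (A = B \<or> A = - B)"
proof -
  obtain C where C: "isom_mat e' C" "C ** B = mat 1" "B ** C = mat 1"
    using isom_mat_inverse [OF assms(2)] by blast
  have "act (e' \<noteq> e) (C ** A) z = z" if z: "Im z > 0" for z
  proof -
    have "act e A z = act e' B z"
      using fun_cong [OF eq, of z] z by (simp add: Act_def hyp_plane_def)
    then have "act e' C (act e A z) = act e' C (act e' B z)" by (simp only:)
    then show ?thesis
      unfolding act_act [OF C(1) assms(1) z] act_act [OF C(1) assms(2) z] by (simp add: C(2) act_one)
  qed
  from Act_eq_one [OF isom_mat_mult [OF C(1) assms(1)] this]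
  have e: "e' = e" and CA: "C ** A = mat 1 \<or> C ** A = - mat 1" by auto
  have "B ** (C ** A) = (B ** C) ** A" by (simp only: matrix_mul_assoc)
  then have "A = B ** (C ** A)" using C(3) by simp
  then show ?thesis using e CA by (auto simp: matrix_mult_minus_right)
qed

section \<open>Reflections in geodesics and their traces\<close>

text \<open>Together with \<open>refl_p\<close> and \<open>refl_q\<close> this is the cross product
  of \<open>(|u|^2, - 2 Re u, - 1)\<close> with the same vector for \<open>v\<close>: the
  coefficients of the circle or line through both points that is orthogonal to the real
  axis.\<close>

definition refl_s :: "complex \<Rightarrow> complex \<Rightarrow> real" where
  "refl_s u v = 2 * (Re u - Re v)"

definition refl_p :: "complex \<Rightarrow> complex \<Rightarrow> real" where
  "refl_p u v = (cmod u)\<^sup>2 - (cmod v)\<^sup>2"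

definition refl_q :: "complex \<Rightarrow> complex \<Rightarrow> real" where
  "refl_q u v = 2 * (Re u * (cmod v)\<^sup>2 - Re v * (cmod u)\<^sup>2)"

text \<open>A positive multiple of \<open>to_disc u v\<close>.\<close>

definition refl_T :: "complex \<Rightarrow> complex \<Rightarrow> complex" where
  "refl_T u v = of_real (refl_s u v) * u - of_real (refl_p u v)"

text \<open>\<open>z \<mapsto> (p cnj z + q) / (s cnj z - p)\<close> fixes exactly the points with
  \<open>s |z|^2 - 2 p Re z - q = 0\<close>, and \<open>(s, p, q)\<close> is determined up to a factor by two of them.\<close>

definition refl_mat :: "complex \<Rightarrow> complex \<Rightarrow> complex^2^2" where
  "refl_mat u v = rmat (refl_p u v / cmod (refl_T u v)) (refl_q u v / cmod (refl_T u v))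
     (refl_s u v / cmod (refl_T u v)) (- refl_p u v / cmod (refl_T u v))"

lemma refl_q_eq: "refl_q u v = refl_s u v * (cmod u)\<^sup>2 - 2 * refl_p u v * Re u"
  by (simp add: refl_q_def refl_s_def refl_p_def algebra_simps)

text \<open>The right side is the numerator of \<open>to_disc u v\<close> after multiplication by
  the conjugate of the denominator.\<close>

lemma refl_T_factor: "refl_T u v = (v - u) * (cnj v - u)"
proof -
  have s: "complex_of_real (refl_s u v) = (u + cnj u) - (v + cnj v)"
    by (simp add: refl_s_def complex_add_cnj algebra_simps)
  have p: "complex_of_real (refl_p u v) = u * cnj u - v * cnj v"
    by (simp add: refl_p_def complex_norm_square del: of_real_power)
  show ?thesis unfolding refl_T_def s p by (simp add: algebra_simps)
qed

lemma refl_T_nonzero: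
  assumes "Im u > 0" "Im v > 0" "u \<noteq> v"
  shows "refl_T u v \<noteq> 0"
proof -
  have "cnj v - u \<noteq> 0" using assms(1,2) by (auto simp: complex_eq_iff)
  then show ?thesis unfolding refl_T_factor using assms(3) by simp
qed

text \<open>Minus the determinant of the unnormalized reflection matrix, which explains the division
  in \<open>refl_mat\<close>.\<close>

lemma refl_T_norm:
  "(cmod (refl_T u v))\<^sup>2 = refl_p u v * refl_p u v + refl_q u v * refl_s u v"
  unfolding refl_q_eq unfolding cmod_power2 refl_T_def by (simp add: power2_eq_square algebra_simps)

text \<open>The left side is the trace of the product of two unnormalized reflections; the right
  side contains the cosine of the angle at \<open>u\<close>.\<close>

lemma refl_T_inner:
  "2 * refl_p u v * refl_p u w + refl_q u v * refl_s u w + refl_s u v * refl_q u w =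
     2 * Re (refl_T u v * cnj (refl_T u w))"
  unfolding refl_q_eq unfolding cmod_power2 refl_T_def by (simp add: power2_eq_square algebra_simps)

lemma refl_mat_isom:
  assumes "Im u > 0" "Im v > 0" "u \<noteq> v"
  shows "isom_mat True (refl_mat u v)"
proof -
  have nz: "cmod (refl_T u v) \<noteq> 0" using refl_T_nonzero [OF assms] by simp
  have "refl_p u v / cmod (refl_T u v) * (- refl_p u v / cmod (refl_T u v)) -
      refl_q u v / cmod (refl_T u v) * (refl_s u v / cmod (refl_T u v)) =
      - ((refl_p u v * refl_p u v + refl_q u v * refl_s u v) / (cmod (refl_T u v))\<^sup>2)"
    by (simp add: power2_eq_square add_divide_distrib)
  also have "\<dots> = - 1" unfolding refl_T_norm [symmetric] using nz by simp
  finally show ?thesis unfolding refl_mat_def by (intro isom_matI) simp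
qed

lemma refl_mat_square:
  assumes "Im u > 0" "Im v > 0" "u \<noteq> v"
  shows "refl_mat u v ** refl_mat u v = mat 1"
proof -
  have nz: "cmod (refl_T u v) \<noteq> 0" using refl_T_nonzero [OF assms] by simp
  have "refl_p u v / cmod (refl_T u v) * (refl_p u v / cmod (refl_T u v)) +
      refl_q u v / cmod (refl_T u v) * (refl_s u v / cmod (refl_T u v)) =
      (refl_p u v * refl_p u v + refl_q u v * refl_s u v) / (cmod (refl_T u v))\<^sup>2"
    by (simp add: power2_eq_square add_divide_distrib)
  also have "\<dots> = 1" unfolding refl_T_norm [symmetric] using nz by simp
  finally show ?thesis
    unfolding refl_mat_def rmat_mult rmat_one by (simp add: mult.commute add.commute)
qed

text \<open>The matrix remembers the direction of the side although the reflection does not; this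
  sign decides the signs of traces later.\<close>

lemma refl_mat_swap: "refl_mat v u = - refl_mat u v"
proof -
  have a: "refl_p v u = - refl_p u v" "refl_q v u = - refl_q u v" "refl_s v u = - refl_s u v"
    by (simp_all add: refl_p_def refl_q_def refl_s_def)
  have "(cmod (refl_T v u))\<^sup>2 = (cmod (refl_T u v))\<^sup>2" unfolding refl_T_norm a by simp
  then have "cmod (refl_T v u) = cmod (refl_T u v)" by simp
  then show ?thesis unfolding refl_mat_def rmat_uminus a by simp
qed

text \<open>Clearing denominators in the disc formula leaves a common factor
  \<open>cnj u - u\<close>, which cancels.\<close>

lemma hyp_reflection_Act:
  assumes u: "Im u > 0" and v: "Im v > 0" and uv: "u \<noteq> v"
  shows "hyp_reflection u v = Act True (refl_mat u v)"
proof
  fix z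
  show "hyp_reflection u v z = Act True (refl_mat u v) z"
  proof (cases "z \<in> hyp_plane")
    case False
    then show ?thesis by (simp add: hyp_reflection_def Act_def)
  next
    case z: True
    define T where "T = refl_T u v"
    define K where "K = cnj T * (cnj z - u)"
    have T0: "T \<noteq> 0" unfolding T_def by (rule refl_T_nonzero [OF assms])
    have zu: "cnj z - u \<noteq> 0" using z u by (auto simp: complex_eq_iff hyp_plane_def)
    have K0: "K \<noteq> 0" using T0 zu by (simp add: K_def)
    have \<kappa>: "to_disc u v / cnj (to_disc u v) = T / cnj T"
      unfolding T_def refl_T_factor to_disc_def by (simp add: mult.commute)
    have W: "to_disc u v / cnj (to_disc u v) * cnj (to_disc u z) = T * (cnj z - cnj u) / K"
    proof -
      have "cnj (to_disc u z) = (cnj z - cnj u) / (cnj z - u)" by (simp add: to_disc_def)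
      then show ?thesis by (simp only: \<kappa> K_def times_divide_times_eq)
    qed
    define sr pr qr where "sr = complex_of_real (refl_s u v)" and "pr = complex_of_real (refl_p u v)"
      and "qr = complex_of_real (refl_q u v)"
    have Teq: "T = sr * u - pr" "cnj T = sr * cnj u - pr"
      unfolding T_def refl_T_def sr_def pr_def by simp_all
    have qeq: "qr = sr * (u * cnj u) - pr * (u + cnj u)"
    proof -
      have "complex_of_real ((cmod u)\<^sup>2) = u * cnj u" by (rule complex_norm_square)
      then show ?thesis
        unfolding qr_def refl_q_eq sr_def pr_def complex_add_cnj by simp
    qed
    have "from_disc u (T * (cnj z - cnj u) / K) = ((u * K - cnj u * (T * (cnj z - cnj u))) / K) / ((K - T * (cnj z - cnj u)) / K)"
      unfolding from_disc_def using K0 by (simp add: diff_divide_distrib)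
    also have "\<dots> = (u * K - cnj u * (T * (cnj z - cnj u))) / (K - T * (cnj z - cnj u))"
      using K0 by simp
    also have "u * K - cnj u * (T * (cnj z - cnj u)) = (cnj u - u) * (pr * cnj z + qr)"
      unfolding K_def Teq(2) unfolding Teq(1) qeq by algebra
    also have "K - T * (cnj z - cnj u) = (cnj u - u) * (sr * cnj z - pr)"
      unfolding K_def Teq(2) unfolding Teq(1) by algebra
    also have "(cnj u - u) * (pr * cnj z + qr) / ((cnj u - u) * (sr * cnj z - pr)) = (pr * cnj z + qr) / (sr * cnj z - pr)"
    proof -
      have "cnj u - u \<noteq> 0" using u by (auto simp: complex_eq_iff)
      then show ?thesis by simp
    qed
    also have "\<dots> = act True (refl_mat u v) z"
    proof -
      define c where "c = complex_of_real (cmod T)"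
      have c0: "c \<noteq> 0" using T0 by (simp add: c_def)
      have "act True (refl_mat u v) z = (pr / c * cnj z + qr / c) / (sr / c * cnj z + - pr / c)"
        unfolding act_def refl_mat_def rmat_def mk2_nth cnj_if_def
        by (simp add: pr_def qr_def sr_def c_def T_def)
      also have "\<dots> = ((pr * cnj z + qr) / c) / ((sr * cnj z - pr) / c)"
        by (simp add: add_divide_distrib diff_divide_distrib)
      also have "\<dots> = (pr * cnj z + qr) / (sr * cnj z - pr)" using c0 by simp
      finally show ?thesis ..
    qed
    finally show ?thesis using z unfolding hyp_reflection_def Act_def by (simp only: restrict_apply W if_True)
  qed
qed

text \<open>The product is the rotation about \<open>u\<close> by twice the angle. Both sides are
  directed away from \<open>u\<close>, which fixes the sign of the trace.\<close>

lemma trace_refl_mat: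
  assumes u: "Im u > 0" and v: "Im v > 0" "u \<noteq> v" and w: "Im w > 0" "u \<noteq> w"
  shows "trace (refl_mat u v ** refl_mat u w) = of_real (2 * cos (hyp_angle u v w))"
proof -
  let ?T1 = "refl_T u v" and ?T2 = "refl_T u w"
  have nz: "?T1 \<noteq> 0" "?T2 \<noteq> 0" using refl_T_nonzero assms by auto
  have disc: "to_disc u y = refl_T u y / of_real ((cmod (y - cnj u))\<^sup>2)" if "Im y > 0" for y
  proof -
    have "y - cnj u \<noteq> 0" using u that by (auto simp: complex_eq_iff)
    then have "to_disc u y = (y - u) * cnj (y - cnj u) / of_real ((cmod (y - cnj u))\<^sup>2)"
      unfolding to_disc_def by (subst complex_div_cnj) simp
    then show ?thesis unfolding refl_T_factor by simp
  qed
  define k where "k = (cmod (w - cnj u))\<^sup>2 / (cmod (v - cnj u))\<^sup>2"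
  have "v - cnj u \<noteq> 0" "w - cnj u \<noteq> 0" using u v w by (auto simp: complex_eq_iff)
  then have k: "k > 0" by (simp add: k_def)
  have ratio: "to_disc u v / to_disc u w = of_real k * (?T1 / ?T2)"
    unfolding disc [OF v(1)] disc [OF w(1)] k_def by simp
  have r0: "of_real k * (?T1 / ?T2) \<noteq> 0" using k nz by simp
  have "cos (hyp_angle u v w) = cos (Arg (of_real k * (?T1 / ?T2)))"
    unfolding hyp_angle_def ratio by (simp add: cos_abs_real)
  also have "\<dots> = Re (of_real k * (?T1 / ?T2)) / cmod (of_real k * (?T1 / ?T2))"
    by (rule cos_Arg [OF r0])
  also have "\<dots> = Re (?T1 / ?T2) / cmod (?T1 / ?T2)"
  proof -
    have "Re (of_real k * X) / cmod (of_real k * X) = Re X / cmod X" for X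
      using k by (simp add: norm_mult)
    then show ?thesis .
  qed
  also have "Re (?T1 / ?T2) = Re (?T1 * cnj ?T2) / (cmod ?T2)\<^sup>2"
    by (subst complex_div_cnj) (simp only: Re_divide_of_real)
  also have "Re (?T1 * cnj ?T2) / (cmod ?T2)\<^sup>2 / cmod (?T1 / ?T2) = Re (?T1 * cnj ?T2) / (cmod ?T1 * cmod ?T2)"
    using nz by (simp add: norm_divide power2_eq_square)
  finally have c: "2 * cos (hyp_angle u v w) = 2 * Re (?T1 * cnj ?T2) / (cmod ?T1 * cmod ?T2)" by simp
  have "trace (refl_mat u v ** refl_mat u w) =
      of_real ((2 * refl_p u v * refl_p u w + refl_q u v * refl_s u w + refl_s u v * refl_q u w) / (cmod ?T1 * cmod ?T2))"
    unfolding refl_mat_def rmat_mult unfolding rmat_def mk2_trace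
    by (simp add: add_divide_distrib)
  then show ?thesis unfolding refl_T_inner c .
qed

text \<open>The angles \<open>3 pi / 5\<close> and \<open>2 pi / 5\<close> are supplementary, so the
  cosine is a root of \<open>(c + 1) (4 c^2 - 2 c - 1)\<close>.\<close>

lemma cos_pi_5: "2 * cos (pi / 5) = golden"
proof -
  define c where "c = cos (pi / 5)"
  have c0: "c > 0" unfolding c_def by (rule cos_gt_zero) simp_all
  have "cos (3 * (pi / 5)) = - cos (2 * (pi / 5))"
    using cos_pi_minus [of "2 * (pi / 5)"] by (simp add: field_simps)
  then have "4 * c ^ 3 - 3 * c = - (2 * c\<^sup>2 - 1)"
    unfolding cos_treble_cos cos_double_cos c_def .
  then have "(c + 1) * (4 * c * c - 2 * c - 1) = 0"
    by (simp add: power3_eq_cube power2_eq_square algebra_simps)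
  then have "4 * c * c - 2 * c - 1 = 0" using c0 by simp
  then have "(2 * c) * (2 * c) = 2 * c + 1" by simp
  then have "(2 * c - golden) * (2 * c - golden_conj) = 0"
    unfolding golden_def golden_conj_def by (simp add: field_simps)
  moreover have "2 * c - golden_conj > 0" using c0 sqrt5_bounds by (simp add: golden_conj_def)
  ultimately show ?thesis unfolding c_def by simp
qed

text \<open>The actions of \<open>\<Union>?G\<close> and of its coset by \<open>R1\<close> form a
  group containing the three reflections. By \<open>Act_inj\<close> an orientation-preserving map in
  it cannot come from the coset, so it comes from \<open>?G\<close>.\<close>

lemma orientation_preserving_subgroup:
  fixes R1 R2 R3 :: "complex^2^2"
  assumes iso: "isom_mat True R1" "isom_mat True R2" "isom_mat True R3"
    and sq: "R1 ** R1 = mat 1" "R2 ** R2 = mat 1" "R3 ** R3 = mat 1"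
    and A: "A = - (R2 ** R1)" and B: "B = - (R1 ** R3)"
    and \<Gamma>: "\<Gamma> = generate (BijGroup hyp_plane) {Act True R1, Act True R2, Act True R3}"
  shows "{X \<in> PSL2R. \<forall>M\<in>X. moebius M \<in> \<Gamma>} = generate PSL2C {{A, - A}, {B, - B}}"
proof -
  interpret BG: group "BijGroup hyp_plane" by (rule group_BijGroup)
  interpret PG: group PSL2C by (rule group_PSL2C)
  let ?G = "generate PSL2C {{A, - A}, {B, - B}}"
  have isoA: "isom_mat False A" unfolding A using isom_mat_uminus [OF isom_mat_mult [OF iso(2,1)]] by simp
  have isoB: "isom_mat False B" unfolding B using isom_mat_uminus [OF isom_mat_mult [OF iso(1,3)]] by simp
  have sub: "subgroup ?G PSL2C"
    using carrier_PSL2C_I isom_mat_det [OF isoA] isom_mat_det [OF isoB]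
    by (intro PG.generate_is_subgroup) auto
  interpret GS: subgroup ?G PSL2C by (rule sub)
  interpret G: sl2_group "\<Union>?G" by (rule sl2_group_Union [OF sub])
  have AG: "A \<in> \<Union>?G" by (rule UnionI [OF generate.incl [of "{A, - A}"]]) simp_all
  have BGm: "B \<in> \<Union>?G" by (rule UnionI [OF generate.incl [of "{B, - B}"]]) simp_all
  have carr: "Act True R1 \<in> carrier (BijGroup hyp_plane)" "Act True R2 \<in> carrier (BijGroup hyp_plane)"
    "Act True R3 \<in> carrier (BijGroup hyp_plane)"
    using Act_Bij iso by (simp_all add: BijGroup_def)
  have \<Gamma>sub: "subgroup \<Gamma> (BijGroup hyp_plane)"
    unfolding \<Gamma> using carr by (intro BG.generate_is_subgroup) auto
  interpret \<Gamma>: subgroup \<Gamma> "BijGroup hyp_plane" by (rule \<Gamma>sub)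
  have R\<Gamma>: "Act True R1 \<in> \<Gamma>" "Act True R2 \<in> \<Gamma>" "Act True R3 \<in> \<Gamma>"
    unfolding \<Gamma> by (auto intro: generate.incl)
  have inv_mat: "\<exists>C. isom_mat False C \<and> C ** M = mat 1 \<and> matrix_inv M = C" if iM: "isom_mat False M" for M
  proof -
    obtain C where C: "isom_mat False C" "C ** M = mat 1" "M ** C = mat 1"
      using isom_mat_inverse [OF iM] by blast
    have "matrix_inv M = C" by (rule matrix_inv_unique [OF isom_mat_det [OF iM] C(3)])
    with C show ?thesis by blast
  qed
  let ?U = "{M. isom_mat False M \<and> Act False M \<in> \<Gamma>}"
  have "sl2_group ?U"
  proof
    show "det M = 1" if "M \<in> ?U" for M using that isom_mat_det by simp
    show "mat 1 \<in> ?U" using isom_mat_one \<Gamma>.one_closed by (simp add: Act_one)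
    show "M ** N \<in> ?U" if M: "M \<in> ?U" and N: "N \<in> ?U" for M N
    proof -
      have i: "isom_mat False M" "isom_mat False N" and m: "Act False M \<in> \<Gamma>" "Act False N \<in> \<Gamma>"
        using M N by simp_all
      show ?thesis
        using isom_mat_mult [OF i] \<Gamma>.m_closed [OF m] unfolding Act_mult [OF i] by simp
    qed
    show "matrix_inv M \<in> ?U" if M: "M \<in> ?U" for M
    proof -
      have i: "isom_mat False M" and m: "Act False M \<in> \<Gamma>" using M by simp_all
      obtain C where C: "isom_mat False C" "C ** M = mat 1" "matrix_inv M = C"
        using inv_mat [OF i] by blast
      show ?thesis using C(1) \<Gamma>.m_inv_closed [OF m] unfolding C(3) Act_inv [OF i C(1,2)] by simp
    qed
  qed
  moreover have "- mat 1 \<in> ?U"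
    using isom_mat_uminus [OF isom_mat_one] \<Gamma>.one_closed by (simp add: Act_uminus Act_one)
  moreover have "A \<in> ?U"
    using isoA \<Gamma>.m_closed [OF R\<Gamma>(2,1)] unfolding Act_mult [OF iso(2,1)] by (simp add: A Act_uminus)
  moreover have "B \<in> ?U"
    using isoB \<Gamma>.m_closed [OF R\<Gamma>(1,3)] unfolding Act_mult [OF iso(1,3)] by (simp add: B Act_uminus)
  ultimately have GU: "\<Union>?G \<subseteq> ?U" by (rule Union_generate_subset)
  have isoG: "isom_mat False M" and actG: "Act False M \<in> \<Gamma>" if "M \<in> \<Union>?G" for M
    using subsetD [OF GU that] by simp_all

  text \<open>Conjugation by \<open>R1\<close> inverts both generators, hence normalizes the group.\<close>
  have R1R1: "R1 ** (R1 ** M) = M" "(M ** R1) ** R1 = M" for M :: "complex^2^2"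
  proof -
    have "R1 ** (R1 ** M) = (R1 ** R1) ** M" "(M ** R1) ** R1 = M ** (R1 ** R1)"
      by (simp_all only: matrix_mul_assoc)
    then show "R1 ** (R1 ** M) = M" "(M ** R1) ** R1 = M" by (simp_all add: sq)
  qed
  have invA: "matrix_inv A = - (R1 ** R2)"
  proof (rule matrix_inv_unique [OF isom_mat_det [OF isoA]])
    have "A ** - (R1 ** R2) = R2 ** (R1 ** (R1 ** R2))"
      by (simp add: A matrix_mult_minus_left matrix_mult_minus_right matrix_mul_assoc)
    then show "A ** - (R1 ** R2) = mat 1" unfolding R1R1 sq .
  qed
  have invB: "matrix_inv B = - (R3 ** R1)"
  proof (rule matrix_inv_unique [OF isom_mat_det [OF isoB]])
    have "B ** - (R3 ** R1) = (R1 ** (R3 ** R3)) ** R1"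
      by (simp add: B matrix_mult_minus_left matrix_mult_minus_right matrix_mul_assoc)
    then show "B ** - (R3 ** R1) = mat 1" by (simp add: sq)
  qed
  have conjA: "R1 ** A ** R1 = matrix_inv A"
  proof -
    have "R1 ** A ** R1 = - (R1 ** (R2 ** R1 ** R1))"
      by (simp add: A matrix_mult_minus_left matrix_mult_minus_right matrix_mul_assoc)
    then show ?thesis unfolding R1R1 invA .
  qed
  have conjB: "R1 ** B ** R1 = matrix_inv B"
  proof -
    have "R1 ** B ** R1 = - (R1 ** (R1 ** R3) ** R1)"
      by (simp add: B matrix_mult_minus_left matrix_mult_minus_right)
    then show ?thesis unfolding R1R1 invB .
  qed
  have mG: "- mat 1 \<in> \<Union>?G"
    by (rule UnionI [OF generate.one]) (simp add: one_PSL2C)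
  have "\<Union>?G \<subseteq> {M. det M = 1 \<and> R1 ** M ** R1 \<in> \<Union>?G}"
  proof (rule Union_generate_subset)
    show "sl2_group {M. det M = 1 \<and> R1 ** M ** R1 \<in> \<Union>?G}"
      by (rule sl2_group_conj [OF G.sl2_group_axioms sq(1) sq(1)])
    show "- mat 1 \<in> {M. det M = 1 \<and> R1 ** M ** R1 \<in> \<Union>?G}"
      using mG by (simp add: det_minus_2 matrix_mult_minus_left matrix_mult_minus_right sq)
    show "A \<in> {M. det M = 1 \<and> R1 ** M ** R1 \<in> \<Union>?G}"
      using G.inv_closed [OF AG] isom_mat_det [OF isoA] unfolding mem_Collect_eq conjA by blast
    show "B \<in> {M. det M = 1 \<and> R1 ** M ** R1 \<in> \<Union>?G}"
      using G.inv_closed [OF BGm] isom_mat_det [OF isoB] unfolding mem_Collect_eq conjB by blast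
  qed
  then have conjG: "R1 ** M ** R1 \<in> \<Union>?G" if "M \<in> \<Union>?G" for M
    using subsetD [OF _ that] by blast
  let ?T = "Act False ` \<Union>?G \<union> (\<lambda>M. Act True (M ** R1)) ` \<Union>?G"
  have TI: "Act False M \<in> ?T" "Act True (M ** R1) \<in> ?T" if M: "M \<in> \<Union>?G" for M
  proof -
    show "Act False M \<in> ?T" by (rule UnI1) (rule imageI [OF M])
    show "Act True (M ** R1) \<in> ?T" by (rule UnI2) (rule image_eqI [OF refl M])
  qed
  have isoR: "isom_mat True (M ** R1)" if "M \<in> \<Union>?G" for M
    using isom_mat_mult [OF isoG [OF that] iso(1)] by simp
  have TE: "(\<exists>M. M \<in> \<Union>?G \<and> x = Act False M) \<or> (\<exists>M. M \<in> \<Union>?G \<and> x = Act True (M ** R1))" if x: "x \<in> ?T" for x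
    using x
  proof (elim UnE imageE)
    fix M assume "x = Act False M" "M \<in> \<Union>?G"
    then show ?thesis by (intro disjI1 exI conjI)
  next
    fix M assume "x = Act True (M ** R1)" "M \<in> \<Union>?G"
    then show ?thesis by (intro disjI2 exI conjI)
  qed
  have "subgroup ?T (BijGroup hyp_plane)"
  proof (rule BG.subgroupI)
    show "?T \<subseteq> carrier (BijGroup hyp_plane)"
    proof (intro Un_least image_subsetI)
      show "Act False M \<in> carrier (BijGroup hyp_plane)" if M: "M \<in> \<Union>?G" for M
        using Act_Bij [OF isoG [OF M]] by (simp add: BijGroup_def)
      show "Act True (M ** R1) \<in> carrier (BijGroup hyp_plane)" if M: "M \<in> \<Union>?G" for M
        using Act_Bij [OF isoR [OF M]] by (simp add: BijGroup_def)
    qed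
    show "?T \<noteq> {}" by (rule notI, use TI(1) [OF AG] in \<open>simp only: empty_iff\<close>)
  next
    fix x assume "x \<in> ?T"
    from TE [OF this] show "inv\<^bsub>BijGroup hyp_plane\<^esub> x \<in> ?T"
    proof (elim disjE exE conjE)
      fix M assume M: "M \<in> \<Union>?G" "x = Act False M"
      obtain C where C: "isom_mat False C" "C ** M = mat 1" "matrix_inv M = C"
        using inv_mat [OF isoG [OF M(1)]] by blast
      have "inv\<^bsub>BijGroup hyp_plane\<^esub> x = Act False (matrix_inv M)"
        unfolding M(2) C(3) by (rule Act_inv [OF isoG [OF M(1)] C(1,2)])
      then show ?thesis using TI(1) [OF G.inv_closed [OF M(1)]] by (simp only:)
    next
      fix M assume M: "M \<in> \<Union>?G" "x = Act True (M ** R1)"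
      define N where "N = R1 ** matrix_inv M ** R1"
      have N: "N \<in> \<Union>?G" unfolding N_def by (rule conjG [OF G.inv_closed [OF M(1)]])
      have "N ** R1 ** (M ** R1) = R1 ** (matrix_inv M ** (R1 ** (R1 ** M))) ** R1"
        unfolding N_def by (simp only: matrix_mul_assoc)
      also have "\<dots> = mat 1"
        unfolding R1R1 using det_one_inverse(2) [OF isom_mat_det [OF isoG [OF M(1)]]] by (simp add: sq)
      finally have "inv\<^bsub>BijGroup hyp_plane\<^esub> x = Act True (N ** R1)"
        unfolding M(2) by (rule Act_inv [OF isoR [OF M(1)] isoR [OF N]])
      then show ?thesis using TI(2) [OF N] by (simp only:)
    qed
  next
    fix x y assume "x \<in> ?T" "y \<in> ?T"
    from TE [OF this(1)] TE [OF this(2)] show "x \<otimes>\<^bsub>BijGroup hyp_plane\<^esub> y \<in> ?T"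
    proof (elim disjE exE conjE)
      fix M N assume M: "M \<in> \<Union>?G" "x = Act False M" and N: "N \<in> \<Union>?G" "y = Act False N"
      show ?thesis
        using TI(1) [OF G.mult_closed [OF M(1) N(1)]]
        unfolding M(2) N(2) Act_mult [OF isoG [OF M(1)] isoG [OF N(1)]] by simp
    next
      fix M N assume M: "M \<in> \<Union>?G" "x = Act False M" and N: "N \<in> \<Union>?G" "y = Act True (N ** R1)"
      show ?thesis
        using TI(2) [OF G.mult_closed [OF M(1) N(1)]]
        unfolding M(2) N(2) Act_mult [OF isoG [OF M(1)] isoR [OF N(1)]] matrix_mul_assoc by simp
    next
      fix M N assume M: "M \<in> \<Union>?G" "x = Act True (M ** R1)" and N: "N \<in> \<Union>?G" "y = Act False N"
      have "M ** R1 ** N = M ** (R1 ** N ** R1) ** R1"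
      proof -
        have "M ** (R1 ** N ** R1) ** R1 = M ** R1 ** (N ** R1 ** R1)" by (simp only: matrix_mul_assoc)
        then show ?thesis unfolding R1R1 ..
      qed
      then show ?thesis
        using TI(2) [OF G.mult_closed [OF M(1) conjG [OF N(1)]]]
        unfolding M(2) N(2) Act_mult [OF isoR [OF M(1)] isoG [OF N(1)]] by simp
    next
      fix M N assume M: "M \<in> \<Union>?G" "x = Act True (M ** R1)" and N: "N \<in> \<Union>?G" "y = Act True (N ** R1)"
      have "M ** R1 ** (N ** R1) = M ** (R1 ** N ** R1)" by (simp only: matrix_mul_assoc)
      then show ?thesis
        using TI(1) [OF G.mult_closed [OF M(1) conjG [OF N(1)]]]
        unfolding M(2) N(2) Act_mult [OF isoR [OF M(1)] isoR [OF N(1)]] by simp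
    qed
  qed
  moreover have "{Act True R1, Act True R2, Act True R3} \<subseteq> ?T"
  proof -
    have "Act True R1 \<in> ?T" using TI(2) [OF G.one_closed] by simp
    moreover have "Act True R2 \<in> ?T"
    proof -
      have "A ** R1 = - R2" unfolding A matrix_mult_minus_left R1R1 ..
      then show ?thesis using TI(2) [OF AG] by (simp add: Act_uminus)
    qed
    moreover have "Act True R3 \<in> ?T"
    proof -
      have "matrix_inv B ** R1 = - R3" unfolding invB matrix_mult_minus_left R1R1 ..
      then show ?thesis using TI(2) [OF G.inv_closed [OF BGm]] by (simp add: Act_uminus)
    qed
    ultimately show ?thesis by (intro insert_subsetI empty_subsetI)
  qed
  ultimately have \<Gamma>T: "\<Gamma> \<subseteq> ?T" unfolding \<Gamma> by (rule BG.generate_subgroup_incl [rotated])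
  have inPSL: "X \<in> carrier PSL2C" if "X \<in> ?G" for X by (rule GS.mem_carrier [OF that])
  show ?thesis
  proof (intro equalityI subsetI)
    fix X assume "X \<in> {X \<in> PSL2R. \<forall>M\<in>X. moebius M \<in> \<Gamma>}"
    then have X: "X \<in> carrier PSL2C" "\<forall>M\<in>X. \<forall>i j. M $ i $ j \<in> \<real>" "\<forall>M\<in>X. moebius M \<in> \<Gamma>"
      unfolding PSL2R_def mem_Collect_eq by (blast, blast, blast)
    obtain M where M: "det M = 1" "X = {M, - M}" using carrier_PSL2C [THEN iffD1, OF X(1)] by auto
    have MX: "M \<in> X" using M(2) by simp
    have m: "M $ i $ j = of_real (Re (M $ i $ j))" for i j
      using bspec [OF X(2) MX] by (simp add: of_real_Re)
    define a b c d where "a = Re (M$1$1)" and "b = Re (M$1$2)" and "c = Re (M$2$1)" and "d = Re (M$2$2)"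
    have Mr: "M = rmat a b c d" unfolding rmat_def a_def b_def c_def d_def m [symmetric] by (rule mk2_eta)
    have "complex_of_real (a * d - b * c) = 1" using M(1) unfolding Mr rmat_det .
    then have "a * d - b * c = 1" by (simp only: of_real_eq_1_iff)
    then have iM: "isom_mat False M" unfolding Mr by (intro isom_matI) simp
    have "Act False M \<in> \<Gamma>" using bspec [OF X(3) MX] unfolding moebius_Act .
    then have "Act False M \<in> ?T" by (rule subsetD [OF \<Gamma>T])
    from TE [OF this] show "X \<in> ?G"
    proof (elim disjE exE conjE)
      fix N assume N: "N \<in> \<Union>?G" "Act False M = Act False N"
      have "M = N \<or> M = - N" using Act_inj [OF iM isoG [OF N(1)] N(2)] by simp
      then have NX: "N \<in> X" using M(2) by auto
      obtain Y where Y: "Y \<in> ?G" "N \<in> Y" using N(1) by blast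
      have "X = Y" by (rule PSL2C_eqI [OF X(1) inPSL [OF Y(1)] NX Y(2)])
      then show ?thesis using Y(1) by simp
    next
      fix N assume N: "N \<in> \<Union>?G" "Act False M = Act True (N ** R1)"
      have False using Act_inj [OF iM isoR [OF N(1)] N(2)] by simp
      then show ?thesis ..
    qed
  next
    fix X assume X: "X \<in> ?G"
    have "A' $ i $ j \<in> \<real>" if A': "A' \<in> X" for A' i j
    proof -
      obtain a b c d where "A' = rmat a b c d" using isoG [OF UnionI [OF X A']] by (rule isom_matE)
      then show ?thesis using exhaust_2 [of i] exhaust_2 [of j] by (auto simp: rmat_def)
    qed
    then have "X \<in> PSL2R" using inPSL [OF X] by (simp add: PSL2R_def)
    moreover have "\<forall>M\<in>X. moebius M \<in> \<Gamma>"
      using actG [OF UnionI [OF X]] by (simp add: moebius_Act)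
    ultimately show "X \<in> {X \<in> PSL2R. \<forall>M\<in>X. moebius M \<in> \<Gamma>}" by simp
  qed
qed

section \<open>The (2,4,5) triangle and its rotations\<close>

text \<open>A point equal to \<open>u\<close> makes the quotient of disc coordinates 0, also when it
  is the divisor, and \<open>Arg 0 = 0\<close>.\<close>

lemma hyp_angle_distinct:
  assumes "hyp_angle u v w \<noteq> 0"
  shows "u \<noteq> v" "u \<noteq> w"
proof -
  have "to_disc u v \<noteq> 0 \<and> to_disc u w \<noteq> 0"
    using assms unfolding hyp_angle_def by (auto simp: Arg_zero)
  then show "u \<noteq> v" "u \<noteq> w" by (auto simp: to_disc_def)
qed

text \<open>\<open>A\<close>, \<open>B\<close> and \<open>A ** B\<close> are rotations about
  \<open>v\<close>, \<open>u\<close> and \<open>w\<close>. The minus signs, with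
  \<open>refl_mat_swap\<close>, turn \<open>A\<close> and \<open>A ** B\<close> into products of
  reflections in sides directed away from the respective vertex, so their traces are positive
  cosines; the trace of \<open>B\<close> is 0 with either sign.\<close>

lemma triangle_group_245:
  assumes "is_triangle_group 2 4 5 G"
  shows "\<exists>A B. G = generate PSL2C {{A, - A}, {B, - B}} \<and> group_245 A B (of_real (sqrt 2))"
proof -
  from assms[unfolded is_triangle_group_def] obtain u v w
    where H': "u \<in> hyp_plane" "v \<in> hyp_plane" "w \<in> hyp_plane"
    and ang': "hyp_angle u v w = pi / real 2 \<and> hyp_angle v w u = pi / real 4 \<and>
      hyp_angle w u v = pi / real 5 \<and> G = orientation_preserving_group u v w"
    by (elim bexE) (rule that; assumption)
  have H: "Im u > 0" "Im v > 0" "Im w > 0" using H' unfolding hyp_plane_def by simp_all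
  have ang: "hyp_angle u v w = pi / 2" "hyp_angle v w u = pi / 4" "hyp_angle w u v = pi / 5"
    and G: "G = orientation_preserving_group u v w"
    using ang' by simp_all
  have "hyp_angle u v w \<noteq> 0" "hyp_angle v w u \<noteq> 0" unfolding ang by simp_all
  then have ne: "u \<noteq> v" "u \<noteq> w" "v \<noteq> w"
    using hyp_angle_distinct(1,2) [of u v w] hyp_angle_distinct(1) [of v w u] by simp_all
  note ne' = ne [symmetric]
  define R1 R2 R3 where "R1 = refl_mat u v" and "R2 = refl_mat v w" and "R3 = refl_mat u w"
  have iso: "isom_mat True R1" "isom_mat True R2" "isom_mat True R3"
    unfolding R1_def R2_def R3_def by (intro refl_mat_isom H ne)+
  have sq: "R1 ** R1 = mat 1" "R2 ** R2 = mat 1" "R3 ** R3 = mat 1"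
    unfolding R1_def R2_def R3_def by (intro refl_mat_square H ne)+
  define A B where "A = - (R2 ** R1)" and "B = - (R1 ** R3)"
  have refl: "hyp_reflection u v = Act True R1" "hyp_reflection v w = Act True R2"
    "hyp_reflection w u = Act True R3"
  proof -
    show "hyp_reflection u v = Act True R1" "hyp_reflection v w = Act True R2"
      unfolding R1_def R2_def by (intro hyp_reflection_Act H ne)+
    have "hyp_reflection w u = Act True (refl_mat w u)"
      by (intro hyp_reflection_Act H ne')
    then show "hyp_reflection w u = Act True R3"
      unfolding R3_def refl_mat_swap [of w u] Act_uminus .
  qed
  have "G = generate PSL2C {{A, - A}, {B, - B}}"
    unfolding G orientation_preserving_group_def
    by (rule orientation_preserving_subgroup [OF iso sq A_def B_def])
      (simp only: reflection_group_def refl)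
  moreover have "group_245 A B (of_real (sqrt 2))"
  proof
    have "isom_mat False A" unfolding A_def using isom_mat_uminus [OF isom_mat_mult [OF iso(2,1)]] by simp
    then show "det A = 1" by (rule isom_mat_det)
    have "isom_mat False B" unfolding B_def using isom_mat_uminus [OF isom_mat_mult [OF iso(1,3)]] by simp
    then show "det B = 1" by (rule isom_mat_det)
    show "complex_of_real (sqrt 2) * complex_of_real (sqrt 2) = 2"
      unfolding of_real_mult [symmetric] by simp
    have tm: "trace (- X) = - trace X" for X :: "complex^2^2"
      by (simp add: trace_def sum_negf)
    have "A = refl_mat v w ** refl_mat v u"
      unfolding A_def R1_def R2_def refl_mat_swap [of u v] by (simp add: matrix_mult_minus_right)
    then have "trace A = of_real (2 * cos (pi / 4))"
      using trace_refl_mat [OF H(2,3) ne(3) H(1) ne'(1)] unfolding ang by simp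
    then show "trace A = complex_of_real (sqrt 2)" by (simp add: cos_45)
    have "trace (R1 ** R3) = of_real (2 * cos (pi / 2))"
      unfolding R1_def R3_def using trace_refl_mat [OF H(1,2) ne(1) H(3) ne(2)] unfolding ang .
    then show "trace B = 0" unfolding B_def tm by simp
    have "A ** B = R2 ** (R1 ** R1) ** R3"
      unfolding A_def B_def by (simp add: matrix_mult_minus_left matrix_mult_minus_right matrix_mul_assoc)
    also have "\<dots> = refl_mat w v ** refl_mat w u"
      unfolding sq unfolding R2_def R3_def refl_mat_swap [of w v] refl_mat_swap [of u w]
      by (simp add: matrix_mult_minus_left matrix_mult_minus_right)
    finally have AB: "A ** B = refl_mat w v ** refl_mat w u" .
    have "trace (A ** B) = trace (refl_mat w u ** refl_mat w v)"
      unfolding AB by (rule trace_mul_sym)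
    also have "\<dots> = of_real (2 * cos (pi / 5))"
      using trace_refl_mat [OF H(3,1) ne'(2) H(2) ne'(3)] unfolding ang .
    finally show "trace (A ** B) = complex_of_real golden" unfolding cos_pi_5 .
  qed
  ultimately show ?thesis by (intro exI conjI)
qed

lemma (in group_245) principal_character_245:
  "{A, - A} \<in> carrier PSL2C" "{B, - B} \<in> carrier PSL2C"
  "principal_character {A, - A} {B, - B} = (of_real ((sqrt 5 - 1) / 2), - 2, - 4)"
proof -
  show c: "{A, - A} \<in> carrier PSL2C" "{B, - B} \<in> carrier PSL2C"
    using carrier_PSL2C_I det by blast+
  have "beta {A, - A} = s * s - 4" using beta_eq [OF c(1), of A] tr(1) by (simp add: power2_eq_square)
  then have bA: "beta {A, - A} = - 2" unfolding s2 by simp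
  have bB: "beta {B, - B} = - 4" using beta_eq [OF c(2), of B] tr(2) by simp
  have "gamma {A, - A} {B, - B} = of_real golden * of_real golden - 2"
    using gamma_eq [OF c(1) _ c(2), of A B] trace_commutator(1) by simp
  also have "\<dots> = complex_of_real (golden * golden - 2)" by simp
  also have "golden * golden - 2 = (sqrt 5 - 1) / 2"
    unfolding golden_sq(1) by (simp add: golden_def field_simps)
  finally show "principal_character {A, - A} {B, - B} = (of_real ((sqrt 5 - 1) / 2), - 2, - 4)"
    unfolding principal_character_def bA bB by simp
qed

text \<open>The right angle is put at \<open>\<i>\<close>, one leg on the imaginary axis and one on the unit circle;
  \<open>T\<close> and \<open>t\<close> solve the angle conditions at the other two vertices.\<close>

lemma ex_triangle_group_245: "\<exists>G. is_triangle_group 2 4 5 G"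
proof -
  define C where "C = cos (pi / 5)"
  \<comment> \<open>For \<open>|w| = 1\<close> the angle at \<open>v\<close> demands
    \<open>t^2 - 1 = 2 T t\<close>, so \<open>t + 1 / t = 2 sqrt (1 + T^2)\<close>. The angle at
    \<open>w\<close> then has tangent \<open>S / sqrt (1 + T^2)\<close>; equating it to that of
    \<open>pi / 5\<close> gives \<open>S^2 = 2 sin^2 (pi / 5)\<close> and
    \<open>T^2 = cos (2 pi / 5)\<close>.\<close>
  define S where "S = sqrt 2 * sin (pi / 5)"
  define T where "T = sqrt (cos (2 * (pi / 5)))"
  define t where "t = T + sqrt 2 * C"
  have s0: "sin (pi / 5) > 0" by (rule sin_gt_zero) simp_all
  have C0: "C > 0" unfolding C_def by (rule cos_gt_zero) simp_all
  have c2: "cos (2 * (pi / 5)) > 0" by (rule cos_gt_zero) (simp_all add: field_simps)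
  have S0: "S > 0" using s0 by (simp add: S_def)
  have T0: "T > 0" using c2 by (simp add: T_def)
  have t0: "t > 0" using T0 C0 by (simp add: t_def add_pos_pos)
  have TT: "T * T = cos (2 * (pi / 5))" using c2 by (simp add: T_def)
  have r2: "sqrt 2 * sqrt 2 = (2::real)" by simp
  have sc: "sin (pi / 5) * sin (pi / 5) = 1 - C * C"
    using sin_squared_eq [of "pi / 5"] by (simp add: power2_eq_square C_def)
  have TC: "T * T = 2 * (C * C) - 1" unfolding TT cos_double_cos C_def by (simp add: power2_eq_square)
  have SS: "S * S = 2 * (1 - C * C)"
  proof -
    have "S * S = (sqrt 2 * sqrt 2) * (sin (pi / 5) * sin (pi / 5))" unfolding S_def by (simp only: mult_ac)
    then show ?thesis unfolding r2 sc .
  qed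
  have TS: "T * T + S * S = 1" unfolding SS TC by simp
  have "(t - T) * (t - T) = (sqrt 2 * sqrt 2) * (C * C)" unfolding t_def by (simp add: mult_ac)
  then have "(t - T) * (t - T) = 1 + T * T" unfolding r2 TC by simp
  then have tt: "t * t - 1 = 2 * T * t" by (simp add: algebra_simps)
  define u v w where "u = \<i>" and "v = Complex 0 t" and "w = Complex T S"
  have Hs: "u \<in> hyp_plane" "v \<in> hyp_plane" "w \<in> hyp_plane"
    using t0 S0 by (simp_all add: hyp_plane_def u_def v_def w_def)
  have t1: "t > 1"
  proof (rule ccontr)
    assume "\<not> t > 1"
    then have "t * t \<le> 1 * 1" using t0 by (intro mult_mono) auto
    moreover have "2 * T * t > 0" using T0 t0 by simp
    ultimately show False using tt by simp
  qed
  have ArgI: "\<bar>Arg z\<bar> = \<bar>\<theta>\<bar>" if "z = of_real r * cis \<theta>" "r > 0" "- pi < \<theta>" "\<theta> \<le> pi" for z r \<theta>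
  proof -
    have "Arg z = \<theta>"
      by (rule cis_Arg_unique) (use that in \<open>simp_all add: sgn_mult sgn_of_real\<close>)
    then show ?thesis by simp
  qed
  \<comment> \<open>A quotient is a positive multiple of the numerator times the conjugate of the
    denominator, so a polar form of that polynomial expression gives the angle.\<close>
  have angle: "hyp_angle a b c = \<bar>\<theta>\<bar>"
    if "(b - a) * cnj (b - cnj a) * cnj ((c - a) * cnj (c - cnj a)) = of_real r * cis \<theta>"
      "r > 0" "- pi < \<theta>" "\<theta> \<le> pi" "b - cnj a \<noteq> 0" "c - cnj a \<noteq> 0" "c \<noteq> a" for a b c r \<theta>
  proof -
    define k where "k = (cmod (b - cnj a))\<^sup>2"
    define k' where "k' = (cmod (c - cnj a))\<^sup>2"
    define m where "m = (cmod ((c - a) * cnj (c - cnj a)))\<^sup>2"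
    have "cnj (c - cnj a) \<noteq> 0" "c - a \<noteq> 0"
      using that(6,7) unfolding complex_cnj_zero_iff by simp_all
    then have pos: "k > 0" "k' > 0" "m > 0"
      using that(5,6) by (simp_all add: k_def k'_def m_def del: complex_cnj_diff)
    have d: "to_disc a b = (b - a) * cnj (b - cnj a) / of_real k"
      "to_disc a c = (c - a) * cnj (c - cnj a) / of_real k'"
      unfolding to_disc_def k_def k'_def by (rule complex_div_cnj)+
    have "to_disc a b / to_disc a c = of_real (k' / k) * ((b - a) * cnj (b - cnj a) / ((c - a) * cnj (c - cnj a)))"
      unfolding d by simp
    also have "(b - a) * cnj (b - cnj a) / ((c - a) * cnj (c - cnj a)) =
        (b - a) * cnj (b - cnj a) * cnj ((c - a) * cnj (c - cnj a)) / of_real m"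
      unfolding m_def by (rule complex_div_cnj)
    also have "\<dots> = of_real r * cis \<theta> / of_real m" unfolding that(1) ..
    also have "of_real (k' / k) * (of_real r * cis \<theta> / of_real m) = of_real (k' / k * r / m) * cis \<theta>"
      by simp
    finally show ?thesis
      unfolding hyp_angle_def using pos that(2-4) by (intro ArgI [of _ "k' / k * r / m"]) simp_all
  qed
  have tp: "t * t - 1 > 0" unfolding tt using T0 t0 by simp
  have tp': "t * t + 1 = 2 * (sqrt 2 * C) * t"
  proof -
    have e: "sqrt 2 * C = t - T" by (simp add: t_def)
    show ?thesis unfolding e using tt by (simp add: algebra_simps)
  qed
  have neq: "v - cnj u \<noteq> 0" "w - cnj u \<noteq> 0" "w \<noteq> u" "w - cnj v \<noteq> 0" "u - cnj v \<noteq> 0" "u \<noteq> v"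
    "u - cnj w \<noteq> 0" "v - cnj w \<noteq> 0" "v \<noteq> w"
    using t0 t1 S0 T0 by (auto simp: u_def v_def w_def complex_eq_iff)
  have au: "hyp_angle u v w = \<bar>pi / 2\<bar>"
  proof (rule angle [OF _ _ _ _ neq(1-3)])
    have "(v - u) * cnj (v - cnj u) * cnj ((w - u) * cnj (w - cnj u)) =
        Complex ((t * t - 1) * (T * T + S * S - 1)) ((t * t - 1) * (2 * T))"
      by (simp add: u_def v_def w_def complex_eq_iff algebra_simps)
    then show "(v - u) * cnj (v - cnj u) * cnj ((w - u) * cnj (w - cnj u)) = of_real ((t * t - 1) * (2 * T)) * cis (pi / 2)"
      unfolding TS by (simp add: complex_eq_iff)
    show "(t * t - 1) * (2 * T) > 0" using T0 tp by simp
  qed simp_all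
  have av: "hyp_angle v w u = \<bar>pi / 4\<bar>"
  proof (rule angle [OF _ _ _ _ neq(4-6)])
    have e: "2 * (T * t) = t * t - 1" using tt by simp
    have "(w - v) * cnj (w - cnj v) * cnj ((u - v) * cnj (u - cnj v)) =
        Complex ((T * T + S * S - t * t) * (1 - t * t)) (- (2 * (T * t) * (1 - t * t)))"
      by (simp add: u_def v_def w_def complex_eq_iff algebra_simps)
    also have "\<dots> = Complex ((t * t - 1) * (t * t - 1)) ((t * t - 1) * (t * t - 1))"
      unfolding TS e by (simp add: algebra_simps)
    also have "\<dots> = of_real ((t * t - 1) * (t * t - 1) * sqrt 2) * cis (pi / 4)"
      by (simp add: complex_eq_iff cos_45 sin_45 algebra_simps)
    finally show "(w - v) * cnj (w - cnj v) * cnj ((u - v) * cnj (u - cnj v)) =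
      of_real ((t * t - 1) * (t * t - 1) * sqrt 2) * cis (pi / 4)" .
    show "(t * t - 1) * (t * t - 1) * sqrt 2 > 0" using tp by (intro mult_pos_pos) simp_all
    show "- pi < pi / 4" "pi / 4 \<le> pi" using pi_gt_zero by linarith+
  qed
  have aw: "hyp_angle w u v = \<bar>pi / 5\<bar>"
  proof (rule angle [OF _ _ _ _ neq(7-9)])
    have "(u - w) * cnj (u - cnj w) * cnj ((v - w) * cnj (v - cnj w)) =
        Complex ((1 + T * T - S * S) * (t * t + T * T - S * S) + 4 * (T * T) * (S * S)) (2 * (T * S) * (t * t - 1))"
      by (simp add: u_def v_def w_def complex_eq_iff algebra_simps)
    also have "(1 + T * T - S * S) * (t * t + T * T - S * S) + 4 * (T * T) * (S * S) = 2 * (T * T) * (t * t + 1)"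
      using TS by algebra
    also have "2 * (T * S) * (t * t - 1) = 4 * (T * T) * t * S" unfolding tt by simp
    also have "Complex (2 * (T * T) * (t * t + 1)) (4 * (T * T) * t * S) = of_real (2 * (T * T) * (t * t + 1) / C) * cis (pi / 5)"
    proof -
      have "2 * (T * T) * (t * t + 1) / C * sin (pi / 5) = 4 * (T * T) * t * S"
        unfolding tp' S_def using C0 by simp
      then show ?thesis using C0 by (simp add: complex_eq_iff C_def [symmetric])
    qed
    finally show "(u - w) * cnj (u - cnj w) * cnj ((v - w) * cnj (v - cnj w)) =
      of_real (2 * (T * T) * (t * t + 1) / C) * cis (pi / 5)" .
    have "t * t + 1 > 0" using tp by linarith
    then show "2 * (T * T) * (t * t + 1) / C > 0" using T0 C0 by simp
    show "- pi < pi / 5" "pi / 5 \<le> pi" using pi_gt_zero by linarith+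
  qed
  have "is_triangle_group 2 4 5 (orientation_preserving_group u v w)"
    unfolding is_triangle_group_def
    by (rule bexI [OF _ Hs(1)], rule bexI [OF _ Hs(2)], rule bexI [OF _ Hs(3)]) (simp add: au av aw)
  then show ?thesis by (rule exI)
qed

theorem theorem25:
  shows "(\<forall>f \<in> carrier PSL2C. \<forall>g \<in> carrier PSL2C. \<forall>\<gamma> \<beta> :: complex.
            kleinian (generate PSL2C {f, g}) \<and> principal_character f g = (\<gamma>, \<beta>, -4)
            \<longrightarrow> cmod \<gamma> + cmod (\<beta> + 2) \<ge> (sqrt 5 - 1) / 2)
       \<and> (\<exists>G. is_triangle_group 2 4 5 G)
       \<and> (\<forall>G. is_triangle_group 2 4 5 G \<longrightarrow>
            kleinian G \<and>
            (\<exists>f \<in> carrier PSL2C. \<exists>g \<in> carrier PSL2C. \<exists>\<gamma> \<beta> :: complex.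
               generate PSL2C {f, g} = G \<and>
               principal_character f g = (\<gamma>, \<beta>, -4) \<and>
               \<gamma> = complex_of_real ((sqrt 5 - 1) / 2) \<and> \<beta> = -2 \<and>
               cmod \<gamma> + cmod (\<beta> + 2) = (sqrt 5 - 1) / 2))"
proof (intro conjI allI ballI impI)
  fix f g \<gamma> \<beta>
  assume f: "f \<in> carrier PSL2C" and g: "g \<in> carrier PSL2C"
    and K: "kleinian (generate PSL2C {f, g}) \<and> principal_character f g = (\<gamma>, \<beta>, -4)"
  then have "gamma f g = \<gamma>" "beta f = \<beta>" "beta g = - 4" by (simp_all add: principal_character_def)
  with kleinian_lower_bound [OF f g conjunct1 [OF K]]
  show "cmod \<gamma> + cmod (\<beta> + 2) \<ge> (sqrt 5 - 1) / 2" by simp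
next
  show "\<exists>G. is_triangle_group 2 4 5 G" by (rule ex_triangle_group_245)
next
  fix G assume "is_triangle_group 2 4 5 G"
  from triangle_group_245 [OF this] obtain A B
    where G: "G = generate PSL2C {{A, - A}, {B, - B}}" and 245: "group_245 A B (of_real (sqrt 2))"
    by blast
  interpret group_245 A B "of_real (sqrt 2)" by (rule 245)
  show "kleinian G" unfolding G by (rule kleinian)
  have "sqrt 5 \<ge> 1" by simp
  then have "cmod (complex_of_real ((sqrt 5 - 1) / 2)) + cmod (- 2 + 2 :: complex) = (sqrt 5 - 1) / 2"
    by (simp only: norm_of_real) simp
  then show "\<exists>f \<in> carrier PSL2C. \<exists>g \<in> carrier PSL2C. \<exists>\<gamma> \<beta> :: complex.
      generate PSL2C {f, g} = G \<and> principal_character f g = (\<gamma>, \<beta>, -4) \<and>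
      \<gamma> = complex_of_real ((sqrt 5 - 1) / 2) \<and> \<beta> = -2 \<and>
      cmod \<gamma> + cmod (\<beta> + 2) = (sqrt 5 - 1) / 2"
    using principal_character_245
    by (intro bexI [of _ "{A, - A}"] bexI [of _ "{B, - B}"] exI conjI) (simp_all only: G)
qed

end
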